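(* Let $T$ be a consistent primitive recursively axiomatized $\mathcal{L}_A$-theory containing $\mathsf{PA}$. Then there exists a $\Sigma_1$ provability predicate $\mathrm{Pr}_T(x)$ of $T$ such that (1) for any modal formula $A$ and any arithmetical interpretation $f$ based on $\mathrm{Pr}_T(x)$, if $\mathbf{N4} \vdash A$, then $\mathsf{PA} \vdash f(A)$; and (2) there exists an arithmetical interpretation $f$ based on $\mathrm{Pr}_T(x)$ such that for any modal formula $A$, $\mathbf{N4} \vdash A$ if and only if $T \vdash f(A)$.
   Context: $\mathcal{L}_A$ is the language of first-order arithmetic. An $\mathcal{L}_A$-formula $\mathrm{Pr}_T(x)$ is a provability predicate of $T$ if for every $\mathcal{L}_A$-formula $\varphi$, $T \vdash \varphi$ iff $\mathsf{PA} \vdash \mathrm{Pr}_T(\ulcorner \varphi \urcorner)$. Modal formulas are built from propositional variables and $\bot$ using $\neg,\land,\lor,\to$ and $\Box$. An arithmetical interpretation based on $\mathrm{Pr}_T(x)$ is a map $f$ from modal formulas to $\mathcal{L}_A$-sentences with $f(p)$ arbitrary for variables, $f(\bot)$ being $0=1$, $f$ commuting with Boolean connectives, and $f(\Box A)$ being $\mathrm{Pr}_T(\ulcorner f(A)\urcorner)$. The logic $\mathbf{N}$ has all propositional tautologies as axioms and Modus Ponens and Necessitation $A/\Box A$ as rules; $\mathbf{N4}$ is obtained from $\mathbf{N}$ by adding the axiom scheme $\Box B \to \Box\Box B$. *)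

theory Defs
  imports Main "HOL-Library.Nat_Bijection"
begin

section \<open>First-order arithmetic\<close>

text \<open>The language has the symbols \<open>0, S, +, \<times>, \<le>, =\<close>.  Bound variables are de Bruijn
  indices; in a formula under \<open>k\<close> quantifiers, the index \<open>k + i\<close> denotes the \<open>i\<close>-th free variable.\<close>

datatype tm = Var nat | Zero | Succ tm | Add tm tm | Mul tm tm

datatype fm =
    Eq tm tm
  | Le tm tm
  | Neg fm
  | Conj fm fm
  | Disj fm fm
  | Imp fm fm
  | Forall fm
  | Exists fm

primrec fv_tm :: "tm \<Rightarrow> nat set" where
  "fv_tm (Var n) = {n}"
| "fv_tm Zero = {}"
| "fv_tm (Succ t) = fv_tm t"
| "fv_tm (Add s t) = fv_tm s \<union> fv_tm t"
| "fv_tm (Mul s t) = fv_tm s \<union> fv_tm t"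

primrec fv :: "fm \<Rightarrow> nat set" where
  "fv (Eq s t) = fv_tm s \<union> fv_tm t"
| "fv (Le s t) = fv_tm s \<union> fv_tm t"
| "fv (Neg \<phi>) = fv \<phi>"
| "fv (Conj \<phi> \<psi>) = fv \<phi> \<union> fv \<psi>"
| "fv (Disj \<phi> \<psi>) = fv \<phi> \<union> fv \<psi>"
| "fv (Imp \<phi> \<psi>) = fv \<phi> \<union> fv \<psi>"
| "fv (Forall \<phi>) = {n. Suc n \<in> fv \<phi>}"
| "fv (Exists \<phi>) = {n. Suc n \<in> fv \<phi>}"

definition sentence :: "fm \<Rightarrow> bool" where
  "sentence \<phi> \<longleftrightarrow> fv \<phi> = {}"

primrec subst_tm :: "(nat \<Rightarrow> tm) \<Rightarrow> tm \<Rightarrow> tm" where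
  "subst_tm \<sigma> (Var n) = \<sigma> n"
| "subst_tm \<sigma> Zero = Zero"
| "subst_tm \<sigma> (Succ t) = Succ (subst_tm \<sigma> t)"
| "subst_tm \<sigma> (Add s t) = Add (subst_tm \<sigma> s) (subst_tm \<sigma> t)"
| "subst_tm \<sigma> (Mul s t) = Mul (subst_tm \<sigma> s) (subst_tm \<sigma> t)"

definition lift_tm :: "tm \<Rightarrow> tm" where
  "lift_tm = subst_tm (\<lambda>i. Var (Suc i))"

definition up :: "(nat \<Rightarrow> tm) \<Rightarrow> nat \<Rightarrow> tm" where
  "up \<sigma> = case_nat (Var 0) (\<lambda>i. lift_tm (\<sigma> i))"

primrec subst :: "(nat \<Rightarrow> tm) \<Rightarrow> fm \<Rightarrow> fm" where
  "subst \<sigma> (Eq s t) = Eq (subst_tm \<sigma> s) (subst_tm \<sigma> t)"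
| "subst \<sigma> (Le s t) = Le (subst_tm \<sigma> s) (subst_tm \<sigma> t)"
| "subst \<sigma> (Neg \<phi>) = Neg (subst \<sigma> \<phi>)"
| "subst \<sigma> (Conj \<phi> \<psi>) = Conj (subst \<sigma> \<phi>) (subst \<sigma> \<psi>)"
| "subst \<sigma> (Disj \<phi> \<psi>) = Disj (subst \<sigma> \<phi>) (subst \<sigma> \<psi>)"
| "subst \<sigma> (Imp \<phi> \<psi>) = Imp (subst \<sigma> \<phi>) (subst \<sigma> \<psi>)"
| "subst \<sigma> (Forall \<phi>) = Forall (subst (up \<sigma>) \<phi>)"
| "subst \<sigma> (Exists \<phi>) = Exists (subst (up \<sigma>) \<phi>)"

definition lift :: "fm \<Rightarrow> fm" where
  "lift = subst (\<lambda>i. Var (Suc i))"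

text \<open>Instantiation of the variable \<open>0\<close>, the remaining free variables being shifted down.\<close>

definition inst :: "fm \<Rightarrow> tm \<Rightarrow> fm" where
  "inst \<phi> t = subst (case_nat t Var) \<phi>"

definition univ_closure :: "fm \<Rightarrow> fm" where
  "univ_closure \<phi> = (Forall ^^ (LEAST n. fv \<phi> \<subseteq> {..<n})) \<phi>"


section \<open>Provability and Peano arithmetic\<close>

text \<open>A Hilbert calculus for classical first-order logic with equality.\<close>

inductive logical_axiom :: "fm \<Rightarrow> bool" where
  imp_K: "logical_axiom (Imp \<phi> (Imp \<psi> \<phi>))"
| imp_S: "logical_axiom (Imp (Imp \<phi> (Imp \<psi> \<chi>)) (Imp (Imp \<phi> \<psi>) (Imp \<phi> \<chi>)))"
| conj_intro: "logical_axiom (Imp \<phi> (Imp \<psi> (Conj \<phi> \<psi>)))"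
| conj_elim1: "logical_axiom (Imp (Conj \<phi> \<psi>) \<phi>)"
| conj_elim2: "logical_axiom (Imp (Conj \<phi> \<psi>) \<psi>)"
| disj_intro1: "logical_axiom (Imp \<phi> (Disj \<phi> \<psi>))"
| disj_intro2: "logical_axiom (Imp \<psi> (Disj \<phi> \<psi>))"
| disj_elim: "logical_axiom (Imp (Imp \<phi> \<chi>) (Imp (Imp \<psi> \<chi>) (Imp (Disj \<phi> \<psi>) \<chi>)))"
| neg_intro: "logical_axiom (Imp (Imp \<phi> \<psi>) (Imp (Imp \<phi> (Neg \<psi>)) (Neg \<phi>)))"
| neg_neg: "logical_axiom (Imp (Neg (Neg \<phi>)) \<phi>)"
| forall_elim: "logical_axiom (Imp (Forall \<phi>) (inst \<phi> t))"
| forall_intro: "logical_axiom (Imp (Forall (Imp (lift \<phi>) \<psi>)) (Imp \<phi> (Forall \<psi>)))"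
| exists_intro: "logical_axiom (Imp (inst \<phi> t) (Exists \<phi>))"
| exists_elim: "logical_axiom (Imp (Forall (Imp \<phi> (lift \<psi>))) (Imp (Exists \<phi>) \<psi>))"
| eq_refl: "logical_axiom (Eq t t)"
| eq_subst: "logical_axiom (Imp (Eq s t) (Imp (inst \<phi> s) (inst \<phi> t)))"

inductive proves :: "fm set \<Rightarrow> fm \<Rightarrow> bool" (infix "\<turnstile>" 50) for T :: "fm set" where
  axiom: "\<phi> \<in> T \<Longrightarrow> T \<turnstile> \<phi>"
| logical: "logical_axiom \<phi> \<Longrightarrow> T \<turnstile> \<phi>"
| mp: "T \<turnstile> Imp \<phi> \<psi> \<Longrightarrow> T \<turnstile> \<phi> \<Longrightarrow> T \<turnstile> \<psi>"
| gen: "T \<turnstile> \<phi> \<Longrightarrow> T \<turnstile> Forall \<phi>"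

definition consistent :: "fm set \<Rightarrow> bool" where
  "consistent T \<longleftrightarrow> \<not> (\<exists>\<phi>. T \<turnstile> \<phi> \<and> T \<turnstile> Neg \<phi>)"

definition induction_formula :: "fm \<Rightarrow> fm" where
  "induction_formula \<phi> =
     Imp (Conj (inst \<phi> Zero)
               (Forall (Imp \<phi> (subst (case_nat (Succ (Var 0)) (\<lambda>i. Var (Suc i))) \<phi>))))
         (Forall \<phi>)"

inductive_set PA :: "fm set" where
  succ_nonzero: "univ_closure (Neg (Eq (Succ (Var 0)) Zero)) \<in> PA"
| succ_inj: "univ_closure (Imp (Eq (Succ (Var 0)) (Succ (Var 1))) (Eq (Var 0) (Var 1))) \<in> PA"
| add_zero: "univ_closure (Eq (Add (Var 0) Zero) (Var 0)) \<in> PA"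
| add_succ: "univ_closure (Eq (Add (Var 0) (Succ (Var 1))) (Succ (Add (Var 0) (Var 1)))) \<in> PA"
| mul_zero: "univ_closure (Eq (Mul (Var 0) Zero) Zero) \<in> PA"
| mul_succ: "univ_closure (Eq (Mul (Var 0) (Succ (Var 1))) (Add (Mul (Var 0) (Var 1)) (Var 0))) \<in> PA"
| le_elim: "univ_closure
    (Imp (Le (Var 0) (Var 1)) (Exists (Eq (Add (Var 0) (Var 1)) (Var 2)))) \<in> PA"
| le_intro: "univ_closure
    (Imp (Exists (Eq (Add (Var 0) (Var 1)) (Var 2))) (Le (Var 0) (Var 1))) \<in> PA"
| induction: "univ_closure (induction_formula \<phi>) \<in> PA"


section \<open>\<open>\<Sigma>\<^sub>1\<close> formulas\<close>

inductive Delta0 :: "fm \<Rightarrow> bool" where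
  "Delta0 (Eq s t)"
| "Delta0 (Le s t)"
| "Delta0 \<phi> \<Longrightarrow> Delta0 (Neg \<phi>)"
| "Delta0 \<phi> \<Longrightarrow> Delta0 \<psi> \<Longrightarrow> Delta0 (Conj \<phi> \<psi>)"
| "Delta0 \<phi> \<Longrightarrow> Delta0 \<psi> \<Longrightarrow> Delta0 (Disj \<phi> \<psi>)"
| "Delta0 \<phi> \<Longrightarrow> Delta0 \<psi> \<Longrightarrow> Delta0 (Imp \<phi> \<psi>)"
| "Delta0 \<phi> \<Longrightarrow> Delta0 (Forall (Imp (Le (Var 0) (lift_tm t)) \<phi>))"
| "Delta0 \<phi> \<Longrightarrow> Delta0 (Exists (Conj (Le (Var 0) (lift_tm t)) \<phi>))"

inductive Sigma1 :: "fm \<Rightarrow> bool" where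
  "Delta0 \<phi> \<Longrightarrow> Sigma1 \<phi>"
| "Sigma1 \<phi> \<Longrightarrow> Sigma1 (Exists \<phi>)"


section \<open>Goedel numbers and primitive recursive axiomatizations\<close>

primrec gn_tm :: "tm \<Rightarrow> nat" where
  "gn_tm (Var n) = prod_encode (0, n)"
| "gn_tm Zero = prod_encode (1, 0)"
| "gn_tm (Succ t) = prod_encode (2, gn_tm t)"
| "gn_tm (Add s t) = prod_encode (3, prod_encode (gn_tm s, gn_tm t))"
| "gn_tm (Mul s t) = prod_encode (4, prod_encode (gn_tm s, gn_tm t))"

primrec gn :: "fm \<Rightarrow> nat" where
  "gn (Eq s t) = prod_encode (0, prod_encode (gn_tm s, gn_tm t))"
| "gn (Le s t) = prod_encode (1, prod_encode (gn_tm s, gn_tm t))"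
| "gn (Neg \<phi>) = prod_encode (2, gn \<phi>)"
| "gn (Conj \<phi> \<psi>) = prod_encode (3, prod_encode (gn \<phi>, gn \<psi>))"
| "gn (Disj \<phi> \<psi>) = prod_encode (4, prod_encode (gn \<phi>, gn \<psi>))"
| "gn (Imp \<phi> \<psi>) = prod_encode (5, prod_encode (gn \<phi>, gn \<psi>))"
| "gn (Forall \<phi>) = prod_encode (6, gn \<phi>)"
| "gn (Exists \<phi>) = prod_encode (7, gn \<phi>)"

definition numeral_tm :: "nat \<Rightarrow> tm" where
  "numeral_tm n = (Succ ^^ n) Zero"

text \<open>The \<open>n\<close>-ary primitive recursive functions; only the values on lists of length \<open>n\<close> matter.\<close>

inductive prim_rec :: "nat \<Rightarrow> (nat list \<Rightarrow> nat) \<Rightarrow> bool" where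
  zero: "prim_rec n (\<lambda>xs. 0)"
| succ: "prim_rec 1 (\<lambda>xs. Suc (xs ! 0))"
| proj: "i < n \<Longrightarrow> prim_rec n (\<lambda>xs. xs ! i)"
| comp: "prim_rec (length gs) f \<Longrightarrow> (\<And>g. g \<in> set gs \<Longrightarrow> prim_rec n g) \<Longrightarrow>
    prim_rec n (\<lambda>xs. f (map (\<lambda>g. g xs) gs))"
| rec: "prim_rec n f \<Longrightarrow> prim_rec (Suc (Suc n)) g \<Longrightarrow>
    prim_rec (Suc n) (\<lambda>xs. rec_nat (f (tl xs)) (\<lambda>y r. g (y # r # tl xs)) (hd xs))"

definition prim_rec_set :: "nat set \<Rightarrow> bool" where
  "prim_rec_set A \<longleftrightarrow> (\<exists>f. prim_rec 1 f \<and> (\<forall>n. f [n] = (if n \<in> A then 1 else 0)))"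

text \<open>A theory is given by its set of axioms, which are sentences.\<close>

definition prim_rec_axiomatized_theory :: "fm set \<Rightarrow> bool" where
  "prim_rec_axiomatized_theory T \<longleftrightarrow> (\<forall>\<phi>\<in>T. sentence \<phi>) \<and> prim_rec_set (gn ` T)"

definition contains_theory :: "fm set \<Rightarrow> fm set \<Rightarrow> bool" where
  "contains_theory T U \<longleftrightarrow> (\<forall>\<phi>. U \<turnstile> \<phi> \<longrightarrow> T \<turnstile> \<phi>)"


section \<open>Provability predicates\<close>

definition apply_code :: "fm \<Rightarrow> fm \<Rightarrow> fm" where
  "apply_code P \<phi> = inst P (numeral_tm (gn \<phi>))"

text \<open>The variable \<open>x\<close> of the predicate is the one with index \<open>0\<close>.\<close>

definition provability_predicate :: "fm set \<Rightarrow> fm \<Rightarrow> bool" where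
  "provability_predicate T P \<longleftrightarrow>
     fv P \<subseteq> {0} \<and> (\<forall>\<phi>. T \<turnstile> \<phi> \<longleftrightarrow> PA \<turnstile> apply_code P \<phi>)"


section \<open>Modal logic\<close>

datatype mfm =
    MVar nat
  | MBot
  | MNeg mfm
  | MConj mfm mfm
  | MDisj mfm mfm
  | MImp mfm mfm
  | Box mfm

text \<open>Truth under a Boolean valuation that treats variables and boxed formulas as atoms.\<close>

primrec bool_eval :: "(mfm \<Rightarrow> bool) \<Rightarrow> mfm \<Rightarrow> bool" where
  "bool_eval v (MVar n) \<longleftrightarrow> v (MVar n)"
| "bool_eval v MBot \<longleftrightarrow> False"
| "bool_eval v (MNeg A) \<longleftrightarrow> \<not> bool_eval v A"
| "bool_eval v (MConj A B) \<longleftrightarrow> bool_eval v A \<and> bool_eval v B"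
| "bool_eval v (MDisj A B) \<longleftrightarrow> bool_eval v A \<or> bool_eval v B"
| "bool_eval v (MImp A B) \<longleftrightarrow> (bool_eval v A \<longrightarrow> bool_eval v B)"
| "bool_eval v (Box A) \<longleftrightarrow> v (Box A)"

definition tautology :: "mfm \<Rightarrow> bool" where
  "tautology A \<longleftrightarrow> (\<forall>v. bool_eval v A)"

text \<open>The logic obtained from \<open>\<^bold>N\<close> by adding the formulas in \<open>X\<close> as axioms.\<close>

inductive N_plus :: "mfm set \<Rightarrow> mfm \<Rightarrow> bool" for X :: "mfm set" where
  taut: "tautology A \<Longrightarrow> N_plus X A"
| extra: "A \<in> X \<Longrightarrow> N_plus X A"
| mp: "N_plus X (MImp A B) \<Longrightarrow> N_plus X A \<Longrightarrow> N_plus X B"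
| nec: "N_plus X A \<Longrightarrow> N_plus X (Box A)"

definition N4 :: "mfm \<Rightarrow> bool" where
  "N4 = N_plus {MImp (Box B) (Box (Box B)) | B. True}"

definition arith_interpretation :: "fm \<Rightarrow> (mfm \<Rightarrow> fm) \<Rightarrow> bool" where
  "arith_interpretation P f \<longleftrightarrow>
     (\<forall>A. sentence (f A)) \<and>
     f MBot = Eq Zero (Succ Zero) \<and>
     (\<forall>A. f (MNeg A) = Neg (f A)) \<and>
     (\<forall>A B. f (MConj A B) = Conj (f A) (f B)) \<and>
     (\<forall>A B. f (MDisj A B) = Disj (f A) (f B)) \<and>
     (\<forall>A B. f (MImp A B) = Imp (f A) (f B)) \<and>
     (\<forall>A. f (Box A) = apply_code P (f A))"

end

theory Submission
  imports Defs "HOL-Number_Theory.Cong"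
begin

text \<open>Let \<open>Pr(x)\<close> say: \<open>x\<close> arises by finitely many iterations of \<open>y \<mapsto> gn(Pr(y))\<close> from some \<open>y \<le> x\<close> that was
  admitted at some stage. The iteration relation is decidable and binumerated by a Rosser formula, so
  \<open>Pr(\<phi>) \<longrightarrow> Pr(Pr(\<phi>))\<close> is provable in \<open>PA\<close> by a finite case distinction on \<open>y\<close>, without formalized
  \<open>\<Sigma>\<^sub>1\<close>-completeness. Stages admit the theorems of \<open>T\<close> until a bell rings: a stage at which some \<open>f(B)\<close> has
  been proved in \<open>T\<close> and which carries a finite set \<open>L\<close> such that \<open>B\<close> becomes false when \<open>Pr\<close> is read as the
  closure of \<open>L\<close> and the theorems found so far. At the first bell \<open>L\<close> is admitted and the enumeration stops,
  hence \<open>PA\<close> decides every \<open>Pr(a)\<close> and refutes \<open>f(B)\<close>. As \<open>T\<close> is consistent, no bell ever rings, and \<open>Pr\<close>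
  numerates \<open>T\<close>. On the other hand, if \<open>T \<turnstile> f(B)\<close> for a non-theorem \<open>B\<close> of \<open>N4\<close>, then one of least size
  would ring a bell.\<close>

section \<open>Substitution\<close>

text \<open>N4 has no distribution axiom for the box. All that \<open>Pr\<close> has to define is
  therefore a set that contains the theorems and is closed under the iteration, and in the
  completeness half a Boolean valuation of the boxed subformulas takes the place of a Kripke model.
  The predicate speaks about its own code. It comes from diagonalization: every relation of the
  construction carries a parameter \<open>c\<close>, and \<open>c\<close> is finally set to the code
  of the formula in which it is a variable. The stop condition supplies a numeral that bounds the
  stages, and \<open>y\<close> is bounded by \<open>a\<close>, so finitely many cases remain; Rosser
  formulas make each of them refutable while the witness is still a free variable. Since a stage may
  carry any finite set, the search for a bell runs through all possible countermodels, and nothing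
  about N4 has to be expressed in arithmetic.\<close>

lemma subst_tm_cong: "(\<And>i. i \<in> fv_tm t \<Longrightarrow> \<sigma> i = \<tau> i) \<Longrightarrow> subst_tm \<sigma> t = subst_tm \<tau> t"
  by (induction t) auto

lemma up_simps [simp]: "up \<sigma> 0 = Var 0" "up \<sigma> (Suc i) = lift_tm (\<sigma> i)"
  by (simp_all add: up_def)

lemma subst_cong: "(\<And>i. i \<in> fv \<phi> \<Longrightarrow> \<sigma> i = \<tau> i) \<Longrightarrow> subst \<sigma> \<phi> = subst \<tau> \<phi>"
proof (induction \<phi> arbitrary: \<sigma> \<tau>)
  case (Eq s t) then show ?case by (auto intro: subst_tm_cong)
next
  case (Le s t) then show ?case by (auto intro: subst_tm_cong)
next
  case (Neg \<phi>)
  show ?case using Neg.IH[of \<sigma> \<tau>] Neg.prems by simp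
next
  case (Conj \<phi> \<psi>)
  show ?case using Conj.IH(1)[of \<sigma> \<tau>] Conj.IH(2)[of \<sigma> \<tau>] Conj.prems by simp
next
  case (Disj \<phi> \<psi>)
  show ?case using Disj.IH(1)[of \<sigma> \<tau>] Disj.IH(2)[of \<sigma> \<tau>] Disj.prems by simp
next
  case (Imp \<phi> \<psi>)
  show ?case using Imp.IH(1)[of \<sigma> \<tau>] Imp.IH(2)[of \<sigma> \<tau>] Imp.prems by simp
next
  case (Forall \<phi>)
  have "subst (up \<sigma>) \<phi> = subst (up \<tau>) \<phi>"
  proof (rule Forall.IH)
    fix i assume "i \<in> fv \<phi>" then show "up \<sigma> i = up \<tau> i"
      using Forall.prems by (cases i) auto
  qed
  then show ?case by simp
next
  case (Exists \<phi>)
  have "subst (up \<sigma>) \<phi> = subst (up \<tau>) \<phi>"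
  proof (rule Exists.IH)
    fix i assume "i \<in> fv \<phi>" then show "up \<sigma> i = up \<tau> i"
      using Exists.prems by (cases i) auto
  qed
  then show ?case by simp
qed

lemma subst_tm_Var [simp]: "subst_tm Var t = t"
  by (induction t) auto

lemma up_Var [simp]: "up Var = Var"
proof
  fix i show "up Var i = Var i" by (cases i) (auto simp: lift_tm_def)
qed

lemma subst_Var [simp]: "subst Var \<phi> = \<phi>"
  by (induction \<phi>) auto

lemma subst_sentence: "sentence \<phi> \<Longrightarrow> subst \<sigma> \<phi> = \<phi>"
  using subst_cong[of \<phi> \<sigma> Var] by (simp add: sentence_def)

lemma subst_tm_comp: "subst_tm \<sigma> (subst_tm \<tau> t) = subst_tm (\<lambda>i. subst_tm \<sigma> (\<tau> i)) t"
  by (induction t) auto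

lemma subst_tm_lift: "subst_tm \<sigma> (lift_tm t) = subst_tm (\<lambda>i. \<sigma> (Suc i)) t"
  by (simp add: lift_tm_def subst_tm_comp)

lemma subst_tm_up_lift: "subst_tm (up \<sigma>) (lift_tm t) = lift_tm (subst_tm \<sigma> t)"
  by (simp add: subst_tm_lift) (simp add: lift_tm_def subst_tm_comp)

lemma subst_tm_inst_lift [simp]: "subst_tm (case_nat u Var) (lift_tm t) = t"
  by (simp add: subst_tm_lift)

lemma subst_up_comp: "(\<lambda>i. subst_tm (up \<sigma>) (up \<tau> i)) = up (\<lambda>i. subst_tm \<sigma> (\<tau> i))"
proof
  fix i show "subst_tm (up \<sigma>) (up \<tau> i) = up (\<lambda>i. subst_tm \<sigma> (\<tau> i)) i"
    by (cases i) (auto simp: subst_tm_up_lift)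
qed

lemma subst_comp: "subst \<sigma> (subst \<tau> \<phi>) = subst (\<lambda>i. subst_tm \<sigma> (\<tau> i)) \<phi>"
  by (induction \<phi> arbitrary: \<sigma> \<tau>) (auto simp: subst_tm_comp subst_up_comp)

lemma subst_up_lift: "subst (up \<sigma>) (lift \<phi>) = lift (subst \<sigma> \<phi>)"
  by (simp add: lift_def subst_comp) (simp add: lift_tm_def)

text \<open>Lets the quantifier axioms act below a simultaneous substitution: the instance is again
  a single simultaneous substitution.\<close>

lemma inst_subst_up: "inst (subst (up \<sigma>) \<phi>) t = subst (case_nat t \<sigma>) \<phi>"
proof -
  have "(\<lambda>i. subst_tm (case_nat t Var) (up \<sigma> i)) = case_nat t \<sigma>"
  proof
    fix i show "subst_tm (case_nat t Var) (up \<sigma> i) = case_nat t \<sigma> i" by (cases i) auto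
  qed
  then show ?thesis by (simp add: inst_def subst_comp)
qed

lemma subst_inst: "subst \<sigma> (inst \<phi> t) = inst (subst (up \<sigma>) \<phi>) (subst_tm \<sigma> t)"
proof -
  have "(\<lambda>i. subst_tm \<sigma> (case_nat t Var i)) = case_nat (subst_tm \<sigma> t) \<sigma>"
  proof
    fix i show "subst_tm \<sigma> (case_nat t Var i) = case_nat (subst_tm \<sigma> t) \<sigma> i" by (cases i) auto
  qed
  then show ?thesis by (simp add: inst_subst_up) (simp add: inst_def subst_comp)
qed

lemma numeral_tm_simps [simp]: "numeral_tm 0 = Zero" "numeral_tm (Suc n) = Succ (numeral_tm n)"
  by (simp_all add: numeral_tm_def)

lemma subst_numeral [simp]: "subst_tm \<sigma> (numeral_tm n) = numeral_tm n"
  by (induction n) auto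

lemma lift_numeral [simp]: "lift_tm (numeral_tm n) = numeral_tm n"
  by (simp add: lift_tm_def)

lemma lift_simps [simp]:
  "lift_tm (Var i) = Var (Suc i)" "lift_tm Zero = Zero" "lift_tm (Succ t) = Succ (lift_tm t)"
  "lift_tm (Add s t) = Add (lift_tm s) (lift_tm t)" "lift_tm (Mul s t) = Mul (lift_tm s) (lift_tm t)"
  by (simp_all add: lift_tm_def)

lemma fv_tm_numeral [simp]: "fv_tm (numeral_tm n) = {}"
  by (induction n) auto

lemma numeral_tm_inject [simp]: "numeral_tm m = numeral_tm n \<longleftrightarrow> m = n"
proof (induction m arbitrary: n)
  case 0 then show ?case by (cases n) auto
next
  case (Suc m) then show ?case by (cases n) auto
qed

section \<open>Free variables of substituted formulas and universal closures\<close>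

lemma fv_tm_subst: "fv_tm (subst_tm \<sigma> t) = (\<Union>i\<in>fv_tm t. fv_tm (\<sigma> i))"
  by (induction t) auto

lemma fv_tm_lift: "fv_tm (lift_tm t) = Suc ` fv_tm t"
  by (auto simp: lift_tm_def fv_tm_subst)

lemma fv_up_image: "{n. Suc n \<in> (\<Union>i\<in>A. fv_tm (up \<sigma> i))} = (\<Union>i\<in>{n. Suc n \<in> A}. fv_tm (\<sigma> i))"
proof (intro equalityI subsetI)
  fix n assume "n \<in> {n. Suc n \<in> (\<Union>i\<in>A. fv_tm (up \<sigma> i))}"
  then obtain i where i: "i \<in> A" "Suc n \<in> fv_tm (up \<sigma> i)" by auto
  then show "n \<in> (\<Union>i\<in>{n. Suc n \<in> A}. fv_tm (\<sigma> i))" by (cases i) (auto simp: fv_tm_lift)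
next
  fix n assume "n \<in> (\<Union>i\<in>{n. Suc n \<in> A}. fv_tm (\<sigma> i))"
  then obtain i where i: "Suc i \<in> A" "n \<in> fv_tm (\<sigma> i)" by auto
  then have "Suc n \<in> fv_tm (up \<sigma> (Suc i))" by (simp add: fv_tm_lift)
  with i(1) show "n \<in> {n. Suc n \<in> (\<Union>i\<in>A. fv_tm (up \<sigma> i))}" by blast
qed

lemma fv_subst: "fv (subst \<sigma> \<phi>) = (\<Union>i\<in>fv \<phi>. fv_tm (\<sigma> i))"
  by (induction \<phi> arbitrary: \<sigma>) (auto simp only: subst.simps fv.simps fv_tm_subst UN_Un fv_up_image)

lemma finite_fv_tm: "finite (fv_tm t)"
  by (induction t) auto

lemma finite_fv: "finite (fv \<phi>)"
proof (induction \<phi>)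
  case (Forall \<phi>)
  have "{n. Suc n \<in> fv \<phi>} = Suc -` fv \<phi>" by auto
  then show ?case using Forall by (simp add: finite_vimageI)
next
  case (Exists \<phi>)
  have "{n. Suc n \<in> fv \<phi>} = Suc -` fv \<phi>" by auto
  then show ?case using Exists by (simp add: finite_vimageI)
qed (auto simp: finite_fv_tm)

lemma fv_Forall_pow: "fv ((Forall ^^ n) \<phi>) = {i. i + n \<in> fv \<phi>}"
  by (induction n arbitrary: \<phi>) (auto simp del: funpow.simps simp: funpow_Suc_right)

lemma sentence_univ_closure: "sentence (univ_closure \<phi>)"
proof -
  have "\<exists>n. fv \<phi> \<subseteq> {..<n}" using finite_nat_set_iff_bounded[of "fv \<phi>"] finite_fv[of \<phi>] by auto
  then have "fv \<phi> \<subseteq> {..<(LEAST n. fv \<phi> \<subseteq> {..<n})}" by (rule LeastI_ex)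
  then show ?thesis by (auto simp: sentence_def univ_closure_def fv_Forall_pow)
qed

lemma sentence_PA: "\<phi> \<in> PA \<Longrightarrow> sentence \<phi>"
  by (cases rule: PA.cases) (auto simp: sentence_univ_closure)

section \<open>The standard model\<close>

primrec tval :: "(nat \<Rightarrow> nat) \<Rightarrow> tm \<Rightarrow> nat" where
  "tval e (Var n) = e n"
| "tval e Zero = 0"
| "tval e (Succ t) = Suc (tval e t)"
| "tval e (Add s t) = tval e s + tval e t"
| "tval e (Mul s t) = tval e s * tval e t"

primrec sat :: "(nat \<Rightarrow> nat) \<Rightarrow> fm \<Rightarrow> bool" where
  "sat e (Eq s t) \<longleftrightarrow> tval e s = tval e t"
| "sat e (Le s t) \<longleftrightarrow> tval e s \<le> tval e t"
| "sat e (Neg \<phi>) \<longleftrightarrow> \<not> sat e \<phi>"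
| "sat e (Conj \<phi> \<psi>) \<longleftrightarrow> sat e \<phi> \<and> sat e \<psi>"
| "sat e (Disj \<phi> \<psi>) \<longleftrightarrow> sat e \<phi> \<or> sat e \<psi>"
| "sat e (Imp \<phi> \<psi>) \<longleftrightarrow> (sat e \<phi> \<longrightarrow> sat e \<psi>)"
| "sat e (Forall \<phi>) \<longleftrightarrow> (\<forall>n. sat (case_nat n e) \<phi>)"
| "sat e (Exists \<phi>) \<longleftrightarrow> (\<exists>n. sat (case_nat n e) \<phi>)"

lemma tval_subst: "tval e (subst_tm \<sigma> t) = tval (\<lambda>i. tval e (\<sigma> i)) t"
  by (induction t) auto

lemma tval_lift [simp]: "tval (case_nat n e) (lift_tm t) = tval e t"
  by (simp add: lift_tm_def tval_subst)

lemma tval_numeral [simp]: "tval e (numeral_tm n) = n"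
  by (induction n) auto

lemma tval_up: "(\<lambda>i. tval (case_nat n e) (up \<sigma> i)) = case_nat n (\<lambda>i. tval e (\<sigma> i))"
proof
  fix i show "tval (case_nat n e) (up \<sigma> i) = case_nat n (\<lambda>i. tval e (\<sigma> i)) i" by (cases i) auto
qed

lemma sat_subst: "sat e (subst \<sigma> \<phi>) = sat (\<lambda>i. tval e (\<sigma> i)) \<phi>"
  by (induction \<phi> arbitrary: e \<sigma>) (auto simp: tval_subst tval_up)

lemma case_nat_eta: "(\<lambda>i. tval e (case_nat t \<sigma> i)) = case_nat (tval e t) (\<lambda>i. tval e (\<sigma> i))"
proof
  fix i show "tval e (case_nat t \<sigma> i) = case_nat (tval e t) (\<lambda>i. tval e (\<sigma> i)) i" by (cases i) auto
qed

lemma sat_inst: "sat e (inst \<phi> t) = sat (case_nat (tval e t) e) \<phi>"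
  by (simp add: inst_def sat_subst case_nat_eta)

lemma sat_lift [simp]: "sat (case_nat n e) (lift \<phi>) = sat e \<phi>"
  by (simp add: lift_def sat_subst)

lemma logical_axiom_sound: "logical_axiom \<phi> \<Longrightarrow> sat e \<phi>"
  by (induction rule: logical_axiom.induct) (auto simp: sat_inst)

lemma sat_univ_closure: "(\<And>e. sat e \<phi>) \<Longrightarrow> sat e (univ_closure \<phi>)"
proof -
  assume *: "\<And>e. sat e \<phi>"
  have "sat e ((Forall ^^ n) \<phi>)" for n e
    by (induction n arbitrary: e) (auto simp: *)
  then show ?thesis by (simp add: univ_closure_def)
qed

lemma sat_induction_formula: "sat e (induction_formula \<phi>)"
proof -
  have "(\<lambda>i. tval (case_nat n e) (case_nat (Succ (Var 0)) (\<lambda>i. Var (Suc i)) i)) = case_nat (Suc n) e" for n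
  proof
    fix i show "tval (case_nat n e) (case_nat (Succ (Var 0)) (\<lambda>i. Var (Suc i)) i) = case_nat (Suc n) e i"
      by (cases i) auto
  qed
  then show ?thesis
    unfolding induction_formula_def
    by (auto simp: sat_inst sat_subst intro: nat_induct[where P = "\<lambda>n. sat (case_nat n e) \<phi>"])
qed

lemma PA_axiom_sound: "\<phi> \<in> PA \<Longrightarrow> sat e \<phi>"
proof (induction rule: PA.induct)
  case (induction \<phi>)
  then show ?case by (intro sat_univ_closure sat_induction_formula)
next
  case le_elim
  show ?case by (intro sat_univ_closure) (auto simp: nat_le_iff_add add.commute)
next
  case le_intro
  show ?case by (intro sat_univ_closure) auto
qed (intro sat_univ_closure, simp)+

text \<open>Truth in the standard model is the way back from \<open>PA\<close>: a provable instance
  of the predicate is true, and its truth will be shown to mean provability in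
  \<open>T\<close>.\<close>

lemma PA_sound: "PA \<turnstile> \<phi> \<Longrightarrow> sat e \<phi>"
proof (induction arbitrary: e rule: proves.induct)
  case (axiom \<phi>) then show ?case by (rule PA_axiom_sound)
next
  case (logical \<phi>) then show ?case by (rule logical_axiom_sound)
qed auto

section \<open>Derived rules of the calculus\<close>

lemma logical_axiom_subst: "logical_axiom \<phi> \<Longrightarrow> logical_axiom (subst \<sigma> \<phi>)"
  by (induction rule: logical_axiom.induct)
    (auto simp: subst_inst subst_up_lift intro: logical_axiom.intros)

text \<open>Axioms that are sentences are fixed by every substitution, and logical axioms are closed
  under it, so whole derivations can be substituted into.\<close>

lemma proves_subst:
  assumes "\<forall>\<phi>\<in>T. sentence \<phi>" and "T \<turnstile> \<phi>"
  shows "T \<turnstile> subst \<sigma> \<phi>"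
  using assms(2)
proof (induction arbitrary: \<sigma> rule: proves.induct)
  case (axiom \<phi>) then show ?case using assms(1) by (simp add: subst_sentence proves.axiom)
next
  case (logical \<phi>) then show ?case by (simp add: logical_axiom_subst proves.logical)
next
  case (mp \<phi> \<psi>) then show ?case using proves.mp by fastforce
next
  case (gen \<phi>) then show ?case by (simp add: proves.gen)
qed

text \<open>Derivability from theorems and hypotheses by modus ponens only, so that the deduction theorem
  holds for open formulas.\<close>

inductive pd :: "fm set \<Rightarrow> fm set \<Rightarrow> fm \<Rightarrow> bool" for T \<Gamma> where
  hyp: "\<phi> \<in> \<Gamma> \<Longrightarrow> pd T \<Gamma> \<phi>"
| prov: "T \<turnstile> \<phi> \<Longrightarrow> pd T \<Gamma> \<phi>"
| mp: "pd T \<Gamma> (Imp \<phi> \<psi>) \<Longrightarrow> pd T \<Gamma> \<phi> \<Longrightarrow> pd T \<Gamma> \<psi>"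

lemma pd_empty: "pd T {} \<phi> \<Longrightarrow> T \<turnstile> \<phi>"
  by (induction rule: pd.induct) (auto intro: proves.mp)

lemma pd_ax: "logical_axiom \<phi> \<Longrightarrow> pd T \<Gamma> \<phi>"
  by (simp add: pd.prov proves.logical)

lemma pd_mono: "pd T \<Gamma> \<phi> \<Longrightarrow> \<Gamma> \<subseteq> \<Delta> \<Longrightarrow> pd T \<Delta> \<phi>"
  by (induction rule: pd.induct) (auto intro: pd.intros)

lemma pd_deduct: "pd T (insert \<alpha> \<Gamma>) \<phi> \<Longrightarrow> pd T \<Gamma> (Imp \<alpha> \<phi>)"
proof (induction rule: pd.induct)
  case (hyp \<phi>)
  show ?case
  proof (cases "\<phi> = \<alpha>")
    case True
    have "pd T \<Gamma> (Imp \<alpha> (Imp \<alpha> \<alpha>))" "pd T \<Gamma> (Imp \<alpha> (Imp (Imp \<alpha> \<alpha>) \<alpha>))"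
      "pd T \<Gamma> (Imp (Imp \<alpha> (Imp (Imp \<alpha> \<alpha>) \<alpha>)) (Imp (Imp \<alpha> (Imp \<alpha> \<alpha>)) (Imp \<alpha> \<alpha>)))"
      by (auto intro: pd_ax logical_axiom.intros)
    then show ?thesis using True by (blast intro: pd.mp[OF pd.mp])
  next
    case False
    then have "pd T \<Gamma> \<phi>" using hyp by (auto intro: pd.hyp)
    then show ?thesis by (rule pd.mp[OF pd_ax[OF logical_axiom.imp_K]])
  qed
next
  case (prov \<phi>)
  then show ?case by (intro pd.mp[OF pd_ax[OF logical_axiom.imp_K]] pd.prov)
next
  case (mp \<phi> \<psi>)
  show ?case by (rule pd.mp[OF pd.mp[OF pd_ax[OF logical_axiom.imp_S] mp.IH(1)] mp.IH(2)])
qed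

lemma pd_neg_intro: "pd T (insert \<alpha> \<Gamma>) \<beta> \<Longrightarrow> pd T (insert \<alpha> \<Gamma>) (Neg \<beta>) \<Longrightarrow> pd T \<Gamma> (Neg \<alpha>)"
  by (rule pd.mp[OF pd.mp[OF pd_ax[OF logical_axiom.neg_intro] pd_deduct] pd_deduct])

lemma pd_contr: "pd T \<Gamma> \<alpha> \<Longrightarrow> pd T \<Gamma> (Neg \<alpha>) \<Longrightarrow> pd T \<Gamma> \<beta>"
proof -
  assume "pd T \<Gamma> \<alpha>" "pd T \<Gamma> (Neg \<alpha>)"
  then have "pd T \<Gamma> (Neg (Neg \<beta>))"
    by (auto intro: pd_neg_intro[of T "Neg \<beta>" \<Gamma> \<alpha>] pd_mono)
  then show ?thesis by (rule pd.mp[OF pd_ax[OF logical_axiom.neg_neg]])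
qed

lemma pd_disjE:
  assumes "pd T \<Gamma> (Disj \<alpha> \<beta>)" "pd T (insert \<alpha> \<Gamma>) \<chi>" "pd T (insert \<beta> \<Gamma>) \<chi>"
  shows "pd T \<Gamma> \<chi>"
  by (rule pd.mp[OF pd.mp[OF pd.mp[OF pd_ax[OF logical_axiom.disj_elim]]]])
    (use assms in \<open>auto intro: pd_deduct\<close>)

lemma pd_cases:
  assumes "pd T (insert \<alpha> \<Gamma>) \<chi>" "pd T (insert (Neg \<alpha>) \<Gamma>) \<chi>"
  shows "pd T \<Gamma> \<chi>"
proof -
  let ?G = "insert (Neg \<chi>) \<Gamma>"
  have "pd T ?G (Neg \<alpha>)"
    by (rule pd_neg_intro[of _ _ _ \<chi>]) (use assms(1) in \<open>auto intro: pd_mono pd.hyp\<close>)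
  moreover have "pd T ?G (Neg (Neg \<alpha>))"
    by (rule pd_neg_intro[of _ _ _ \<chi>]) (use assms(2) in \<open>auto intro: pd_mono pd.hyp\<close>)
  ultimately have "pd T \<Gamma> (Neg (Neg \<chi>))" by (rule pd_neg_intro)
  then show ?thesis by (rule pd.mp[OF pd_ax[OF logical_axiom.neg_neg]])
qed

section \<open>Propositional completeness of the calculus\<close>

primrec ev :: "(fm \<Rightarrow> bool) \<Rightarrow> fm \<Rightarrow> bool" where
  "ev v (Eq s t) = v (Eq s t)"
| "ev v (Le s t) = v (Le s t)"
| "ev v (Neg \<phi>) = (\<not> ev v \<phi>)"
| "ev v (Conj \<phi> \<psi>) = (ev v \<phi> \<and> ev v \<psi>)"
| "ev v (Disj \<phi> \<psi>) = (ev v \<phi> \<or> ev v \<psi>)"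
| "ev v (Imp \<phi> \<psi>) = (ev v \<phi> \<longrightarrow> ev v \<psi>)"
| "ev v (Forall \<phi>) = v (Forall \<phi>)"
| "ev v (Exists \<phi>) = v (Exists \<phi>)"

primrec primes :: "fm \<Rightarrow> fm set" where
  "primes (Eq s t) = {Eq s t}"
| "primes (Le s t) = {Le s t}"
| "primes (Neg \<phi>) = primes \<phi>"
| "primes (Conj \<phi> \<psi>) = primes \<phi> \<union> primes \<psi>"
| "primes (Disj \<phi> \<psi>) = primes \<phi> \<union> primes \<psi>"
| "primes (Imp \<phi> \<psi>) = primes \<phi> \<union> primes \<psi>"
| "primes (Forall \<phi>) = {Forall \<phi>}"
| "primes (Exists \<phi>) = {Exists \<phi>}"

text \<open>Kalmar's lemma, with quantified formulas counted as propositional atoms. Each case of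
  the induction derives the lines of one truth table.\<close>

lemma kalmar:
  assumes "primes \<phi> \<subseteq> A"
  shows "pd T ((\<lambda>a. if v a then a else Neg a) ` A) (if ev v \<phi> then \<phi> else Neg \<phi>)"
    (is "pd T ?G _")
  using assms
proof (induction \<phi>)
  case (Neg \<phi>)
  show ?case
  proof (cases "ev v \<phi>")
    case True
    then have "pd T ?G (Neg (Neg \<phi>))"
      using Neg by (intro pd_neg_intro[of T "Neg \<phi>" ?G \<phi>]) (auto intro: pd_mono pd.hyp)
    then show ?thesis using True by simp
  qed (use Neg in auto)
next
  case (Conj \<phi> \<psi>)
  have ax: "pd T G (Imp (Conj \<phi> \<psi>) \<phi>)" "pd T G (Imp (Conj \<phi> \<psi>) \<psi>)"
    "pd T G (Imp \<phi> (Imp \<psi> (Conj \<phi> \<psi>)))" for G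
    by (auto intro: pd_ax logical_axiom.intros)
  consider "ev v \<phi>" "ev v \<psi>" | "\<not> ev v \<phi>" | "\<not> ev v \<psi>" by blast
  then show ?case
  proof cases
    case 1 then show ?thesis using Conj ax(3)[of ?G] by (auto intro: pd.mp)
  next
    case 2
    then have "pd T ?G (Neg (Conj \<phi> \<psi>))"
      using Conj by (intro pd_neg_intro[of T "Conj \<phi> \<psi>" ?G \<phi>])
        (auto intro: pd_mono pd.mp[OF ax(1)] pd.hyp)
    then show ?thesis using 2 by simp
  next
    case 3
    then have "pd T ?G (Neg (Conj \<phi> \<psi>))"
      using Conj by (intro pd_neg_intro[of T "Conj \<phi> \<psi>" ?G \<psi>])
        (auto intro: pd_mono pd.mp[OF ax(2)] pd.hyp)
    then show ?thesis using 3 by simp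
  qed
next
  case (Disj \<phi> \<psi>)
  have ax: "pd T G (Imp \<phi> (Disj \<phi> \<psi>))" "pd T G (Imp \<psi> (Disj \<phi> \<psi>))" for G
    by (auto intro: pd_ax logical_axiom.intros)
  consider "\<not> ev v \<phi>" "\<not> ev v \<psi>" | "ev v \<phi>" | "ev v \<psi>" by blast
  then show ?case
  proof cases
    case 1
    have n: "pd T ?G (Neg \<phi>)" "pd T ?G (Neg \<psi>)" using Disj 1 by auto
    have c: "pd T (insert (Disj \<phi> \<psi>) ?G) \<chi>" for \<chi>
    proof (rule pd_disjE[of _ _ \<phi> \<psi>])
      show "pd T (insert (Disj \<phi> \<psi>) ?G) (Disj \<phi> \<psi>)" by (auto intro: pd.hyp)
      show "pd T (insert \<phi> (insert (Disj \<phi> \<psi>) ?G)) \<chi>"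
        by (rule pd_contr[of _ _ \<phi>]) (use n in \<open>auto intro: pd.hyp pd_mono\<close>)
      show "pd T (insert \<psi> (insert (Disj \<phi> \<psi>) ?G)) \<chi>"
        by (rule pd_contr[of _ _ \<psi>]) (use n in \<open>auto intro: pd.hyp pd_mono\<close>)
    qed
    have "pd T ?G (Neg (Disj \<phi> \<psi>))" by (rule pd_neg_intro[OF c c])
    then show ?thesis using 1 by simp
  qed (use Disj ax in \<open>auto intro: pd.mp\<close>)
next
  case (Imp \<phi> \<psi>)
  consider "ev v \<phi>" "\<not> ev v \<psi>" | "\<not> ev v \<phi>" | "ev v \<psi>" by blast
  then show ?case
  proof cases
    case 1
    have n: "pd T ?G \<phi>" "pd T ?G (Neg \<psi>)" using Imp 1 by auto
    have "pd T ?G (Neg (Imp \<phi> \<psi>))"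
    proof (rule pd_neg_intro[of _ _ _ \<psi>])
      show "pd T (insert (Imp \<phi> \<psi>) ?G) \<psi>"
        by (rule pd.mp[of _ _ \<phi>]) (use n in \<open>auto intro: pd.hyp pd_mono\<close>)
    qed (use n in \<open>auto intro: pd_mono\<close>)
    then show ?thesis using 1 by simp
  next
    case 2
    then have "pd T ?G (Neg \<phi>)" using Imp by auto
    then have "pd T (insert \<phi> ?G) \<psi>"
      by (intro pd_contr[of T "insert \<phi> ?G" \<phi> \<psi>]) (auto intro: pd.hyp pd_mono)
    then show ?thesis using 2 pd_deduct by simp
  next
    case 3
    then have "pd T ?G \<psi>" using Imp by auto
    then show ?thesis using 3 by (auto intro: pd_deduct pd_mono)
  qed
qed (auto intro!: pd.hyp)

lemma finite_primes: "finite (primes \<phi>)"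
  by (induction \<phi>) auto

lemma taut_provable:
  assumes "\<And>v. ev v \<phi>"
  shows "T \<turnstile> \<phi>"
proof -
  \<comment> \<open>\<open>A\<close> holds the prime formulas still fixed by a literal,
    \<open>B\<close> those already eliminated. Eliminating \<open>b\<close> combines the two
    valuations that differ only at \<open>b\<close>.\<close>
  have "pd T ((\<lambda>a. if v a then a else Neg a) ` A) \<phi>"
    if "finite B" "A \<inter> B = {}" "A \<union> B = primes \<phi>" for A B v
    using that
  proof (induction B arbitrary: A v rule: finite_induct)
    case empty
    then show ?case using kalmar[of \<phi> A T v] assms by simp
  next
    case (insert b B)
    have im: "(\<lambda>a. if (v(b := x)) a then a else Neg a) ` insert b A
        = insert (if x then b else Neg b) ((\<lambda>a. if v a then a else Neg a) ` A)" for x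
      using insert.prems by (auto simp: image_iff)
    have "pd T ((\<lambda>a. if (v(b := x)) a then a else Neg a) ` insert b A) \<phi>" for x
      by (rule insert.IH) (use insert in auto)
    from this[of True] this[of False] show ?case
      unfolding im by (auto intro: pd_cases)
  qed
  from this[OF finite_primes, of "{}"] show ?thesis by (simp add: pd_empty)
qed

text \<open>From here on propositional reasoning inside the calculus is a semantic check on
  \<open>ev\<close>: \<open>taut1\<close> to \<open>taut4\<close> draw propositional consequences of
  one to four theorems.\<close>

lemma taut1: "T \<turnstile> \<alpha> \<Longrightarrow> (\<And>v. ev v \<alpha> \<Longrightarrow> ev v \<phi>) \<Longrightarrow> T \<turnstile> \<phi>"
  by (rule proves.mp[OF taut_provable]) auto

lemma taut2: "T \<turnstile> \<alpha> \<Longrightarrow> T \<turnstile> \<beta> \<Longrightarrow> (\<And>v. ev v \<alpha> \<Longrightarrow> ev v \<beta> \<Longrightarrow> ev v \<phi>) \<Longrightarrow> T \<turnstile> \<phi>"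
  by (rule proves.mp[where \<phi> = \<beta>, OF taut1]) auto

lemma taut3: "T \<turnstile> \<alpha> \<Longrightarrow> T \<turnstile> \<beta> \<Longrightarrow> T \<turnstile> \<gamma> \<Longrightarrow>
    (\<And>v. ev v \<alpha> \<Longrightarrow> ev v \<beta> \<Longrightarrow> ev v \<gamma> \<Longrightarrow> ev v \<phi>) \<Longrightarrow> T \<turnstile> \<phi>"
  by (rule proves.mp[where \<phi> = \<gamma>, OF taut2[where \<alpha> = \<alpha> and \<beta> = \<beta>]]) auto

lemma taut4: "T \<turnstile> \<alpha> \<Longrightarrow> T \<turnstile> \<beta> \<Longrightarrow> T \<turnstile> \<gamma> \<Longrightarrow> T \<turnstile> \<delta> \<Longrightarrow>
    (\<And>v. ev v \<alpha> \<Longrightarrow> ev v \<beta> \<Longrightarrow> ev v \<gamma> \<Longrightarrow> ev v \<delta> \<Longrightarrow> ev v \<phi>) \<Longrightarrow> T \<turnstile> \<phi>"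
  by (rule proves.mp[where \<phi> = \<delta>, OF taut3[where \<alpha> = \<alpha> and \<beta> = \<beta> and \<gamma> = \<gamma>]]) auto

lemma exists_imp: "T \<turnstile> Imp \<phi> (lift \<psi>) \<Longrightarrow> T \<turnstile> Imp (Exists \<phi>) \<psi>"
  by (rule proves.mp[OF proves.logical[OF exists_elim] proves.gen])

lemma imp_subst_exists: "T \<turnstile> Imp (subst (case_nat t \<sigma>) \<phi>) (subst \<sigma> (Exists \<phi>))"
  using proves.logical[OF exists_intro[of "subst (up \<sigma>) \<phi>" t]] by (simp add: inst_subst_up)

lemma subst_forall_imp: "T \<turnstile> Imp (subst \<sigma> (Forall \<phi>)) (subst (case_nat t \<sigma>) \<phi>)"
  using proves.logical[OF forall_elim[of "subst (up \<sigma>) \<phi>" t]] by (simp add: inst_subst_up)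

section \<open>Arithmetic in PA\<close>

lemma PA_subst: "PA \<turnstile> \<phi> \<Longrightarrow> PA \<turnstile> subst \<sigma> \<phi>"
  by (rule proves_subst) (auto simp: sentence_PA)

text \<open>Shifting all free variables by one makes room at index 0. Eliminating the quantifier at
  \<open>Var 0\<close> then composes to the identity substitution.\<close>

lemma PA_forallD: "PA \<turnstile> Forall \<phi> \<Longrightarrow> PA \<turnstile> \<phi>"
proof -
  assume "PA \<turnstile> Forall \<phi>"
  then have "PA \<turnstile> subst (\<lambda>i. Var (Suc i)) (Forall \<phi>)" by (rule PA_subst)
  then have "PA \<turnstile> subst (case_nat (Var 0) (\<lambda>i. Var (Suc i))) \<phi>"
    by (rule proves.mp[OF subst_forall_imp])
  moreover have "case_nat (Var 0) (\<lambda>i. Var (Suc i)) = Var"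
    by (auto split: nat.split)
  ultimately show ?thesis by simp
qed

lemma PA_axiomD: "univ_closure \<phi> \<in> PA \<Longrightarrow> PA \<turnstile> subst \<sigma> \<phi>"
proof -
  assume "univ_closure \<phi> \<in> PA"
  moreover have "PA \<turnstile> (Forall ^^ n) \<phi> \<Longrightarrow> PA \<turnstile> \<phi>" for n
    by (induction n) (auto dest: PA_forallD)
  ultimately have "PA \<turnstile> \<phi>" by (auto simp: univ_closure_def dest: proves.axiom)
  then show ?thesis by (rule PA_subst)
qed

section \<open>Equality\<close>

lemma eq_refl': "T \<turnstile> Eq t t"
  by (rule proves.logical[OF eq_refl])

text \<open>Leibniz's law for the template \<open>Eq (Var 0) (lift_tm s)\<close>; the congruence
  lemmas below differ only in their templates.\<close>

lemma eq_sym: "T \<turnstile> Imp (Eq s t) (Eq t s)"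
  using proves.logical[OF eq_subst[of s t "Eq (Var 0) (lift_tm s)"], of T]
  by (rule taut2[OF _ eq_refl'[of T s]]) (auto simp: inst_def)

lemma eq_trans: "T \<turnstile> Imp (Eq s t) (Imp (Eq t u) (Eq s u))"
  using proves.logical[OF eq_subst[of t u "Eq (lift_tm s) (Var 0)"], of T]
  by (rule taut1) (auto simp: inst_def)

lemma eq_Succ: "T \<turnstile> Imp (Eq s t) (Eq (Succ s) (Succ t))"
  using proves.logical[OF eq_subst[of s t "Eq (Succ (lift_tm s)) (Succ (Var 0))"], of T]
  by (rule taut2[OF _ eq_refl'[of T "Succ s"]]) (auto simp: inst_def)

lemma eq_Add: "T \<turnstile> Imp (Eq s s') (Imp (Eq t t') (Eq (Add s t) (Add s' t')))"
proof -
  have 1: "T \<turnstile> Imp (Eq s s') (Eq (Add s t) (Add s' t))"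
    using proves.logical[OF eq_subst[of s s' "Eq (Add (lift_tm s) (lift_tm t)) (Add (Var 0) (lift_tm t))"], of T]
    by (rule taut2[OF _ eq_refl'[of T "Add s t"]]) (auto simp: inst_def)
  show ?thesis
    using proves.logical[OF eq_subst[of t t' "Eq (Add (lift_tm s) (lift_tm t)) (Add (lift_tm s') (Var 0))"], of T]
    by (rule taut2[OF _ 1]) (auto simp: inst_def)
qed

lemma eq_Mul: "T \<turnstile> Imp (Eq s s') (Imp (Eq t t') (Eq (Mul s t) (Mul s' t')))"
proof -
  have 1: "T \<turnstile> Imp (Eq s s') (Eq (Mul s t) (Mul s' t))"
    using proves.logical[OF eq_subst[of s s' "Eq (Mul (lift_tm s) (lift_tm t)) (Mul (Var 0) (lift_tm t))"], of T]
    by (rule taut2[OF _ eq_refl'[of T "Mul s t"]]) (auto simp: inst_def)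
  show ?thesis
    using proves.logical[OF eq_subst[of t t' "Eq (Mul (lift_tm s) (lift_tm t)) (Mul (lift_tm s') (Var 0))"], of T]
    by (rule taut2[OF _ 1]) (auto simp: inst_def)
qed

lemma eq_Le: "T \<turnstile> Imp (Eq s s') (Imp (Eq t t') (Imp (Le s t) (Le s' t')))"
proof -
  have 1: "T \<turnstile> Imp (Eq s s') (Imp (Le s t) (Le s' t))"
    using proves.logical[OF eq_subst[of s s' "Le (Var 0) (lift_tm t)"], of T] by (simp add: inst_def)
  show ?thesis
    using proves.logical[OF eq_subst[of t t' "Le (lift_tm s') (Var 0)"], of T]
    by (rule taut2[OF _ 1]) (auto simp: inst_def)
qed

lemma eq_replace: "T \<turnstile> Imp (Eq (Var j) t) (Imp \<phi> (subst (Var(j := t)) \<phi>))"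
proof -
  \<comment> \<open>\<open>?\<psi>\<close> moves the variable \<open>j\<close> to index 0 and shifts
    the others, so that instantiating it at \<open>u\<close> replaces \<open>Var j\<close> by
    \<open>u\<close> in \<open>\<phi>\<close>.\<close>
  let ?\<psi> = "subst (\<lambda>i. if i = j then Var 0 else Var (Suc i)) \<phi>"
  have "inst ?\<psi> u = subst (Var(j := u)) \<phi>" for u
    unfolding inst_def subst_comp by (auto intro!: arg_cong[where f = "\<lambda>s. subst s \<phi>"])
  from this[of "Var j"] this[of t]
  have "inst ?\<psi> (Var j) = \<phi>" "inst ?\<psi> t = subst (Var(j := t)) \<phi>" by simp_all
  then show ?thesis using proves.logical[OF eq_subst[of "Var j" t ?\<psi>], of T] by simp
qed

lemma eq_replace_back: "T \<turnstile> Imp (Eq (Var j) t) (Imp (subst (Var(j := t)) \<phi>) \<phi>)"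
proof -
  let ?\<psi> = "subst (\<lambda>i. if i = j then Var 0 else Var (Suc i)) \<phi>"
  have "inst ?\<psi> u = subst (Var(j := u)) \<phi>" for u
    unfolding inst_def subst_comp by (auto intro!: arg_cong[where f = "\<lambda>s. subst s \<phi>"])
  from this[of "Var j"] this[of t]
  have "inst ?\<psi> (Var j) = \<phi>" "inst ?\<psi> t = subst (Var(j := t)) \<phi>" by simp_all
  then have "T \<turnstile> Imp (Eq t (Var j)) (Imp (subst (Var(j := t)) \<phi>) \<phi>)"
    using proves.logical[OF eq_subst[of t "Var j" ?\<psi>], of T] by simp
  then show ?thesis by (rule taut2[OF _ eq_sym[of T "Var j" t]]) auto
qed

section \<open>The axioms of PA at arbitrary terms\<close>

lemma PA_succ_nonzero: "PA \<turnstile> Neg (Eq (Succ t) Zero)"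
  using PA_axiomD[OF PA.succ_nonzero, of "\<lambda>_. t"] by simp

lemma PA_succ_inj: "PA \<turnstile> Imp (Eq (Succ s) (Succ t)) (Eq s t)"
  using PA_axiomD[OF PA.succ_inj, of "case_nat s (\<lambda>_. t)"] by simp

lemma PA_add_zero: "PA \<turnstile> Eq (Add t Zero) t"
  using PA_axiomD[OF PA.add_zero, of "\<lambda>_. t"] by simp

lemma PA_add_succ: "PA \<turnstile> Eq (Add s (Succ t)) (Succ (Add s t))"
  using PA_axiomD[OF PA.add_succ, of "case_nat s (\<lambda>_. t)"] by simp

lemma PA_mul_zero: "PA \<turnstile> Eq (Mul t Zero) Zero"
  using PA_axiomD[OF PA.mul_zero, of "\<lambda>_. t"] by simp

lemma PA_mul_succ: "PA \<turnstile> Eq (Mul s (Succ t)) (Add (Mul s t) s)"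
  using PA_axiomD[OF PA.mul_succ, of "case_nat s (\<lambda>_. t)"] by simp

lemma PA_le_elim: "PA \<turnstile> Imp (Le s t) (Exists (Eq (Add (Var 0) (lift_tm s)) (lift_tm t)))"
  using PA_axiomD[OF PA.le_elim, of "case_nat s (\<lambda>_. t)"] by (simp add: up_def numeral_2_eq_2)

lemma PA_le_intro: "PA \<turnstile> Imp (Exists (Eq (Add (Var 0) (lift_tm s)) (lift_tm t))) (Le s t)"
  using PA_axiomD[OF PA.le_intro, of "case_nat s (\<lambda>_. t)"] by (simp add: up_def numeral_2_eq_2)

lemma PA_le_witness: "PA \<turnstile> Imp (Eq (Add r s) t) (Le s t)"
  using proves.logical[OF exists_intro[of "Eq (Add (Var 0) (lift_tm s)) (lift_tm t)" r], of PA]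
  by (rule taut2[OF _ PA_le_intro[of s t]]) (auto simp: inst_def)

lemma PA_le_imp:
  assumes "PA \<turnstile> Imp (Eq (Add (Var 0) (lift_tm s)) (lift_tm t)) (lift \<psi>)"
  shows "PA \<turnstile> Imp (Le s t) \<psi>"
  by (rule taut2[OF PA_le_elim[of s t] exists_imp[OF assms]]) auto

text \<open>The one point where an induction axiom is used inside \<open>PA\<close>. The later
  inductions run outside, over numerals, and use this case distinction inside.\<close>

lemma PA_zero_or_succ: "PA \<turnstile> Disj (Eq t Zero) (Exists (Eq (lift_tm t) (Succ (Var 0))))"
proof -
  let ?\<phi> = "Disj (Eq (Var 0) Zero) (Exists (Eq (Var 1) (Succ (Var 0))))"
  have "PA \<turnstile> subst Var (induction_formula ?\<phi>)" by (rule PA_axiomD[OF PA.induction])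
  then have ind: "PA \<turnstile> induction_formula ?\<phi>" by simp
  have z: "PA \<turnstile> inst ?\<phi> Zero"
    by (rule taut1[OF eq_refl'[of PA Zero]]) (simp add: inst_def)
  have "PA \<turnstile> Imp (inst (Eq (Succ (Var 1)) (Succ (Var 0))) (Var 0)) (Exists (Eq (Succ (Var 1)) (Succ (Var 0))))"
    by (rule proves.logical[OF exists_intro])
  then have s: "PA \<turnstile> Imp ?\<phi> (subst (case_nat (Succ (Var 0)) (\<lambda>i. Var (Suc i))) ?\<phi>)"
    by (rule taut2[OF eq_refl'[of PA "Succ (Var 0)"]]) (simp add: inst_def)
  have "PA \<turnstile> Forall ?\<phi>"
    using ind unfolding induction_formula_def
    by (rule taut3[OF z proves.gen[OF s]]) auto
  then have "PA \<turnstile> ?\<phi>" by (rule PA_forallD)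
  then have "PA \<turnstile> subst (\<lambda>_. t) ?\<phi>" by (rule PA_subst)
  then show ?thesis by simp
qed

lemma PA_cases:
  assumes "PA \<turnstile> Imp (Eq t Zero) \<psi>"
    and "PA \<turnstile> Imp (Eq (lift_tm t) (Succ (Var 0))) (lift \<psi>)"
  shows "PA \<turnstile> \<psi>"
  by (rule taut3[OF PA_zero_or_succ[of t] assms(1) exists_imp[OF assms(2)]]) auto

section \<open>Evaluation of terms at numerals\<close>

abbreviation num :: "(nat \<Rightarrow> nat) \<Rightarrow> nat \<Rightarrow> tm" where
  "num e \<equiv> \<lambda>i. numeral_tm (e i)"

lemma PA_trans: "PA \<turnstile> Eq s t \<Longrightarrow> PA \<turnstile> Eq t u \<Longrightarrow> PA \<turnstile> Eq s u"
  by (rule proves.mp[OF proves.mp[OF eq_trans]])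

lemma PA_add_numeral: "PA \<turnstile> Eq (Add (numeral_tm m) (numeral_tm n)) (numeral_tm (m + n))"
proof (induction n)
  case 0 then show ?case using PA_add_zero by simp
next
  case (Suc n)
  have "PA \<turnstile> Eq (Succ (Add (numeral_tm m) (numeral_tm n))) (Succ (numeral_tm (m + n)))"
    by (rule proves.mp[OF eq_Succ Suc])
  then show ?case using PA_trans[OF PA_add_succ] by simp
qed

lemma PA_mul_numeral: "PA \<turnstile> Eq (Mul (numeral_tm m) (numeral_tm n)) (numeral_tm (m * n))"
proof (induction n)
  case 0 then show ?case using PA_mul_zero by simp
next
  case (Suc n)
  have "PA \<turnstile> Eq (Add (Mul (numeral_tm m) (numeral_tm n)) (numeral_tm m)) (Add (numeral_tm (m * n)) (numeral_tm m))"
    by (rule proves.mp[OF proves.mp[OF eq_Add Suc] eq_refl'])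
  then show ?case
    using PA_trans[OF PA_mul_succ PA_trans[OF _ PA_add_numeral[of "m * n" m]]] by (simp add: add.commute)
qed

lemma PA_eval: "PA \<turnstile> Eq (subst_tm (num e) t) (numeral_tm (tval e t))"
proof (induction t)
  case (Succ t) then show ?case using proves.mp[OF eq_Succ Succ] by simp
next
  case (Add s t)
  then show ?case using PA_trans[OF proves.mp[OF proves.mp[OF eq_Add Add(1)] Add(2)] PA_add_numeral] by simp
next
  case (Mul s t)
  then show ?case using PA_trans[OF proves.mp[OF proves.mp[OF eq_Mul Mul(1)] Mul(2)] PA_mul_numeral] by simp
qed (auto intro: eq_refl' simp del: numeral_tm_simps simp: numeral_tm_simps(1)[symmetric])

lemma PA_numeral_neq: "m \<noteq> n \<Longrightarrow> PA \<turnstile> Neg (Eq (numeral_tm m) (numeral_tm n))"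
proof (induction m arbitrary: n)
  case 0
  then obtain k where [simp]: "n = Suc k" by (cases n) auto
  show ?case
    by (rule taut2[OF PA_succ_nonzero[of "numeral_tm k"] eq_sym[of PA Zero "numeral_tm n"]]) auto
next
  case (Suc m)
  show ?case
  proof (cases n)
    case 0 then show ?thesis using PA_succ_nonzero by simp
  next
    case (Suc k)
    then show ?thesis
      using taut2[OF Suc.IH[of k] PA_succ_inj[of "numeral_tm m" "numeral_tm k"]] Suc.prems by auto
  qed
qed

section \<open>Bounded case distinctions and comparison with numerals\<close>

definition bdisj :: "nat \<Rightarrow> tm \<Rightarrow> fm" where
  "bdisj n t = foldr (\<lambda>i. Disj (Eq t (numeral_tm i))) [0..<Suc n] (Neg (Eq Zero Zero))"

lemma ev_bdisj: "ev v (bdisj n t) \<longleftrightarrow> (\<exists>i\<le>n. v (Eq t (numeral_tm i))) \<or> \<not> v (Eq Zero Zero)"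
proof -
  have "ev v (foldr (\<lambda>i. Disj (Eq t (numeral_tm i))) xs (Neg (Eq Zero Zero)))
      \<longleftrightarrow> (\<exists>i\<in>set xs. v (Eq t (numeral_tm i))) \<or> \<not> v (Eq Zero Zero)" for xs
    by (induction xs) auto
  then show ?thesis by (auto simp: bdisj_def simp del: upt_Suc)
qed

lemma bdisj_imp:
  assumes "\<And>i. i \<le> n \<Longrightarrow> PA \<turnstile> Imp (Eq t (numeral_tm i)) \<psi>"
  shows "PA \<turnstile> Imp (bdisj n t) \<psi>"
proof -
  have "PA \<turnstile> Imp (foldr (\<lambda>i. Disj (Eq t (numeral_tm i))) xs (Neg (Eq Zero Zero))) \<psi>"
    if "set xs \<subseteq> {..n}" for xs
    using that
  proof (induction xs)
    case Nil
    \<comment> \<open>The language has no constant for falsity; the refutable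
      \<open>Neg (Eq Zero Zero)\<close> ends the disjunction instead.\<close>
    show ?case by (rule taut1[OF eq_refl'[of PA Zero]]) auto
  next
    case (Cons a xs)
    then have IH: "PA \<turnstile> Imp (foldr (\<lambda>i. Disj (Eq t (numeral_tm i))) xs (Neg (Eq Zero Zero))) \<psi>"
      and a: "PA \<turnstile> Imp (Eq t (numeral_tm a)) \<psi>" using assms by auto
    show ?case by (rule taut2[OF IH a]) auto
  qed
  moreover have "set [0..<Suc n] \<subseteq> {..n}" by auto
  ultimately show ?thesis unfolding bdisj_def by blast
qed

lemma subst_bdisj [simp]: "subst \<sigma> (bdisj n t) = bdisj n (subst_tm \<sigma> t)"
proof -
  have "subst \<sigma> (foldr (\<lambda>i. Disj (Eq t (numeral_tm i))) xs (Neg (Eq Zero Zero)))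
      = foldr (\<lambda>i. Disj (Eq (subst_tm \<sigma> t) (numeral_tm i))) xs (Neg (Eq Zero Zero))" for xs
    by (induction xs) auto
  then show ?thesis by (simp add: bdisj_def del: upt_Suc)
qed

lemma imp_bdisj: "i \<le> n \<Longrightarrow> PA \<turnstile> Imp (Eq t (numeral_tm i)) (bdisj n t)"
  by (rule taut_provable) (auto simp: ev_bdisj)

lemma PA_le_succ: "PA \<turnstile> Imp (Le (Succ s) (Succ t)) (Le s t)"
proof (rule PA_le_imp)
  let ?z = "Var 0" and ?s = "lift_tm s" and ?t = "lift_tm t"
  have 1: "PA \<turnstile> Imp (Eq (Add ?z (Succ ?s)) (Succ ?t)) (Eq (Succ (Add ?z ?s)) (Succ ?t))"
    by (rule taut3[OF PA_add_succ[of ?z ?s] eq_sym[of PA "Add ?z (Succ ?s)" "Succ (Add ?z ?s)"]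
          eq_trans[of PA "Succ (Add ?z ?s)" "Add ?z (Succ ?s)" "Succ ?t"]]) auto
  have "PA \<turnstile> Imp (Eq (Add ?z (Succ ?s)) (Succ ?t)) (Le ?s ?t)"
    by (rule taut3[OF 1 PA_succ_inj[of "Add ?z ?s" ?t] PA_le_witness[of ?z ?s ?t]]) auto
  then show "PA \<turnstile> Imp (Eq (Add (Var 0) (lift_tm (Succ s))) (lift_tm (Succ t))) (lift (Le s t))"
    by (simp add: lift_def lift_tm_def)
qed

lemma PA_not_succ_le_zero: "PA \<turnstile> Neg (Le (Succ s) Zero)"
proof -
  let ?z = "Var 0" and ?s = "lift_tm s"
  have "PA \<turnstile> Neg (Eq (Add ?z (Succ ?s)) Zero)"
  proof (rule taut3[OF PA_add_succ[of ?z ?s] eq_sym[of PA "Add ?z (Succ ?s)" "Succ (Add ?z ?s)"]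
        taut2[OF eq_trans[of PA "Succ (Add ?z ?s)" "Add ?z (Succ ?s)" "Zero"] PA_succ_nonzero[of "Add ?z ?s"]]])
    show "ev v (Imp (Eq (Succ (Add ?z ?s)) (Add ?z (Succ ?s))) (Neg (Eq (Add ?z (Succ ?s)) Zero)))"
      if "ev v (Imp (Eq (Succ (Add ?z ?s)) (Add ?z (Succ ?s))) (Imp (Eq (Add ?z (Succ ?s)) Zero) (Eq (Succ (Add ?z ?s)) Zero)))"
        "ev v (Neg (Eq (Succ (Add ?z ?s)) Zero))" for v
      using that by auto
  qed auto
  then have "PA \<turnstile> Imp (Eq (Add ?z (lift_tm (Succ s))) (lift_tm Zero)) (lift (Neg (Eq Zero Zero)))"
    by (rule taut1) (simp add: lift_def)
  then have "PA \<turnstile> Imp (Le (Succ s) Zero) (Neg (Eq Zero Zero))" by (rule PA_le_imp)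
  then show ?thesis by (rule taut2[OF eq_refl'[of PA Zero]]) auto
qed

text \<open>Induction on the numeral outside \<open>PA\<close>, with \<open>t\<close> split inside
  \<open>PA\<close> into zero and successor. The hypothesis is applied to the predecessor
  \<open>Var 0\<close> of \<open>t\<close>, whence the generalization over \<open>t\<close>.\<close>

lemma PA_le_numeral_bdisj: "PA \<turnstile> Imp (Le t (numeral_tm n)) (bdisj n t)"
proof (induction n arbitrary: t)
  case 0
  show ?case
  proof (rule PA_cases[of t])
    show "PA \<turnstile> Imp (Eq t Zero) (Imp (Le t (numeral_tm 0)) (bdisj 0 t))"
      by (rule taut_provable) (auto simp: ev_bdisj)
    let ?t = "lift_tm t"
    have "PA \<turnstile> Imp (Eq ?t (Succ (Var 0))) (Imp (Le ?t Zero) (bdisj 0 ?t))"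
      by (rule taut3[OF eq_Le[of PA ?t "Succ (Var 0)" Zero Zero] eq_refl'[of PA Zero]
            PA_not_succ_le_zero[of "Var 0"]]) auto
    then show "PA \<turnstile> Imp (Eq ?t (Succ (Var 0))) (lift (Imp (Le t (numeral_tm 0)) (bdisj 0 t)))"
      by (simp add: lift_def lift_tm_def)
  qed
next
  case (Suc n)
  let ?t = "lift_tm t" and ?S = "Succ (numeral_tm n)"
  show ?case
  proof (rule PA_cases[of t])
    show "PA \<turnstile> Imp (Eq t Zero) (Imp (Le t (numeral_tm (Suc n))) (bdisj (Suc n) t))"
      by (rule taut_provable) (auto simp: ev_bdisj intro!: exI[of _ 0])
    have "PA \<turnstile> Imp (bdisj n (Var 0)) (Imp (Eq ?t (Succ (Var 0))) (bdisj (Suc n) ?t))"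
    proof (rule bdisj_imp)
      fix i assume "i \<le> n"
      then have "PA \<turnstile> Imp (Eq ?t (numeral_tm (Suc i))) (bdisj (Suc n) ?t)" by (intro imp_bdisj) auto
      then show "PA \<turnstile> Imp (Eq (Var 0) (numeral_tm i)) (Imp (Eq ?t (Succ (Var 0))) (bdisj (Suc n) ?t))"
        by (rule taut3[OF eq_Succ[of PA "Var 0" "numeral_tm i"]
              eq_trans[of PA ?t "Succ (Var 0)" "Succ (numeral_tm i)"]]) auto
    qed
    from taut2[OF this Suc.IH[of "Var 0"]]
    have 1: "PA \<turnstile> Imp (Le (Var 0) (numeral_tm n)) (Imp (Eq ?t (Succ (Var 0))) (bdisj (Suc n) ?t))" by auto
    have 2: "PA \<turnstile> Imp (Eq ?t (Succ (Var 0))) (Imp (Le ?t ?S) (Le (Var 0) (numeral_tm n)))"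
      by (rule taut3[OF eq_Le[of PA ?t "Succ (Var 0)" ?S ?S] eq_refl'[of PA ?S]
            PA_le_succ[of "Var 0" "numeral_tm n"]]) auto
    have "PA \<turnstile> Imp (Eq ?t (Succ (Var 0))) (Imp (Le ?t ?S) (bdisj (Suc n) ?t))"
      by (rule taut2[OF 1 2]) auto
    then show "PA \<turnstile> Imp (Eq ?t (Succ (Var 0))) (lift (Imp (Le t (numeral_tm (Suc n))) (bdisj (Suc n) t)))"
      by (simp add: lift_def lift_tm_def)
  qed
qed

text \<open>The finite case distinction on which all later reasoning inside \<open>PA\<close> rests:
  below a numeral, each value may be treated by its own proof.\<close>

lemma PA_le_numeral_imp:
  assumes "\<And>i. i \<le> n \<Longrightarrow> PA \<turnstile> Imp (Eq t (numeral_tm i)) \<psi>"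
  shows "PA \<turnstile> Imp (Le t (numeral_tm n)) \<psi>"
  by (rule taut2[OF PA_le_numeral_bdisj bdisj_imp[OF assms]]) auto

lemma PA_numeral_le: "m \<le> n \<Longrightarrow> PA \<turnstile> Le (numeral_tm m) (numeral_tm n)"
  using proves.mp[OF PA_le_witness PA_add_numeral[of "n - m" m]] by simp

lemma PA_numeral_not_le: "n < m \<Longrightarrow> PA \<turnstile> Neg (Le (numeral_tm m) (numeral_tm n))"
proof -
  assume "n < m"
  then have "PA \<turnstile> Imp (Eq (numeral_tm m) (numeral_tm i)) (Neg (Le (numeral_tm m) (numeral_tm n)))" if "i \<le> n" for i
    by (intro taut1[OF PA_numeral_neq[of m i]]) (use that in auto)
  from PA_le_numeral_imp[OF this] show ?thesis by (rule taut1) auto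
qed

text \<open>Addition recurses on its second argument, whereas the witness of \<open>Le\<close> is
  the first, so a successor has to be moved across. With a numeral in second place an outer
  induction suffices.\<close>

lemma PA_succ_add_numeral: "PA \<turnstile> Eq (Add (Succ t) (numeral_tm n)) (Add t (Succ (numeral_tm n)))"
proof (induction n)
  case 0
  have 1: "PA \<turnstile> Eq (Add (Succ t) Zero) (Succ t)" by (rule PA_add_zero)
  have 2: "PA \<turnstile> Eq (Succ t) (Succ (Add t Zero))"
    by (rule proves.mp[OF eq_Succ proves.mp[OF eq_sym PA_add_zero]])
  show ?case using PA_trans[OF 1 PA_trans[OF 2 proves.mp[OF eq_sym PA_add_succ]]] by simp
next
  case (Suc n)
  show ?case
    using PA_trans[OF PA_add_succ PA_trans[OF proves.mp[OF eq_Succ Suc] proves.mp[OF eq_sym PA_add_succ]]] by simp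
qed

lemma PA_linear: "PA \<turnstile> Disj (Le t (numeral_tm n)) (Le (numeral_tm n) t)"
proof (induction n)
  case 0
  show ?case
    by (rule taut2[OF PA_add_zero[of t] PA_le_witness[of t Zero t]]) auto
next
  case (Suc n)
  let ?n = "numeral_tm n" and ?S = "Succ (numeral_tm n)" and ?t = "lift_tm t"
  have A: "PA \<turnstile> Imp (Eq t (numeral_tm i)) (Le t ?S)" if "i \<le> Suc n" for i
    by (rule taut3[OF eq_sym[of PA t "numeral_tm i"] eq_Le[of PA "numeral_tm i" t ?S ?S]
          taut2[OF eq_refl'[of PA ?S] PA_numeral_le[OF that], of "Conj (Eq ?S ?S) (Le (numeral_tm i) ?S)"]]) auto
  have 1: "PA \<turnstile> Imp (Le t ?n) (Le t ?S)"
    by (rule PA_le_numeral_imp) (auto intro: A)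
  let ?D = "Disj (Eq t ?n) (Le ?S t)"
  have "PA \<turnstile> Imp (Le ?n t) ?D"
  proof (rule PA_le_imp)
    let ?z = "Var 0" and ?Dl = "Disj (Eq ?t ?n) (Le ?S ?t)"
    have "PA \<turnstile> Imp (Eq (Add ?z ?n) ?t) ?Dl"
    \<comment> \<open>The witness \<open>Var 0\<close> of \<open>Le ?n t\<close> decides the case:
      if it is zero then \<open>t\<close> equals the numeral, and if it is a successor then its
      predecessor witnesses \<open>Le ?S t\<close>.\<close>
    proof (rule PA_cases[of "Var 0"])
      let ?zn = "Add ?z ?n" and ?on = "Add Zero ?n"
      have "PA \<turnstile> Imp (Eq ?z Zero) (Eq ?zn ?on)"
        by (rule taut2[OF eq_Add[of PA ?z Zero ?n ?n] eq_refl'[of PA ?n]]) auto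
      then have b: "PA \<turnstile> Imp (Eq ?z Zero) (Eq ?n ?zn)"
        by (rule taut4[OF _ PA_add_numeral[of 0 n, simplified] eq_trans[of PA ?zn ?on ?n] eq_sym[of PA ?zn ?n]]) auto
      show "PA \<turnstile> Imp (Eq (Var 0) Zero) (Imp (Eq (Add ?z ?n) ?t) ?Dl)"
        by (rule taut3[OF b eq_trans[of PA ?n ?zn ?t] eq_sym[of PA ?n ?t]]) auto
      let ?tt = "lift_tm ?t"
      have c: "PA \<turnstile> Imp (Eq (Var 1) (Succ ?z)) (Eq (Add (Succ ?z) ?n) (Add (Var 1) ?n))"
        by (rule taut3[OF eq_Add[of PA "Succ ?z" "Var 1" ?n ?n] eq_refl'[of PA ?n] eq_sym[of PA "Var 1" "Succ ?z"]]) auto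
      have d: "PA \<turnstile> Imp (Eq (Var 1) (Succ ?z)) (Eq (Add ?z ?S) (Add (Var 1) ?n))"
        by (rule taut3[OF c proves.mp[OF eq_sym PA_succ_add_numeral[of ?z n]]
              eq_trans[of PA "Add ?z ?S" "Add (Succ ?z) ?n" "Add (Var 1) ?n"]]) auto
      have "PA \<turnstile> Imp (Eq (Var 1) (Succ ?z)) (Imp (Eq (Add (Var 1) ?n) ?tt) (Disj (Eq ?tt ?n) (Le ?S ?tt)))"
        by (rule taut3[OF d eq_trans[of PA "Add ?z ?S" "Add (Var 1) ?n" ?tt] PA_le_witness[of ?z ?S ?tt]]) auto
      then show "PA \<turnstile> Imp (Eq (lift_tm (Var 0)) (Succ (Var 0))) (lift (Imp (Eq (Add ?z ?n) ?t) ?Dl))"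
        by (simp add: lift_def lift_tm_def)
    qed
    then show "PA \<turnstile> Imp (Eq (Add (Var 0) (lift_tm ?n)) ?t) (lift ?D)" by (simp add: lift_def lift_tm_def)
  qed
  then have "PA \<turnstile> Imp (Le ?n t) (Disj (Le t ?S) (Le ?S t))"
    by (rule taut2[OF _ A[of n]]) auto
  then show ?case by (rule taut3[OF Suc 1]) auto
qed

section \<open>Provable decidability of bounded formulas\<close>

lemma up_num_inst: "(\<lambda>i. subst_tm (Var(0 := numeral_tm k)) (up (num e) i)) = num (case_nat k e)"
proof
  fix i show "subst_tm (Var(0 := numeral_tm k)) (up (num e) i) = num (case_nat k e) i" by (cases i) auto
qed

lemma case_num: "case_nat (numeral_tm k) (num e) = num (case_nat k e)"
  by (auto split: nat.split)

text \<open>The bound of a quantifier evaluates to a numeral, so a bounded quantifier is a finite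
  case distinction: a universal one is proved, or an existential one refuted, value by value, and
  otherwise a single value settles it.\<close>

lemma Delta0_decided:
  assumes "Delta0 \<phi>"
  shows "PA \<turnstile> (if sat e \<phi> then subst (num e) \<phi> else Neg (subst (num e) \<phi>))"
  using assms
proof (induction arbitrary: e)
  case (1 s t)
  let ?s = "subst_tm (num e) s" and ?t = "subst_tm (num e) t"
  let ?m = "numeral_tm (tval e s)" and ?n = "numeral_tm (tval e t)"
  show ?case
  proof (cases "tval e s = tval e t")
    case True
    then show ?thesis using PA_trans[OF PA_eval[of e s] proves.mp[OF eq_sym PA_eval[of e t, folded True]]] by simp
  next
    case False
    have "PA \<turnstile> Imp (Eq ?s ?t) (Eq ?m ?t)"
      by (rule taut2[OF proves.mp[OF eq_sym PA_eval[of e s]] eq_trans[of PA ?m ?s ?t]]) auto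
    then have "PA \<turnstile> Imp (Eq ?s ?t) (Eq ?m ?n)"
      by (rule taut3[OF _ PA_eval[of e t] eq_trans[of PA ?m ?t ?n]]) auto
    then have "PA \<turnstile> Neg (Eq ?s ?t)" by (rule taut2[OF _ PA_numeral_neq[OF False]]) auto
    then show ?thesis using False by simp
  qed
next
  case (2 s t)
  let ?s = "subst_tm (num e) s" and ?t = "subst_tm (num e) t"
  let ?m = "numeral_tm (tval e s)" and ?n = "numeral_tm (tval e t)"
  show ?case
  proof (cases "tval e s \<le> tval e t")
    case True
    have "PA \<turnstile> Imp (Le ?m ?n) (Le ?s ?t)"
      by (rule taut3[OF proves.mp[OF eq_sym PA_eval[of e s]] proves.mp[OF eq_sym PA_eval[of e t]]
            eq_Le[of PA ?m ?s ?n ?t]]) auto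
    then show ?thesis using True proves.mp[OF _ PA_numeral_le[OF True]] by auto
  next
    case False
    have "PA \<turnstile> Imp (Le ?s ?t) (Le ?m ?n)"
      by (rule taut3[OF PA_eval[of e s] PA_eval[of e t] eq_Le[of PA ?s ?m ?t ?n]]) auto
    then have "PA \<turnstile> Neg (Le ?s ?t)"
      by (rule taut2[OF _ PA_numeral_not_le[of "tval e t" "tval e s"]]) (use False in auto)
    then show ?thesis using False by simp
  qed
next
  case (3 \<phi>)
  show ?case by (rule taut1[OF 3(2)[of e]]) (auto split: if_splits)
next
  case (4 \<phi> \<psi>)
  show ?case by (rule taut2[OF 4(3)[of e] 4(4)[of e]]) (auto split: if_splits)
next
  case (5 \<phi> \<psi>)
  show ?case by (rule taut2[OF 5(3)[of e] 5(4)[of e]]) (auto split: if_splits)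
next
  case (6 \<phi> \<psi>)
  show ?case by (rule taut2[OF 6(3)[of e] 6(4)[of e]]) (auto split: if_splits)
next
  case (7 \<phi> t)
  let ?t = "subst_tm (num e) t" and ?n = "numeral_tm (tval e t)" and ?B = "subst (up (num e)) \<phi>"
  have eqn: "PA \<turnstile> Eq (lift_tm ?t) ?n" using PA_subst[OF PA_eval[of e t]] by (simp add: lift_tm_def)
  show ?case
  proof (cases "\<forall>k\<le>tval e t. sat (case_nat k e) \<phi>")
    case True
    have "PA \<turnstile> Imp (Le (Var 0) ?n) ?B"
    proof (rule PA_le_numeral_imp)
      fix k assume "k \<le> tval e t"
      then have "PA \<turnstile> subst (num (case_nat k e)) \<phi>" using 7(2)[of "case_nat k e"] True by auto
      then have "PA \<turnstile> subst (Var(0 := numeral_tm k)) ?B" by (simp add: subst_comp up_num_inst)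
      then show "PA \<turnstile> Imp (Eq (Var 0) (numeral_tm k)) ?B"
        by (rule taut2[OF _ eq_replace_back[of PA 0 "numeral_tm k" ?B]]) auto
    qed
    then have "PA \<turnstile> Imp (Conj (Eq (lift_tm ?t) ?n) (Le (Var 0) (lift_tm ?t))) ?B"
      by (rule taut3[OF eq_Le[of PA "Var 0" "Var 0" "lift_tm ?t" ?n] eq_refl'[of PA "Var 0"]]) auto
    then have "PA \<turnstile> Imp (Le (Var 0) (lift_tm ?t)) ?B" by (rule taut2[OF eqn]) auto
    then show ?thesis using True by (auto simp: subst_tm_up_lift intro: proves.gen)
  next
    case False
    then obtain k where k: "k \<le> tval e t" "\<not> sat (case_nat k e) \<phi>" by auto
    have n: "PA \<turnstile> Neg (subst (num (case_nat k e)) \<phi>)" using 7(2)[of "case_nat k e"] k by auto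
    have le: "PA \<turnstile> Le (numeral_tm k) ?t"
      by (rule taut3[OF PA_numeral_le[OF k(1)] proves.mp[OF eq_sym PA_eval[of e t]]
            taut2[OF eq_refl'[of PA "numeral_tm k"] eq_Le[of PA "numeral_tm k" "numeral_tm k" ?n ?t],
              of "Imp (Eq ?n ?t) (Imp (Le (numeral_tm k) ?n) (Le (numeral_tm k) ?t))"]]) auto
    have "PA \<turnstile> Imp (subst (num e) (Forall (Imp (Le (Var 0) (lift_tm t)) \<phi>)))
        (subst (case_nat (numeral_tm k) (num e)) (Imp (Le (Var 0) (lift_tm t)) \<phi>))"
      by (rule subst_forall_imp)
    then have "PA \<turnstile> Imp (subst (num e) (Forall (Imp (Le (Var 0) (lift_tm t)) \<phi>)))
        (Imp (Le (numeral_tm k) ?t) (subst (num (case_nat k e)) \<phi>))"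
      by (simp add: case_num subst_tm_lift)
    then have "PA \<turnstile> Neg (subst (num e) (Forall (Imp (Le (Var 0) (lift_tm t)) \<phi>)))"
      by (rule taut3[OF _ le n]) auto
    then show ?thesis using False by auto
  qed
next
  case (8 \<phi> t)
  let ?t = "subst_tm (num e) t" and ?n = "numeral_tm (tval e t)" and ?B = "subst (up (num e)) \<phi>"
  have eqn: "PA \<turnstile> Eq (lift_tm ?t) ?n" using PA_subst[OF PA_eval[of e t]] by (simp add: lift_tm_def)
  show ?case
  proof (cases "\<exists>k\<le>tval e t. sat (case_nat k e) \<phi>")
    case False
    have "PA \<turnstile> Imp (Le (Var 0) ?n) (Neg ?B)"
    proof (rule PA_le_numeral_imp)
      fix k assume "k \<le> tval e t"
      then have "PA \<turnstile> Neg (subst (num (case_nat k e)) \<phi>)" using 8(2)[of "case_nat k e"] False by auto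
      then have "PA \<turnstile> Neg (subst (Var(0 := numeral_tm k)) ?B)" by (simp add: subst_comp up_num_inst)
      then show "PA \<turnstile> Imp (Eq (Var 0) (numeral_tm k)) (Neg ?B)"
        by (rule taut2[OF _ eq_replace[of PA 0 "numeral_tm k" ?B]]) auto
    qed
    then have "PA \<turnstile> Imp (Conj (Eq (lift_tm ?t) ?n) (Le (Var 0) (lift_tm ?t))) (Neg ?B)"
      by (rule taut3[OF eq_Le[of PA "Var 0" "Var 0" "lift_tm ?t" ?n] eq_refl'[of PA "Var 0"]]) auto
    then have "PA \<turnstile> Imp (Conj (Le (Var 0) (lift_tm ?t)) ?B) (lift (Neg (Eq Zero Zero)))"
      by (rule taut2[OF eqn]) auto
    from exists_imp[OF this] have "PA \<turnstile> Neg (Exists (Conj (Le (Var 0) (lift_tm ?t)) ?B))"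
      by (rule taut2[OF eq_refl'[of PA Zero]]) auto
    then show ?thesis using False by (auto simp: subst_tm_up_lift)
  next
    case True
    then obtain k where k: "k \<le> tval e t" "sat (case_nat k e) \<phi>" by auto
    have n: "PA \<turnstile> subst (num (case_nat k e)) \<phi>" using 8(2)[of "case_nat k e"] k by auto
    have le: "PA \<turnstile> Le (numeral_tm k) ?t"
      by (rule taut3[OF PA_numeral_le[OF k(1)] proves.mp[OF eq_sym PA_eval[of e t]]
            taut2[OF eq_refl'[of PA "numeral_tm k"] eq_Le[of PA "numeral_tm k" "numeral_tm k" ?n ?t],
              of "Imp (Eq ?n ?t) (Imp (Le (numeral_tm k) ?n) (Le (numeral_tm k) ?t))"]]) auto
    have "PA \<turnstile> Imp (subst (case_nat (numeral_tm k) (num e)) (Conj (Le (Var 0) (lift_tm t)) \<phi>))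
        (subst (num e) (Exists (Conj (Le (Var 0) (lift_tm t)) \<phi>)))"
      by (rule imp_subst_exists)
    then have "PA \<turnstile> Imp (Conj (Le (numeral_tm k) ?t) (subst (num (case_nat k e)) \<phi>))
       (subst (num e) (Exists (Conj (Le (Var 0) (lift_tm t)) \<phi>)))"
      by (simp add: case_num subst_tm_lift)
    then have "PA \<turnstile> subst (num e) (Exists (Conj (Le (Var 0) (lift_tm t)) \<phi>))"
      by (rule taut3[OF _ le n]) auto
    then show ?thesis using True by auto
  qed
qed

lemma Sigma1_complete: "Sigma1 \<phi> \<Longrightarrow> sat e \<phi> \<Longrightarrow> PA \<turnstile> subst (num e) \<phi>"
proof (induction arbitrary: e rule: Sigma1.induct)
  case (1 \<phi>) then show ?case using Delta0_decided[of \<phi> e] by simp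
next
  case (2 \<phi>)
  then obtain k where "PA \<turnstile> subst (num (case_nat k e)) \<phi>" by auto
  then show ?case using proves.mp[OF imp_subst_exists[where \<sigma> = "num e" and t = "numeral_tm k"]] by (simp add: case_num)
qed

lemma Delta0_subst: "Delta0 \<phi> \<Longrightarrow> Delta0 (subst \<sigma> \<phi>)"
  by (induction arbitrary: \<sigma> rule: Delta0.induct) (auto simp: subst_tm_up_lift intro: Delta0.intros)

lemma Sigma1_subst: "Sigma1 \<phi> \<Longrightarrow> Sigma1 (subst \<sigma> \<phi>)"
  by (induction arbitrary: \<sigma> rule: Sigma1.induct) (auto intro: Sigma1.intros Delta0_subst)

section \<open>Enumerable relations\<close>

text \<open>Relations and functions take their arguments from an environment, as formulas do: \<open>re\<close> stands for
  recursively enumerable, \<open>dec\<close> for decidable and \<open>cf\<close> for computable.\<close>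

definition re :: "((nat \<Rightarrow> nat) \<Rightarrow> bool) \<Rightarrow> bool" where
  "re R \<longleftrightarrow> (\<exists>\<phi>. Delta0 \<phi> \<and> (\<forall>e. R e \<longleftrightarrow> (\<exists>n. sat (case_nat n e) \<phi>)))"

definition dec :: "((nat \<Rightarrow> nat) \<Rightarrow> bool) \<Rightarrow> bool" where
  "dec R \<longleftrightarrow> re R \<and> re (\<lambda>e. \<not> R e)"

definition cf :: "((nat \<Rightarrow> nat) \<Rightarrow> nat) \<Rightarrow> bool" where
  "cf F \<longleftrightarrow> re (\<lambda>e. e 0 = F (\<lambda>i. e (Suc i)))"

text \<open>Reading the witness as a mere bound for a witness makes the matrix monotone in it.
  Several witnesses can then be merged into one.\<close>

lemma re_mono:
  assumes "re R"
  obtains \<phi> where "Delta0 \<phi>" "\<And>e. R e \<longleftrightarrow> (\<exists>n. sat (case_nat n e) \<phi>)"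
    "\<And>m n e. m \<le> n \<Longrightarrow> sat (case_nat m e) \<phi> \<Longrightarrow> sat (case_nat n e) \<phi>"
proof -
  from assms obtain \<phi> where \<phi>: "Delta0 \<phi>" "\<And>e. R e \<longleftrightarrow> (\<exists>n. sat (case_nat n e) \<phi>)"
    by (auto simp: re_def)
  let ?\<psi> = "Exists (Conj (Le (Var 0) (lift_tm (Var 0)))
    (subst (case_nat (Var 0) (\<lambda>i. Var (Suc (Suc i)))) \<phi>))"
  have s: "sat (case_nat n e) ?\<psi> \<longleftrightarrow> (\<exists>a\<le>n. sat (case_nat a e) \<phi>)" for n e
    by (simp add: sat_subst case_nat_eta)
  have "Delta0 ?\<psi>" by (intro Delta0.intros Delta0_subst \<phi>)
  moreover have "R e \<longleftrightarrow> (\<exists>n. sat (case_nat n e) ?\<psi>)" for e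
    unfolding s \<phi>(2) by blast
  moreover have "sat (case_nat n e) ?\<psi>" if "m \<le> n" "sat (case_nat m e) ?\<psi>" for m n e
    using that unfolding s by (meson le_trans)
  ultimately show ?thesis by (rule that)
qed

lemma re_Delta0: "Delta0 \<phi> \<Longrightarrow> re (\<lambda>e. sat e \<phi>)"
  unfolding re_def by (intro exI[of _ "lift \<phi>"]) (auto simp: lift_def[abs_def] Delta0_subst sat_subst)

lemma dec_Delta0: "Delta0 \<phi> \<Longrightarrow> dec (\<lambda>e. sat e \<phi>)"
  using re_Delta0[of "Neg \<phi>"] by (auto simp: dec_def re_Delta0 intro: Delta0.intros)

lemma re_rename: "re R \<Longrightarrow> re (\<lambda>e. R (\<lambda>i. e (r i)))"
proof -
  assume "re R"
  then obtain \<phi> where \<phi>: "Delta0 \<phi>" "\<And>e. R e \<longleftrightarrow> (\<exists>n. sat (case_nat n e) \<phi>)"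
    by (auto simp: re_def)
  have "R (\<lambda>i. e (r i)) \<longleftrightarrow> (\<exists>n. sat (case_nat n e) (subst (case_nat (Var 0) (\<lambda>i. Var (Suc (r i)))) \<phi>))" for e
    by (simp add: sat_subst \<phi>(2) case_nat_eta)
  then show ?thesis unfolding re_def using Delta0_subst[OF \<phi>(1)] by blast
qed

lemma re_conj: assumes "re R" "re Q" shows "re (\<lambda>e. R e \<and> Q e)"
proof -
  obtain \<phi> where \<phi>: "Delta0 \<phi>" "\<And>e. R e \<longleftrightarrow> (\<exists>n. sat (case_nat n e) \<phi>)"
    "\<And>m n e. m \<le> n \<Longrightarrow> sat (case_nat m e) \<phi> \<Longrightarrow> sat (case_nat n e) \<phi>" using re_mono[OF assms(1)] by blast
  obtain \<psi> where \<psi>: "Delta0 \<psi>" "\<And>e. Q e \<longleftrightarrow> (\<exists>n. sat (case_nat n e) \<psi>)"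
    "\<And>m n e. m \<le> n \<Longrightarrow> sat (case_nat m e) \<psi> \<Longrightarrow> sat (case_nat n e) \<psi>" using re_mono[OF assms(2)] by blast
  have "R e \<and> Q e \<longleftrightarrow> (\<exists>n. sat (case_nat n e) (Conj \<phi> \<psi>))" for e
  proof
    assume "R e \<and> Q e"
    then obtain m n where "sat (case_nat m e) \<phi>" "sat (case_nat n e) \<psi>" using \<phi>(2) \<psi>(2) by blast
    then have "sat (case_nat (max m n) e) (Conj \<phi> \<psi>)"
      using \<phi>(3)[of m "max m n"] \<psi>(3)[of n "max m n"] by simp
    then show "\<exists>n. sat (case_nat n e) (Conj \<phi> \<psi>)" by blast
  qed (auto simp: \<phi>(2) \<psi>(2))
  moreover have "Delta0 (Conj \<phi> \<psi>)" using \<phi>(1) \<psi>(1) by (rule Delta0.intros)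
  ultimately show ?thesis unfolding re_def by blast
qed

lemma re_disj: assumes "re R" "re Q" shows "re (\<lambda>e. R e \<or> Q e)"
proof -
  obtain \<phi> where \<phi>: "Delta0 \<phi>" "\<And>e. R e \<longleftrightarrow> (\<exists>n. sat (case_nat n e) \<phi>)" using assms(1) by (auto simp: re_def)
  obtain \<psi> where \<psi>: "Delta0 \<psi>" "\<And>e. Q e \<longleftrightarrow> (\<exists>n. sat (case_nat n e) \<psi>)" using assms(2) by (auto simp: re_def)
  have "R e \<or> Q e \<longleftrightarrow> (\<exists>n. sat (case_nat n e) (Disj \<phi> \<psi>))" for e
    by (auto simp: \<phi>(2) \<psi>(2))
  moreover have "Delta0 (Disj \<phi> \<psi>)" using \<phi>(1) \<psi>(1) by (rule Delta0.intros)
  ultimately show ?thesis unfolding re_def by blast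
qed

lemma swap_env: "(\<lambda>i. tval (case_nat y (case_nat n e)) (case_nat (Var (Suc 0)) (case_nat (Var 0) (\<lambda>i. Var (Suc (Suc i)))) i))
    = case_nat n (case_nat y e)"
  by (auto split: nat.split)

text \<open>Both \<open>y\<close> and the witness are placed below one number, so that a single
  unbounded quantifier remains in front of a \<open>Delta0\<close> matrix.\<close>

lemma re_ex:
  assumes "re (\<lambda>e. R (e 0) (\<lambda>i. e (Suc i)))"
  shows "re (\<lambda>e. \<exists>y. R y e)"
proof -
  obtain \<phi> where \<phi>: "Delta0 \<phi>" "\<And>e. R (e 0) (\<lambda>i. e (Suc i)) \<longleftrightarrow> (\<exists>n. sat (case_nat n e) \<phi>)"
    "\<And>m n e. m \<le> n \<Longrightarrow> sat (case_nat m e) \<phi> \<Longrightarrow> sat (case_nat n e) \<phi>" using re_mono[OF assms] by blast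
  let ?\<psi> = "Exists (Conj (Le (Var 0) (lift_tm (Var 0)))
    (subst (case_nat (Var (Suc 0)) (case_nat (Var 0) (\<lambda>i. Var (Suc (Suc i))))) \<phi>))"
  have "(\<exists>y. R y e) \<longleftrightarrow> (\<exists>n. sat (case_nat n e) ?\<psi>)" for e
  proof
    assume "\<exists>y. R y e"
    then obtain y n where "sat (case_nat n (case_nat y e)) \<phi>" using \<phi>(2)[of "case_nat _ e"] by auto
    then have "sat (case_nat (max n y) (case_nat y e)) \<phi>" using \<phi>(3) by (meson max.cobounded1)
    then have "sat (case_nat (max n y) e) ?\<psi>" by (auto simp: sat_subst swap_env intro!: exI[of _ y])
    then show "\<exists>n. sat (case_nat n e) ?\<psi>" by blast
  next
    assume "\<exists>n. sat (case_nat n e) ?\<psi>"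
    then obtain n y where "sat (case_nat n (case_nat y e)) \<phi>" by (auto simp: sat_subst swap_env)
    then show "\<exists>y. R y e" using \<phi>(2)[of "case_nat y e"] by auto
  qed
  moreover have "Delta0 ?\<psi>" by (intro Delta0.intros Delta0_subst \<phi>)
  ultimately show ?thesis unfolding re_def by blast
qed

text \<open>Collection: each of the finitely many \<open>y\<close> has a witness of its own, and by
  monotonicity the sum of these witnesses serves them all.\<close>

lemma re_ball_var:
  assumes "re (\<lambda>e. R (e 0) (\<lambda>i. e (Suc i)))"
  shows "re (\<lambda>e. \<forall>y\<le>e k. R y e)"
proof -
  obtain \<phi> where \<phi>: "Delta0 \<phi>" "\<And>e. R (e 0) (\<lambda>i. e (Suc i)) \<longleftrightarrow> (\<exists>n. sat (case_nat n e) \<phi>)"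
    "\<And>m n e. m \<le> n \<Longrightarrow> sat (case_nat m e) \<phi> \<Longrightarrow> sat (case_nat n e) \<phi>" using re_mono[OF assms] by blast
  let ?\<psi> = "Forall (Imp (Le (Var 0) (lift_tm (Var (Suc k))))
    (subst (case_nat (Var (Suc 0)) (case_nat (Var 0) (\<lambda>i. Var (Suc (Suc i))))) \<phi>))"
  have s: "sat (case_nat n e) ?\<psi> \<longleftrightarrow> (\<forall>y\<le>e k. sat (case_nat n (case_nat y e)) \<phi>)" for n e
    by (simp add: sat_subst swap_env)
  have "(\<forall>y\<le>e k. R y e) \<longleftrightarrow> (\<exists>n. sat (case_nat n e) ?\<psi>)" for e
    unfolding s
  proof
    assume "\<forall>y\<le>e k. R y e"
    then have "\<forall>y\<le>e k. \<exists>n. sat (case_nat n (case_nat y e)) \<phi>" using \<phi>(2)[of "case_nat _ e"] by auto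
    then obtain f where f: "\<forall>y\<le>e k. sat (case_nat (f y) (case_nat y e)) \<phi>" by metis
    have "\<forall>y\<le>e k. sat (case_nat (sum f {..e k}) (case_nat y e)) \<phi>"
    proof (intro allI impI)
      fix y assume y: "y \<le> e k"
      then have "f y \<le> sum f {..e k}" by (intro member_le_sum) auto
      then show "sat (case_nat (sum f {..e k}) (case_nat y e)) \<phi>" using f y \<phi>(3) by blast
    qed
    then show "\<exists>n. \<forall>y\<le>e k. sat (case_nat n (case_nat y e)) \<phi>" by blast
  next
    assume "\<exists>n. \<forall>y\<le>e k. sat (case_nat n (case_nat y e)) \<phi>"
    then show "\<forall>y\<le>e k. R y e" using \<phi>(2)[of "case_nat _ e"] by auto
  qed
  moreover have "Delta0 ?\<psi>" by (intro Delta0.intros Delta0_subst \<phi>)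
  ultimately show ?thesis unfolding re_def by blast
qed

section \<open>Computable functions and decidable relations\<close>

lemma cf_shift_re: "cf F \<Longrightarrow> re (\<lambda>e. e k = F (\<lambda>i. e (r i)))"
  unfolding cf_def using re_rename[of _ "case_nat k r"] by fastforce

text \<open>The value is named by an existential quantifier. As \<open>F\<close> is total, the same
  works for the complement of \<open>R\<close>, which yields \<open>dec_cf\<close>.\<close>

lemma re_cf:
  assumes "cf F" "re (\<lambda>e. R (e 0) (\<lambda>i. e (Suc i)))"
  shows "re (\<lambda>e. R (F e) e)"
proof -
  have "re (\<lambda>e. e 0 = F (\<lambda>i. e (Suc i)) \<and> R (e 0) (\<lambda>i. e (Suc i)))"
    by (intro re_conj assms(2)) (use assms(1) in \<open>simp add: cf_def\<close>)
  from re_ex[where R = "\<lambda>y e. y = F e \<and> R y e", OF this] show ?thesis by simp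
qed

lemma dec_cf:
  assumes "cf F" "dec (\<lambda>e. R (e 0) (\<lambda>i. e (Suc i)))"
  shows "dec (\<lambda>e. R (F e) e)"
  using assms unfolding dec_def
  by (auto intro: re_cf[where R = R] re_cf[where R = "\<lambda>y e. \<not> R y e"])

lemma cf_rename: "cf F \<Longrightarrow> cf (\<lambda>e. F (\<lambda>i. e (r i)))"
  unfolding cf_def[of "\<lambda>e. F (\<lambda>i. e (r i))"] by (rule cf_shift_re)

lemma cf_let:
  assumes "cf F" "cf (\<lambda>e. H (e 0) (\<lambda>i. e (Suc i)))"
  shows "cf (\<lambda>e. H (F e) e)"
proof -
  have "re (\<lambda>e. e 1 = H (e 0) (\<lambda>i. e (Suc (Suc i))))"
    using cf_shift_re[OF assms(2), of 1 "case_nat 0 (\<lambda>i. Suc (Suc i))"] by simp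
  then show ?thesis
    unfolding cf_def[of "\<lambda>e. H (F e) e"]
    using re_cf[OF cf_rename[OF assms(1), of Suc], of "\<lambda>y e. e 0 = H y (\<lambda>i. e (Suc i))"] by simp
qed

lemma cf_comp1: "cf (\<lambda>e. h (e 0)) \<Longrightarrow> cf F \<Longrightarrow> cf (\<lambda>e. h (F e))"
  by (rule cf_let[where H = "\<lambda>y e. h y"])

lemma cf_comp2: "cf (\<lambda>e. h (e 0) (e 1)) \<Longrightarrow> cf F \<Longrightarrow> cf G \<Longrightarrow> cf (\<lambda>e. h (F e) (G e))"
proof -
  assume h: "cf (\<lambda>e. h (e 0) (e 1))" and F: "cf F" and G: "cf G"
  \<comment> \<open>Truncated subtraction from 1 exchanges the indices 0 and 1.\<close>
  have "cf (\<lambda>e. h (e 1) (e 0))" using cf_rename[OF h, of "\<lambda>i. 1 - i"] by simp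
  then have "cf (\<lambda>e. h (e 0) (G (\<lambda>i. e (Suc i))))"
    using cf_let[OF cf_rename[OF G, of Suc], of "\<lambda>y e. h (e 0) y"] by simp
  then show ?thesis using cf_let[OF F, of "\<lambda>y e. h y (G e)"] by simp
qed

lemma re_Eq: "re (\<lambda>e. tval e s = tval e t)"
  using re_Delta0[OF Delta0.intros(1)[of s t]] by simp

lemma cf_var: "cf (\<lambda>e. e i)"
  unfolding cf_def using re_Eq[of "Var 0" "Var (Suc i)"] by simp

lemma cf_const: "cf (\<lambda>e. k)"
  unfolding cf_def using re_Eq[of "Var 0" "numeral_tm k"] by simp

lemma cf_Suc: "cf F \<Longrightarrow> cf (\<lambda>e. Suc (F e))"
  by (rule cf_comp1) (use re_Eq[of "Var 0" "Succ (Var 1)"] in \<open>auto simp: cf_def\<close>)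

lemma cf_add: "cf F \<Longrightarrow> cf G \<Longrightarrow> cf (\<lambda>e. F e + G e)"
  by (rule cf_comp2) (use re_Eq[of "Var 0" "Add (Var 1) (Var 2)"] in \<open>auto simp: cf_def numeral_2_eq_2\<close>)

lemma cf_mult: "cf F \<Longrightarrow> cf G \<Longrightarrow> cf (\<lambda>e. F e * G e)"
  by (rule cf_comp2) (use re_Eq[of "Var 0" "Mul (Var 1) (Var 2)"] in \<open>auto simp: cf_def numeral_2_eq_2\<close>)

lemma dec_rel:
  assumes "dec (\<lambda>e. R (e 0) (e 1))" "cf F" "cf G"
  shows "dec (\<lambda>e. R (F e) (G e))"
proof -
  have "dec (\<lambda>e. R (e 1) (e 0))"
    using assms(1) re_rename[of _ "\<lambda>i. 1 - i"] unfolding dec_def by fastforce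
  then have "dec (\<lambda>e. R (e 0) (G (\<lambda>i. e (Suc i))))"
    using dec_cf[OF cf_rename[OF assms(3), of Suc], of "\<lambda>y e. R (e 0) y"] by simp
  then show ?thesis using dec_cf[OF assms(2), of "\<lambda>y e. R y (G e)"] by simp
qed

lemma dec_eq: "cf F \<Longrightarrow> cf G \<Longrightarrow> dec (\<lambda>e. F e = G e)"
  by (rule dec_rel) (use dec_Delta0[OF Delta0.intros(1)[of "Var 0" "Var 1"]] in simp)

lemma dec_le: "cf F \<Longrightarrow> cf G \<Longrightarrow> dec (\<lambda>e. F e \<le> G e)"
  by (rule dec_rel) (use dec_Delta0[OF Delta0.intros(2)[of "Var 0" "Var 1"]] in simp)

lemma dec_less: "cf F \<Longrightarrow> cf G \<Longrightarrow> dec (\<lambda>e. F e < G e)"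
  unfolding less_eq_Suc_le by (intro dec_le cf_Suc)

lemma dec_not: "dec R \<Longrightarrow> dec (\<lambda>e. \<not> R e)"
  by (simp add: dec_def)

lemma dec_conj: "dec R \<Longrightarrow> dec Q \<Longrightarrow> dec (\<lambda>e. R e \<and> Q e)"
  unfolding dec_def de_Morgan_conj by (intro conjI re_conj re_disj) simp_all

lemma dec_disj: "dec R \<Longrightarrow> dec Q \<Longrightarrow> dec (\<lambda>e. R e \<or> Q e)"
  unfolding dec_def de_Morgan_disj by (intro conjI re_conj re_disj) simp_all

lemma dec_imp: "dec R \<Longrightarrow> dec Q \<Longrightarrow> dec (\<lambda>e. R e \<longrightarrow> Q e)"
  unfolding imp_conv_disj by (intro dec_disj dec_not)

lemma dec_re: "dec R \<Longrightarrow> re R"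
  by (simp add: dec_def)

lemma re_ball:
  assumes "cf F" "re (\<lambda>e. R (e 0) (\<lambda>i. e (Suc i)))"
  shows "re (\<lambda>e. \<forall>y\<le>F e. R y e)"
proof -
  have "re (\<lambda>e. R (e 0) (\<lambda>i. e (Suc (Suc i))))"
    using re_rename[OF assms(2), of "case_nat 0 (\<lambda>i. Suc (Suc i))"] by simp
  then have "re (\<lambda>e. \<forall>y\<le>e 0. R y (\<lambda>i. e (Suc i)))"
    using re_ball_var[of "\<lambda>y e. R y (\<lambda>i. e (Suc i))" 0] by simp
  then show ?thesis by (rule re_cf[OF assms(1), of "\<lambda>b e. \<forall>y\<le>b. R y e"])
qed

lemma re_bex:
  assumes "cf F" "re (\<lambda>e. R (e 0) (\<lambda>i. e (Suc i)))"
  shows "re (\<lambda>e. \<exists>y\<le>F e. R y e)"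
  by (intro re_ex re_conj assms(2) dec_re[OF dec_le] cf_var cf_rename[OF assms(1)])

lemma dec_ball:
  assumes "cf F" "dec (\<lambda>e. R (e 0) (\<lambda>i. e (Suc i)))"
  shows "dec (\<lambda>e. \<forall>y\<le>F e. R y e)"
proof -
  have "re (\<lambda>e. \<exists>y\<le>F e. \<not> R y e)" by (rule re_bex[OF assms(1)]) (use assms(2) in \<open>simp add: dec_def\<close>)
  moreover have "re (\<lambda>e. \<forall>y\<le>F e. R y e)" by (rule re_ball[OF assms(1)]) (use assms(2) in \<open>simp add: dec_def\<close>)
  ultimately show ?thesis by (simp add: dec_def)
qed

lemma dec_bex:
  assumes "cf F" "dec (\<lambda>e. R (e 0) (\<lambda>i. e (Suc i)))"
  shows "dec (\<lambda>e. \<exists>y\<le>F e. R y e)"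
  using dec_not[OF dec_ball[OF assms(1) dec_not[OF assms(2)]]] by simp

lemma dec_all_less:
  assumes "cf F" "dec (\<lambda>e. R (e 0) (\<lambda>i. e (Suc i)))"
  shows "dec (\<lambda>e. \<forall>y<F e. R y e)"
proof -
  have "dec (\<lambda>e. \<forall>y\<le>F e. y < F e \<longrightarrow> R y e)"
    by (intro dec_ball dec_imp dec_less cf_var cf_rename[OF assms(1)] assms)
  moreover have "(\<forall>y\<le>F e. y < F e \<longrightarrow> R y e) \<longleftrightarrow> (\<forall>y<F e. R y e)" for e by auto
  ultimately show ?thesis by simp
qed

lemma re_all_less:
  assumes "cf F" "re (\<lambda>e. R (e 0) (\<lambda>i. e (Suc i)))"
  shows "re (\<lambda>e. \<forall>y<F e. R y e)"
proof -
  have "re (\<lambda>e. \<forall>y\<le>F e. y \<ge> F e \<or> R y e)"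
    by (intro re_ball re_disj dec_re[OF dec_le] cf_var cf_rename[OF assms(1)] assms)
  moreover have "(\<forall>y\<le>n. n \<le> y \<or> P y) \<longleftrightarrow> (\<forall>y<n. P y)" for n :: nat and P
    by (metis leD leI less_imp_le)
  ultimately show ?thesis by simp
qed

lemma re_ex_less:
  assumes "cf F" "re (\<lambda>e. R (e 0) (\<lambda>i. e (Suc i)))"
  shows "re (\<lambda>e. \<exists>y<F e. R y e)"
  by (intro re_ex re_conj assms(2) dec_re[OF dec_less] cf_var cf_rename[OF assms(1)])

lemma cf_if:
  assumes "dec R" "cf F" "cf G"
  shows "cf (\<lambda>e. if R e then F e else G e)"
proof -
  have R: "re (\<lambda>e. R (\<lambda>i. e (Suc i)))" "re (\<lambda>e. \<not> R (\<lambda>i. e (Suc i)))"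
    using assms(1) re_rename[of R Suc] re_rename[of "\<lambda>e. \<not> R e" Suc] by (auto simp: dec_def)
  have "re (\<lambda>e. (R (\<lambda>i. e (Suc i)) \<and> e 0 = F (\<lambda>i. e (Suc i))) \<or> (\<not> R (\<lambda>i. e (Suc i)) \<and> e 0 = G (\<lambda>i. e (Suc i))))"
    using assms(2,3) by (intro re_disj re_conj R) (simp_all add: cf_def)
  moreover have "((R (\<lambda>i. e (Suc i)) \<and> e 0 = F (\<lambda>i. e (Suc i))) \<or> (\<not> R (\<lambda>i. e (Suc i)) \<and> e 0 = G (\<lambda>i. e (Suc i))))
      \<longleftrightarrow> e 0 = (if R (\<lambda>i. e (Suc i)) then F (\<lambda>i. e (Suc i)) else G (\<lambda>i. e (Suc i)))" for e by auto
  ultimately show ?thesis by (simp add: cf_def)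
qed

section \<open>Pairing\<close>

definition pfst :: "nat \<Rightarrow> nat" where "pfst x = fst (prod_decode x)"
definition psnd :: "nat \<Rightarrow> nat" where "psnd x = snd (prod_decode x)"

lemma pfst_encode [simp]: "pfst (prod_encode (a, b)) = a" by (simp add: pfst_def)
lemma psnd_encode [simp]: "psnd (prod_encode (a, b)) = b" by (simp add: psnd_def)
lemma encode_pfst_psnd [simp]: "prod_encode (pfst x, psnd x) = x" by (simp add: pfst_def psnd_def)

text \<open>Doubling clears the division in the triangle number, so that the graph of the pairing is
  a polynomial equation.\<close>

lemma prod_encode_graph: "v = prod_encode (a, b) \<longleftrightarrow> v + v = (a + b) * Suc (a + b) + (a + a)"
proof -
  have "even ((a + b) * Suc (a + b))" by simp
  then have "2 * prod_encode (a, b) = (a + b) * Suc (a + b) + 2 * a"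
    by (simp only: prod_encode_def split triangle_def distrib_left dvd_mult_div_cancel)
  then show ?thesis by linarith
qed

lemma cf_prod_encode: "cf F \<Longrightarrow> cf G \<Longrightarrow> cf (\<lambda>e. prod_encode (F e, G e))"
proof (rule cf_comp2[where h = "\<lambda>a b. prod_encode (a, b)"])
  show "cf (\<lambda>e. prod_encode (e 0, e 1))"
    unfolding cf_def prod_encode_graph
    by (intro dec_re[OF dec_eq] cf_add cf_mult cf_Suc cf_var)
qed

lemma cf_pfst: "cf F \<Longrightarrow> cf (\<lambda>e. pfst (F e))"
proof (rule cf_comp1[where h = pfst])
  have "re (\<lambda>e. \<exists>b. prod_encode (e 0, b) = e 1)"
    by (intro re_ex dec_re[OF dec_eq] cf_prod_encode cf_var)
  moreover have "(\<exists>b. prod_encode (x, b) = y) \<longleftrightarrow> x = pfst y" for x y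
    by (metis pfst_encode encode_pfst_psnd)
  ultimately show "cf (\<lambda>e. pfst (e 0))" by (simp add: cf_def)
qed

lemma cf_psnd: "cf F \<Longrightarrow> cf (\<lambda>e. psnd (F e))"
proof (rule cf_comp1[where h = psnd])
  have "re (\<lambda>e. \<exists>b. prod_encode (b, e 0) = e 1)"
    by (intro re_ex dec_re[OF dec_eq] cf_prod_encode cf_var)
  moreover have "(\<exists>b. prod_encode (b, x) = y) \<longleftrightarrow> x = psnd y" for x y
    by (metis psnd_encode encode_pfst_psnd)
  ultimately show "cf (\<lambda>e. psnd (e 0))" by (simp add: cf_def)
qed

section \<open>Recursion\<close>

text \<open>Goedel's beta function: two numbers code a finite sequence through the Chinese remainder
  theorem.\<close>

definition beta :: "nat \<Rightarrow> nat \<Rightarrow> nat \<Rightarrow> nat" where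
  "beta p q i = p mod Suc (Suc i * q)"

lemma mod_graph: "v = a mod Suc b \<longleftrightarrow> v \<le> b \<and> (\<exists>k. a = k * Suc b + v)"
proof
  assume "v = a mod Suc b"
  then show "v \<le> b \<and> (\<exists>k. a = k * Suc b + v)"
    using mod_less_divisor[of "Suc b" a] div_mult_mod_eq[of a "Suc b"] by (metis less_Suc_eq_le zero_less_Suc)
next
  assume "v \<le> b \<and> (\<exists>k. a = k * Suc b + v)"
  then show "v = a mod Suc b" by (metis le_imp_less_Suc mod_less mod_mult_self3)
qed

lemma cf_beta: "cf F \<Longrightarrow> cf G \<Longrightarrow> cf H \<Longrightarrow> cf (\<lambda>e. beta (F e) (G e) (H e))"
proof -
  assume F: "cf F" and G: "cf G" and H: "cf H"
  have "cf (\<lambda>e. e 0 mod Suc (e 1))"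
    unfolding cf_def mod_graph
    by (intro re_conj re_ex dec_re[OF dec_eq] dec_re[OF dec_le] cf_add cf_mult cf_Suc cf_var)
  then show ?thesis unfolding beta_def
    by (rule cf_comp2[where h = "\<lambda>a b. a mod Suc b"]) (intro F G H cf_mult cf_Suc)+
qed

text \<open>A common prime factor divides the difference \<open>(j - i) * fact n\<close> of the
  moduli. As \<open>j - i\<close> divides \<open>fact n\<close>, the prime divides
  \<open>fact n\<close>, hence also 1.\<close>

lemma beta_coprime:
  assumes "i < j" "j \<le> n"
  shows "coprime (Suc (Suc i * fact n)) (Suc (Suc j * fact n) :: nat)"
proof (rule ccontr)
  assume "\<not> ?thesis"
  then obtain p :: nat where p: "prime p" "p dvd Suc (Suc i * fact n)" "p dvd Suc (Suc j * fact n)"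
    using prime_factor_nat[of "gcd (Suc (Suc i * fact n)) (Suc (Suc j * fact n))"]
    by (metis coprime_iff_gcd_eq_1 dvd_trans gcd_dvd1 gcd_dvd2)
  then have "p dvd Suc (Suc j * fact n) - Suc (Suc i * fact n)" by (intro dvd_diff_nat)
  moreover have "Suc (Suc j * fact n) - Suc (Suc i * fact n) = (j - i) * fact n"
    by (simp add: diff_mult_distrib)
  moreover have "(j - i) dvd fact n" using assms by (intro dvd_fact) auto
  ultimately have "p dvd fact n"
    using p(1) by (metis prime_dvd_mult_iff dvd_trans)
  then have "p dvd Suc i * fact n" by simp
  then have "p dvd 1" using p(2) by (metis dvd_add_right_iff plus_1_eq_Suc add.commute)
  then show False using p(1) by simp
qed

lemma beta_exists: "\<exists>p q. \<forall>i\<le>n. beta p q i = f i"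
proof -
  \<comment> \<open>\<open>N\<close> exceeds every index, as coprimality of the moduli demands, and
    every value, so that each value is its own residue.\<close>
  define N where "N = n + sum f {..n}"
  define q :: nat where "q = fact N"
  have "\<exists>p. \<forall>i\<in>{..n}. [p = f i] (mod Suc (Suc i * q))"
  proof (rule chinese_remainder_nat)
    show "\<forall>i\<in>{..n}. \<forall>j\<in>{..n}. i \<noteq> j \<longrightarrow> coprime (Suc (Suc i * q)) (Suc (Suc j * q))"
    proof (intro ballI impI)
      fix i j assume "i \<in> {..n}" "j \<in> {..n}" "i \<noteq> j"
      then consider "i < j" "j \<le> N" | "j < i" "i \<le> N" by (force simp: N_def)
      then show "coprime (Suc (Suc i * q)) (Suc (Suc j * q))"
        unfolding q_def by cases (use beta_coprime coprime_commute in blast)+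
    qed
  qed simp
  then obtain p where p: "\<And>i. i \<le> n \<Longrightarrow> [p = f i] (mod Suc (Suc i * q))" by auto
  have "beta p q i = f i" if "i \<le> n" for i
  proof -
    have "f i \<le> sum f {..n}" using that by (intro member_le_sum) auto
    also have "\<dots> \<le> fact N" using fact_ge_self[of N] by (simp add: N_def)
    also have "\<dots> \<le> Suc i * q" by (simp add: q_def)
    finally show ?thesis using p[OF that] by (simp add: beta_def cong_def)
  qed
  then show ?thesis by blast
qed

lemma cf_rec_nat:
  assumes A: "cf A" and S: "cf (\<lambda>e. S (e 0) (e 1) (\<lambda>i. e (Suc (Suc i))))" and N: "cf N"
  shows "cf (\<lambda>e. rec_nat (A e) (\<lambda>y r. S y r e) (N e))"
proof -
  \<comment> \<open>The environment below the quantifiers over \<open>p\<close>, \<open>q\<close>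
    and \<open>y\<close>: index 0 is \<open>y\<close>, 1 is \<open>q\<close>, 2 is \<open>p\<close>,
    3 is the result, and the arguments begin at 4.\<close>
  have S': "cf (\<lambda>e. S (e 0) (beta (e 2) (e 1) (e 0)) (\<lambda>i. e (Suc (Suc (Suc (Suc i))))))"
  proof -
    have "cf (\<lambda>e. S (e 1) (e 0) (\<lambda>i. e (Suc (Suc (Suc (Suc (Suc i)))))))"
      using cf_rename[OF S, of "case_nat 1 (case_nat 0 (\<lambda>i. Suc (Suc (Suc (Suc (Suc i))))))"] by simp
    then show ?thesis
      using cf_let[of "\<lambda>e. beta (e 2) (e 1) (e 0)" "\<lambda>y e. S (e 0) y (\<lambda>i. e (Suc (Suc (Suc (Suc i)))))"]
        cf_beta[OF cf_var[of 2] cf_var[of 1] cf_var[of 0]] by simp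
  qed
  have "re (\<lambda>e. \<exists>p q. beta p q 0 = A (\<lambda>i. e (Suc i)) \<and>
      (\<forall>y<N (\<lambda>i. e (Suc i)). beta p q (Suc y) = S y (beta p q y) (\<lambda>i. e (Suc i))) \<and>
      e 0 = beta p q (N (\<lambda>i. e (Suc i))))"
    by (intro re_ex re_conj dec_re[OF dec_eq] re_all_less cf_beta cf_Suc cf_var cf_const
        cf_rename[OF A] cf_rename[OF N]) (use S' in \<open>simp add: numeral_2_eq_2\<close>)
  moreover have "(\<exists>p q. beta p q 0 = A e \<and> (\<forall>y<N e. beta p q (Suc y) = S y (beta p q y) e) \<and> x = beta p q (N e))
      \<longleftrightarrow> x = rec_nat (A e) (\<lambda>y r. S y r e) (N e)" for x e
  proof
    assume "\<exists>p q. beta p q 0 = A e \<and> (\<forall>y<N e. beta p q (Suc y) = S y (beta p q y) e) \<and> x = beta p q (N e)"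
    then obtain p q where pq: "beta p q 0 = A e" "\<And>y. y < N e \<Longrightarrow> beta p q (Suc y) = S y (beta p q y) e"
      "x = beta p q (N e)" by blast
    have "y \<le> N e \<Longrightarrow> beta p q y = rec_nat (A e) (\<lambda>y r. S y r e) y" for y
      by (induction y) (auto simp: pq)
    then show "x = rec_nat (A e) (\<lambda>y r. S y r e) (N e)" using pq by simp
  next
    assume x: "x = rec_nat (A e) (\<lambda>y r. S y r e) (N e)"
    obtain p q where "\<forall>i\<le>N e. beta p q i = rec_nat (A e) (\<lambda>y r. S y r e) i" using beta_exists by blast
    then show "\<exists>p q. beta p q 0 = A e \<and> (\<forall>y<N e. beta p q (Suc y) = S y (beta p q y) e) \<and> x = beta p q (N e)"
      using x by (intro exI[of _ p] exI[of _ q]) auto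
  qed
  ultimately show ?thesis by (simp add: cf_def)
qed

text \<open>A common shape for terms, formulas, derivations and graphs of recursive functions:
  \<open>R x y z\<close> allows the step from \<open>y\<close> and \<open>z\<close> to
  \<open>x\<close>. A rule with one premise may take it twice.\<close>

inductive cl :: "(nat \<Rightarrow> bool) \<Rightarrow> (nat \<Rightarrow> nat \<Rightarrow> nat \<Rightarrow> bool) \<Rightarrow> nat \<Rightarrow> bool" for A R where
  base: "A x \<Longrightarrow> cl A R x"
| step: "R x y z \<Longrightarrow> cl A R y \<Longrightarrow> cl A R z \<Longrightarrow> cl A R x"

definition cl_seq :: "(nat \<Rightarrow> bool) \<Rightarrow> (nat \<Rightarrow> nat \<Rightarrow> nat \<Rightarrow> bool) \<Rightarrow> nat list \<Rightarrow> bool" where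
  "cl_seq A R xs \<longleftrightarrow> (\<forall>i<length xs. A (xs ! i) \<or> (\<exists>j<i. \<exists>k<i. R (xs ! i) (xs ! j) (xs ! k)))"

lemma cl_seq_append: "cl_seq A R xs \<Longrightarrow> cl_seq A R ys \<Longrightarrow> cl_seq A R (xs @ ys)"
  unfolding cl_seq_def
proof (intro allI impI)
  fix i
  assume xs: "\<forall>i<length xs. A (xs ! i) \<or> (\<exists>j<i. \<exists>k<i. R (xs ! i) (xs ! j) (xs ! k))"
    and ys: "\<forall>i<length ys. A (ys ! i) \<or> (\<exists>j<i. \<exists>k<i. R (ys ! i) (ys ! j) (ys ! k))"
    and i: "i < length (xs @ ys)"
  show "A ((xs @ ys) ! i) \<or> (\<exists>j<i. \<exists>k<i. R ((xs @ ys) ! i) ((xs @ ys) ! j) ((xs @ ys) ! k))"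
  proof (cases "i < length xs")
    case True
    then consider "A (xs ! i)" | j k where "j < i" "k < i" "R (xs ! i) (xs ! j) (xs ! k)" using xs by blast
    then show ?thesis
    proof cases
      case 1 then show ?thesis using True by (simp add: nth_append)
    next
      case 2
      then show ?thesis using True by (intro disjI2 exI[of _ j] exI[of _ k] conjI) (auto simp: nth_append)
    qed
  next
    case False
    define i' where "i' = i - length xs"
    have i': "i = length xs + i'" "i' < length ys" using False i by (auto simp: i'_def)
    consider "A (ys ! i')" | j k where "j < i'" "k < i'" "R (ys ! i') (ys ! j) (ys ! k)"
      using ys i'(2) by blast
    then show ?thesis
    proof cases
      case 1 then show ?thesis by (simp add: i'(1))
    next
      case 2
      then show ?thesis
        by (intro disjI2 exI[of _ "length xs + j"] exI[of _ "length xs + k"] conjI) (auto simp: i'(1))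
    qed
  qed
qed

lemma cl_seq_snoc:
  assumes "cl_seq A R xs" "A x \<or> (\<exists>y\<in>set xs. \<exists>z\<in>set xs. R x y z)"
  shows "cl_seq A R (xs @ [x])"
  unfolding cl_seq_def
proof (intro allI impI)
  fix i assume "i < length (xs @ [x])"
  then consider "i < length xs" | "i = length xs" by force
  then show "A ((xs @ [x]) ! i) \<or> (\<exists>j<i. \<exists>k<i. R ((xs @ [x]) ! i) ((xs @ [x]) ! j) ((xs @ [x]) ! k))"
  proof cases
    case 1
    then consider "A (xs ! i)" | j k where "j < i" "k < i" "R (xs ! i) (xs ! j) (xs ! k)"
      using assms(1) unfolding cl_seq_def by blast
    then show ?thesis
    proof cases
      case 1 then show ?thesis using \<open>i < length xs\<close> by (simp add: nth_append)
    next
      case 2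
      then show ?thesis using \<open>i < length xs\<close>
        by (intro disjI2 exI[of _ j] exI[of _ k] conjI) (auto simp: nth_append)
    qed
  next
    case 2
    consider "A x" | j k where "j < length xs" "k < length xs" "R x (xs ! j) (xs ! k)"
      using assms(2) by (auto simp: in_set_conv_nth)
    then show ?thesis
    proof cases
      case 1 then show ?thesis using \<open>i = length xs\<close> by simp
    next
      case 2
      then show ?thesis using \<open>i = length xs\<close>
        by (intro disjI2 exI[of _ j] exI[of _ k] conjI) (auto simp: nth_append)
    qed
  qed
qed

text \<open>Derivation trees are flattened into lists whose entries are justified by earlier ones;
  such a list can be coded by \<open>beta\<close>, and membership becomes a search for one
  code.\<close>

lemma cl_iff_seq: "cl A R x \<longleftrightarrow> (\<exists>xs. cl_seq A R xs \<and> x \<in> set xs)"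
proof
  assume "cl A R x"
  then show "\<exists>xs. cl_seq A R xs \<and> x \<in> set xs"
  proof induction
    case (base x)
    have "cl_seq A R [x]" using base by (simp add: cl_seq_def)
    then show ?case by (intro exI[of _ "[x]"]) auto
  next
    case (step x y z)
    from step.IH obtain xs ys where "cl_seq A R xs" "y \<in> set xs" "cl_seq A R ys" "z \<in> set ys" by blast
    then have "cl_seq A R ((xs @ ys) @ [x])"
      using step.hyps(1) by (intro cl_seq_snoc[OF cl_seq_append]) (simp_all, blast)
    then show ?case by (intro exI[of _ "(xs @ ys) @ [x]"]) auto
  qed
next
  assume "\<exists>xs. cl_seq A R xs \<and> x \<in> set xs"
  then obtain xs where xs: "cl_seq A R xs" "x \<in> set xs" by blast
  have "i < length xs \<Longrightarrow> cl A R (xs ! i)" for i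
  proof (induction i rule: less_induct)
    case (less i)
    consider "A (xs ! i)" | j k where "j < i" "k < i" "R (xs ! i) (xs ! j) (xs ! k)"
      using xs(1) less.prems unfolding cl_seq_def by blast
    then show ?case
    proof cases
      case 1 then show ?thesis by (rule cl.base)
    next
      case 2
      show ?thesis by (rule cl.step[where R = R and y = "xs ! j" and z = "xs ! k"]) (use 2 less in simp_all)
    qed
  qed
  then show "cl A R x" using xs(2) by (auto simp: in_set_conv_nth)
qed

lemma re_cl:
  assumes A: "re (\<lambda>e. A (e 0))" and R: "re (\<lambda>e. R (e 0) (e 1) (e 2))" and F: "cf F"
  shows "re (\<lambda>e. cl A R (F e))"
proof -
  have A': "re (\<lambda>e. A (G e))" if "cf G" for G
    using re_cf[OF that, of "\<lambda>y e. A y"] A by simp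
  have R': "re (\<lambda>e. R (G e) (H e) (K e))" if "cf G" "cf H" "cf K" for G H K
  proof -
    have "re (\<lambda>e. R (e 2) (e 1) (e 0))" using re_rename[OF R, of "\<lambda>i. 2 - i"] by simp
    then have "re (\<lambda>e. R (e 1) (e 0) (K (\<lambda>i. e (Suc (Suc i)))))"
      using re_cf[OF cf_rename[OF that(3), of "\<lambda>i. Suc (Suc i)"], of "\<lambda>y e. R (e 1) (e 0) y"] by (simp add: numeral_2_eq_2)
    then have "re (\<lambda>e. R (e 0) (H (\<lambda>i. e (Suc i))) (K (\<lambda>i. e (Suc i))))"
      using re_cf[OF cf_rename[OF that(2), of Suc], of "\<lambda>y e. R (e 0) y (K (\<lambda>i. e (Suc i)))"] by simp
    then show ?thesis using re_cf[OF that(1), of "\<lambda>y e. R y (H e) (K e)"] by simp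
  qed
  have "re (\<lambda>e. \<exists>p q n. (\<exists>m<n. beta p q m = F e) \<and>
      (\<forall>i<n. A (beta p q i) \<or> (\<exists>j<i. \<exists>k<i. R (beta p q i) (beta p q j) (beta p q k))))"
    by (intro re_ex re_conj re_disj re_ex_less re_all_less A' R' dec_re[OF dec_eq] cf_beta cf_var cf_rename[OF F])
  moreover have "(\<exists>p q n. (\<exists>m<n. beta p q m = x) \<and>
      (\<forall>i<n. A (beta p q i) \<or> (\<exists>j<i. \<exists>k<i. R (beta p q i) (beta p q j) (beta p q k)))) \<longleftrightarrow> cl A R x" for x
    unfolding cl_iff_seq
  proof
    assume "\<exists>p q n. (\<exists>m<n. beta p q m = x) \<and>
      (\<forall>i<n. A (beta p q i) \<or> (\<exists>j<i. \<exists>k<i. R (beta p q i) (beta p q j) (beta p q k)))"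
    then obtain p q n where *: "\<exists>m<n. beta p q m = x"
      "\<forall>i<n. A (beta p q i) \<or> (\<exists>j<i. \<exists>k<i. R (beta p q i) (beta p q j) (beta p q k))" by blast
    have "cl_seq A R (map (beta p q) [0..<n])"
      using *(2) by (auto simp: cl_seq_def)
    moreover have "x \<in> set (map (beta p q) [0..<n])" using *(1) by auto
    ultimately show "\<exists>xs. cl_seq A R xs \<and> x \<in> set xs" by blast
  next
    assume "\<exists>xs. cl_seq A R xs \<and> x \<in> set xs"
    then obtain xs where xs: "cl_seq A R xs" "x \<in> set xs" by blast
    obtain p q where "\<forall>i\<le>length xs. beta p q i = xs ! i" using beta_exists by blast
    then have pq: "\<And>i. i < length xs \<Longrightarrow> beta p q i = xs ! i" by auto
    have "\<exists>m<length xs. beta p q m = x" using xs(2) pq by (auto simp: in_set_conv_nth)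
    moreover have "\<forall>i<length xs. A (beta p q i) \<or> (\<exists>j<i. \<exists>k<i. R (beta p q i) (beta p q j) (beta p q k))"
    proof (intro allI impI)
      fix i assume i: "i < length xs"
      then consider "A (xs ! i)" | j k where "j < i" "k < i" "R (xs ! i) (xs ! j) (xs ! k)"
        using xs(1) unfolding cl_seq_def by blast
      then show "A (beta p q i) \<or> (\<exists>j<i. \<exists>k<i. R (beta p q i) (beta p q j) (beta p q k))"
      proof cases
        case 1 then show ?thesis by (simp add: pq i)
      next
        case 2
        then have "R (beta p q i) (beta p q j) (beta p q k)" using i by (simp add: pq)
        then show ?thesis using 2 by blast
      qed
    qed
    ultimately show "\<exists>p q n. (\<exists>m<n. beta p q m = x) \<and>
      (\<forall>i<n. A (beta p q i) \<or> (\<exists>j<i. \<exists>k<i. R (beta p q i) (beta p q j) (beta p q k)))" by blast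
  qed
  ultimately show ?thesis by simp
qed

text \<open>The graph of \<open>h\<close> is generated by two rules read off its equation. Every
  generated pair satisfies that equation; the measure \<open>m\<close> guarantees that every
  argument receives a value.\<close>

lemma cf_recursion:
  fixes h :: "nat \<Rightarrow> nat" and m :: "nat \<Rightarrow> nat"
  assumes h: "\<And>x. h x = (if B x then A x else C x (h (l x)) (h (r x)))"
    and m: "\<And>x. \<not> B x \<Longrightarrow> m (l x) < m x" "\<And>x. \<not> B x \<Longrightarrow> m (r x) < m x"
    and B: "dec (\<lambda>e. B (e 0))" and A: "cf (\<lambda>e. A (e 0))"
    and C: "cf (\<lambda>e. C (e 0) (e 1) (e 2))" and l: "cf (\<lambda>e. l (e 0))" and r: "cf (\<lambda>e. r (e 0))"
    and F: "cf F"
  shows "cf (\<lambda>e. h (F e))"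
proof (rule cf_comp1[OF _ F])
  let ?A = "\<lambda>p. B (pfst p) \<and> psnd p = A (pfst p)"
  let ?R = "\<lambda>p q q'. \<not> B (pfst p) \<and> pfst q = l (pfst p) \<and> pfst q' = r (pfst p) \<and>
    psnd p = C (pfst p) (psnd q) (psnd q')"
  have B': "dec (\<lambda>e. B (G e))" if "cf G" for G
    using dec_cf[OF that, of "\<lambda>y e. B y"] B by simp
  have C': "cf (\<lambda>e. C (G e) (H e) (K e))" if "cf G" "cf H" "cf K" for G H K
  proof -
    have "cf (\<lambda>e. C (e 2) (e 1) (e 0))" using cf_rename[OF C, of "\<lambda>i. 2 - i"] by simp
    then have "cf (\<lambda>e. C (e 1) (e 0) (K (\<lambda>i. e (Suc (Suc i)))))"
      using cf_let[OF cf_rename[OF that(3), of "\<lambda>i. Suc (Suc i)"], of "\<lambda>y e. C (e 1) (e 0) y"] by (simp add: numeral_2_eq_2)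
    then have "cf (\<lambda>e. C (e 0) (H (\<lambda>i. e (Suc i))) (K (\<lambda>i. e (Suc i))))"
      using cf_let[OF cf_rename[OF that(2), of Suc], of "\<lambda>y e. C (e 0) y (K (\<lambda>i. e (Suc i)))"] by simp
    then show ?thesis using cf_let[OF that(1), of "\<lambda>y e. C y (H e) (K e)"] by simp
  qed
  have rA: "re (\<lambda>e. ?A (e 0))"
    by (intro re_conj dec_re[OF B'] dec_re[OF dec_eq] cf_comp1[OF A] cf_pfst cf_psnd cf_var)
  have rR: "re (\<lambda>e. ?R (e 0) (e 1) (e 2))"
    by (intro re_conj dec_re[OF dec_not[OF B']] dec_re[OF dec_eq] cf_comp1[OF l] cf_comp1[OF r] C' cf_pfst cf_psnd cf_var)
  have "re (\<lambda>e. cl ?A ?R (prod_encode (e 1, e 0)))"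
    by (rule re_cl[OF rA rR]) (intro cf_prod_encode cf_var)
  moreover have "cl ?A ?R (prod_encode (x, v)) \<longleftrightarrow> v = h x" for x v
  proof
    have *: "psnd p = h (pfst p)" if "cl ?A ?R p" for p
      using that
    proof induction
      case (base p) then show ?case by (subst h) simp
    next
      case (step p q q') then show ?case by (subst h) simp
    qed
    show "v = h x" if "cl ?A ?R (prod_encode (x, v))" using *[OF that] by simp
    have "cl ?A ?R (prod_encode (x, h x))"
    proof (induction x rule: measure_induct_rule[of m])
      case (less x)
      show ?case
      proof (cases "B x")
        case True
        then show ?thesis using h[of x] by (intro cl.base) simp
      next
        case False
        show ?thesis
          by (rule cl.step[OF _ less[OF m(1)[OF False]] less[OF m(2)[OF False]]]) (use False h[of x] in simp)
      qed
    qed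
    then show "v = h x \<Longrightarrow> cl ?A ?R (prod_encode (x, v))" by simp
  qed
  ultimately show "cf (\<lambda>e. h (e 0))" by (simp add: cf_def)
qed

text \<open>The arguments are generalized to computable functions of the environment. Composition
  and recursion then fit the induction, as their inner functions are again of this kind.\<close>

lemma prim_rec_cf:
  assumes "prim_rec n f" "length Fs = n" "\<And>F. F \<in> set Fs \<Longrightarrow> cf F"
  shows "cf (\<lambda>e. f (map (\<lambda>F. F e) Fs))"
  using assms
proof (induction arbitrary: Fs rule: prim_rec.induct)
  case (zero n) show ?case by (rule cf_const)
next
  case succ
  then obtain F where "Fs = [F]" "cf F" by (cases Fs) auto
  then show ?case by (simp add: cf_Suc)
next
  case (proj i n)
  then show ?case by (simp add: cf_const)
next
  case (comp gs f n)
  have "cf (\<lambda>e. f (map (\<lambda>F. F e) (map (\<lambda>g e. g (map (\<lambda>F. F e) Fs)) gs)))"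
    by (rule comp.IH(1)) (use comp in auto)
  then show ?case by (simp add: comp_def)
next
  case (rec n f g)
  then obtain N Gs where Fs: "Fs = N # Gs" "length Gs = n" "cf N" "\<And>F. F \<in> set Gs \<Longrightarrow> cf F"
    by (cases Fs) auto
  have "cf (\<lambda>e. f (map (\<lambda>F. F e) Gs))" using rec.IH(1) Fs by simp
  moreover have "cf (\<lambda>e. g (map (\<lambda>F. F e) ((\<lambda>e. e 0) # (\<lambda>e. e 1) # map (\<lambda>F e. F (\<lambda>i. e (Suc (Suc i)))) Gs)))"
    by (rule rec.IH(2)) (use Fs in \<open>auto intro: cf_var cf_rename\<close>)
  ultimately show ?case
    using cf_rec_nat[of "\<lambda>e. f (map (\<lambda>F. F e) Gs)" "\<lambda>y r e. g (y # r # map (\<lambda>F. F e) Gs)" N] Fs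
    by (simp add: comp_def)
qed

text \<open>Termination of functions on codes: a component is sure to be smaller only under a
  nonzero tag, since \<open>prod_encode (0, 0)\<close> is 0.\<close>

lemma psnd_less: "pfst y \<noteq> 0 \<Longrightarrow> psnd y < y"
proof -
  assume "pfst y \<noteq> 0"
  then have "psnd y < pfst y + psnd y" by simp
  also have "\<dots> \<le> triangle (pfst y + psnd y) + pfst y"
    by (cases "pfst y + psnd y") auto
  also have "\<dots> = prod_encode (pfst y, psnd y)" by (simp add: prod_encode_def)
  finally show ?thesis by simp
qed

lemma pfst_le: "pfst y \<le> y" and psnd_le: "psnd y \<le> y"
  using le_prod_encode_1[of "pfst y" "psnd y"] le_prod_encode_2[of "psnd y" "pfst y"] by simp_all

lemma pfst_psnd_less: "pfst y \<noteq> 0 \<Longrightarrow> pfst (psnd y) < y" "pfst y \<noteq> 0 \<Longrightarrow> psnd (psnd y) < y"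
  using psnd_less[of y] pfst_le[of "psnd y"] psnd_le[of "psnd y"] by simp_all

lemma cf_pred: "cf F \<Longrightarrow> cf (\<lambda>e. F e - 1)"
proof (rule cf_comp1[where h = "\<lambda>x. x - 1"])
  have "re (\<lambda>e. (e 1 = 0 \<and> e 0 = 0) \<or> Suc (e 0) = e 1)"
    by (intro re_disj re_conj dec_re[OF dec_eq] cf_Suc cf_var cf_const)
  moreover have "(y = 0 \<and> x = 0) \<or> Suc x = y \<longleftrightarrow> x = y - 1" for x y :: nat by auto
  ultimately show "cf (\<lambda>e. e 0 - 1)" by (simp add: cf_def)
qed

lemmas cf_rules = cf_const cf_var cf_Suc cf_add cf_mult cf_prod_encode cf_pfst cf_psnd cf_pred cf_if
lemmas dec_rules = dec_eq dec_le dec_less dec_not dec_conj dec_disj dec_imp dec_ball dec_bex dec_all_less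

section \<open>Substitution on codes\<close>

text \<open>With \<open>d = 0\<close> the variables above \<open>k\<close> are shifted down, which gives instantiation; otherwise they
  are shifted up, and \<open>t = Var (Suc k)\<close> gives lifting.\<close>

definition shift_subst :: "nat \<Rightarrow> nat \<Rightarrow> tm \<Rightarrow> nat \<Rightarrow> tm" where
  "shift_subst d k t n =
    (if n < k then Var n else if n = k then t else if d = 0 then Var (n - 1) else Var (Suc n))"

lemma up_shift_subst: "up (shift_subst d k t) = shift_subst d (Suc k) (lift_tm t)"
proof
  fix i show "up (shift_subst d k t) i = shift_subst d (Suc k) (lift_tm t) i"
    by (cases i) (auto simp: shift_subst_def)
qed

lemma shift_subst_inst: "shift_subst 0 0 t = case_nat t Var"
  by (auto simp: shift_subst_def split: nat.split)

lemma shift_subst_lift: "shift_subst 1 0 (Var 1) = (\<lambda>i. Var (Suc i))"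
  by (auto simp: shift_subst_def)

function stm :: "nat \<Rightarrow> nat \<Rightarrow> nat \<Rightarrow> nat \<Rightarrow> nat" where
  "stm d k t y =
    (if pfst y = 0 then
       (if psnd y < k then y else if psnd y = k then t
        else if d = 0 then prod_encode (0, psnd y - 1) else prod_encode (0, Suc (psnd y)))
     else if pfst y = 2 then prod_encode (2, stm d k t (psnd y))
     else if pfst y = 3 \<or> pfst y = 4 then
       prod_encode (pfst y, prod_encode (stm d k t (pfst (psnd y)), stm d k t (psnd (psnd y))))
     else y)"
  by pat_completeness auto
termination
  by (relation "measure (\<lambda>(d, k, t, y). y)") (auto simp: psnd_less pfst_psnd_less)

declare stm.simps [simp del]

lemma stm_gn: "stm d k (gn_tm t) (gn_tm s) = gn_tm (subst_tm (shift_subst d k t) s)"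
  by (induction s) (simp_all add: stm.simps[of _ _ _ "prod_encode _"] shift_subst_def)

lemma stm_lift: "stm 1 0 (prod_encode (0, 1)) (gn_tm s) = gn_tm (lift_tm s)"
  using stm_gn[of 1 0 "Var 1" s] by (simp add: shift_subst_lift[unfolded One_nat_def] lift_tm_def)

function sfm :: "nat \<Rightarrow> nat \<Rightarrow> nat \<Rightarrow> nat \<Rightarrow> nat" where
  "sfm d k t y =
    (if pfst y = 0 \<or> pfst y = 1 then
       prod_encode (pfst y, prod_encode (stm d k t (pfst (psnd y)), stm d k t (psnd (psnd y))))
     else if pfst y = 2 then prod_encode (2, sfm d k t (psnd y))
     else if pfst y = 3 \<or> pfst y = 4 \<or> pfst y = 5 then
       prod_encode (pfst y, prod_encode (sfm d k t (pfst (psnd y)), sfm d k t (psnd (psnd y))))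
     else if pfst y = 6 \<or> pfst y = 7 then
       prod_encode (pfst y, sfm d (Suc k) (stm 1 0 (prod_encode (0, 1)) t) (psnd y))
     else y)"
  by pat_completeness auto
termination
  by (relation "measure (\<lambda>(d, k, t, y). y)") (auto simp: psnd_less pfst_psnd_less)

declare sfm.simps [simp del]

lemma sfm_gn: "sfm d k (gn_tm t) (gn \<phi>) = gn (subst (shift_subst d k t) \<phi>)"
  by (induction \<phi> arbitrary: k t)
    (simp_all add: sfm.simps[of _ _ _ "prod_encode _"] stm_gn stm_lift[unfolded One_nat_def] up_shift_subst)

lemma sfm_inst: "sfm 0 0 (gn_tm t) (gn \<phi>) = gn (inst \<phi> t)"
  by (simp add: sfm_gn shift_subst_inst inst_def)

lemma sfm_lift: "sfm (Suc 0) 0 (prod_encode (0, Suc 0)) (gn \<phi>) = gn (lift \<phi>)"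
  using sfm_gn[of 1 0 "Var 1" \<phi>] by (simp add: shift_subst_lift[unfolded One_nat_def] lift_def)

abbreviation quad :: "nat \<Rightarrow> nat \<Rightarrow> nat \<Rightarrow> nat \<Rightarrow> nat" where
  "quad d k t y \<equiv> prod_encode (d, prod_encode (k, prod_encode (t, y)))"

text \<open>The four arguments are packed into one number to fit \<open>cf_recursion\<close>, the
  last one being the measure. At a successor both recursive calls are the same.\<close>

lemma cf_stm:
  assumes "cf D" "cf K" "cf T" "cf Y"
  shows "cf (\<lambda>e. stm (D e) (K e) (T e) (Y e))"
proof -
  define h where "h x = stm (pfst x) (pfst (psnd x)) (pfst (psnd (psnd x))) (psnd (psnd (psnd x)))" for x
  define Bp where "Bp y \<longleftrightarrow> \<not> (pfst y = 2 \<or> pfst y = 3 \<or> pfst y = 4)" for y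
  define A where "A x = (let d = pfst x; k = pfst (psnd x); t = pfst (psnd (psnd x)); y = psnd (psnd (psnd x)) in
       if pfst y = 0 then
         (if psnd y < k then y else if psnd y = k then t
          else if d = 0 then prod_encode (0, psnd y - 1) else prod_encode (0, Suc (psnd y))) else y)" for x
  define l where "l x = (let y = psnd (psnd (psnd x)) in quad (pfst x) (pfst (psnd x)) (pfst (psnd (psnd x)))
       (if pfst y = 2 then psnd y else pfst (psnd y)))" for x
  define r where "r x = (let y = psnd (psnd (psnd x)) in quad (pfst x) (pfst (psnd x)) (pfst (psnd (psnd x)))
       (if pfst y = 2 then psnd y else psnd (psnd y)))" for x
  define C where "C x v w = (let y = psnd (psnd (psnd x)) in
       if pfst y = 2 then prod_encode (2, v) else prod_encode (pfst y, prod_encode (v, w)))" for x v w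
  have "cf (\<lambda>e. h (quad (D e) (K e) (T e) (Y e)))"
  proof (rule cf_recursion[where h = h and m = "\<lambda>x. psnd (psnd (psnd x))"
      and B = "\<lambda>x. Bp (psnd (psnd (psnd x)))" and A = A and l = l and r = r and C = C])
    fix x
    show "h x = (if Bp (psnd (psnd (psnd x))) then A x else C x (h (l x)) (h (r x)))"
      unfolding h_def by (subst stm.simps) (auto simp: Let_def A_def C_def l_def r_def Bp_def)
  qed (auto simp: Bp_def Let_def psnd_less pfst_psnd_less A_def C_def l_def r_def intro!: cf_rules dec_rules assms)
  then show ?thesis by (simp add: h_def)
qed

lemma cf_sfm:
  assumes "cf D" "cf K" "cf T" "cf Y"
  shows "cf (\<lambda>e. sfm (D e) (K e) (T e) (Y e))"
proof -
  define h where "h x = sfm (pfst x) (pfst (psnd x)) (pfst (psnd (psnd x))) (psnd (psnd (psnd x)))" for x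
  define Bp where "Bp y \<longleftrightarrow> \<not> (pfst y = 2 \<or> pfst y = 3 \<or> pfst y = 4 \<or> pfst y = 5 \<or> pfst y = 6 \<or> pfst y = 7)" for y
  \<comment> \<open>\<open>Q\<close> marks quantifiers, below which the index is raised and the
    substituted term lifted; \<open>bin\<close> marks the binary connectives.\<close>
  define Q where "Q y \<longleftrightarrow> pfst y = 6 \<or> pfst y = 7" for y
  define bin where "bin y \<longleftrightarrow> pfst y = 3 \<or> pfst y = 4 \<or> pfst y = 5" for y
  define A where "A x = (let d = pfst x; k = pfst (psnd x); t = pfst (psnd (psnd x)); y = psnd (psnd (psnd x)) in
       if pfst y = 0 \<or> pfst y = 1 then
       prod_encode (pfst y, prod_encode (stm d k t (pfst (psnd y)), stm d k t (psnd (psnd y)))) else y)" for x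
  define l where "l x = (let d = pfst x; k = pfst (psnd x); t = pfst (psnd (psnd x)); y = psnd (psnd (psnd x)) in
       quad d (if Q y then Suc k else k) (if Q y then stm 1 0 (prod_encode (0, 1)) t else t)
         (if bin y then pfst (psnd y) else psnd y))" for x
  define r where "r x = (let d = pfst x; k = pfst (psnd x); t = pfst (psnd (psnd x)); y = psnd (psnd (psnd x)) in
       quad d (if Q y then Suc k else k) (if Q y then stm 1 0 (prod_encode (0, 1)) t else t)
         (if bin y then psnd (psnd y) else psnd y))" for x
  define C where "C x v w = (let y = psnd (psnd (psnd x)) in
       if bin y then prod_encode (pfst y, prod_encode (v, w)) else prod_encode (pfst y, v))" for x v w
  have "cf (\<lambda>e. h (quad (D e) (K e) (T e) (Y e)))"
  proof (rule cf_recursion[where h = h and m = "\<lambda>x. psnd (psnd (psnd x))"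
      and B = "\<lambda>x. Bp (psnd (psnd (psnd x)))" and A = A and l = l and r = r and C = C])
    fix x
    show "h x = (if Bp (psnd (psnd (psnd x))) then A x else C x (h (l x)) (h (r x)))"
      unfolding h_def by (subst sfm.simps) (auto simp: Let_def A_def C_def l_def r_def Bp_def bin_def Q_def)
  qed (auto simp: Bp_def Let_def psnd_less pfst_psnd_less A_def C_def l_def r_def Q_def bin_def
      intro!: cf_rules dec_rules assms cf_stm)
  then show ?thesis by (simp add: h_def)
qed

section \<open>Theorems of an axiomatized theory are enumerable\<close>

lemma re_term: "cf F \<Longrightarrow> re (\<lambda>e. \<exists>t. F e = gn_tm t)"
proof -
  assume F: "cf F"
  let ?A = "\<lambda>x. pfst x = 0 \<or> x = prod_encode (1, 0)"
  let ?R = "\<lambda>x y z. x = prod_encode (2, y) \<or> x = prod_encode (3, prod_encode (y, z)) \<or>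
    x = prod_encode (4, prod_encode (y, z))"
  have "re (\<lambda>e. cl ?A ?R (F e))"
    by (intro re_cl F re_disj dec_re[OF dec_eq] cf_rules)
  moreover have "cl ?A ?R x \<longleftrightarrow> (\<exists>t. x = gn_tm t)" for x
  proof
    show "\<exists>t. x = gn_tm t" if "cl ?A ?R x"
      using that
    proof induction
      case (base x)
      then show ?case
      proof
        assume "pfst x = 0"
        then have "x = gn_tm (Var (psnd x))" by (metis encode_pfst_psnd gn_tm.simps(1))
        then show ?thesis by blast
      next
        assume "x = prod_encode (1, 0)"
        then have "x = gn_tm Zero" by simp
        then show ?thesis by blast
      qed
    next
      case (step x y z)
      then obtain s t where st: "y = gn_tm s" "z = gn_tm t" by blast
      with step.hyps(1) have "x = gn_tm (Succ s) \<or> x = gn_tm (Add s t) \<or> x = gn_tm (Mul s t)" by simp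
      then show ?case by blast
    qed
    have "cl ?A ?R (gn_tm t)" for t
    proof (induction t)
      case (Succ t) show ?case by (rule cl.step[OF _ Succ Succ]) simp
    next
      case (Add s t) show ?case by (rule cl.step[OF _ Add]) simp
    next
      case (Mul s t) show ?case by (rule cl.step[OF _ Mul]) simp
    qed (auto intro: cl.base)
    then show "cl ?A ?R x" if "\<exists>t. x = gn_tm t" using that by blast
  qed
  ultimately show ?thesis by simp
qed

lemma re_form: "cf F \<Longrightarrow> re (\<lambda>e. \<exists>\<phi>. F e = gn \<phi>)"
proof -
  assume F: "cf F"
  let ?A = "\<lambda>x. \<exists>a b. (\<exists>s. a = gn_tm s) \<and> (\<exists>t. b = gn_tm t) \<and>
    (x = prod_encode (0, prod_encode (a, b)) \<or> x = prod_encode (1, prod_encode (a, b)))"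
  let ?R = "\<lambda>x y z. x = prod_encode (2, y) \<or> x = prod_encode (3, prod_encode (y, z)) \<or>
    x = prod_encode (4, prod_encode (y, z)) \<or> x = prod_encode (5, prod_encode (y, z)) \<or>
    x = prod_encode (6, y) \<or> x = prod_encode (7, y)"
  have "re (\<lambda>e. ?A (e 0))"
    by (intro re_ex re_conj re_disj dec_re[OF dec_eq] cf_rules re_term)
  then have "re (\<lambda>e. cl ?A ?R (F e))"
    by (rule re_cl) (intro F re_disj dec_re[OF dec_eq] cf_rules)+
  moreover have "cl ?A ?R x \<longleftrightarrow> (\<exists>\<phi>. x = gn \<phi>)" for x
  proof
    show "\<exists>\<phi>. x = gn \<phi>" if "cl ?A ?R x"
      using that
    proof induction
      case (base x)
      then obtain s t where "x = gn (Eq s t) \<or> x = gn (Le s t)" by auto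
      then show ?case by blast
    next
      case (step x y z)
      then obtain \<phi> \<psi> where st: "y = gn \<phi>" "z = gn \<psi>" by blast
      with step.hyps(1) have "x = gn (Neg \<phi>) \<or> x = gn (Conj \<phi> \<psi>) \<or> x = gn (Disj \<phi> \<psi>) \<or> x = gn (Imp \<phi> \<psi>)
        \<or> x = gn (Forall \<phi>) \<or> x = gn (Exists \<phi>)" by simp
      then show ?case by blast
    qed
    have "cl ?A ?R (gn \<phi>)" for \<phi>
    proof (induction \<phi>)
      case (Neg \<phi>) show ?case by (rule cl.step[OF _ Neg Neg]) simp
    next
      case (Conj \<phi> \<psi>) show ?case by (rule cl.step[OF _ Conj]) simp
    next
      case (Disj \<phi> \<psi>) show ?case by (rule cl.step[OF _ Disj]) simp
    next
      case (Imp \<phi> \<psi>) show ?case by (rule cl.step[OF _ Imp]) simp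
    next
      case (Forall \<phi>) show ?case by (rule cl.step[OF _ Forall Forall]) simp
    next
      case (Exists \<phi>) show ?case by (rule cl.step[OF _ Exists Exists]) simp
    qed (auto intro!: cl.base)
    then show "cl ?A ?R x" if "\<exists>\<phi>. x = gn \<phi>" using that by blast
  qed
  ultimately show ?thesis by simp
qed

section \<open>Codes of logical axioms and theorems\<close>

lemma gn_tm_inject [simp]: "gn_tm s = gn_tm t \<longleftrightarrow> s = t"
  by (induction s arbitrary: t) (case_tac t; auto)+

lemma gn_inject [simp]: "gn \<phi> = gn \<psi> \<longleftrightarrow> \<phi> = \<psi>"
  by (induction \<phi> arbitrary: \<psi>) (case_tac \<psi>; auto)+

abbreviation "eq_c a b \<equiv> prod_encode (0, prod_encode (a, b))"
abbreviation "neg_c a \<equiv> prod_encode (2, a)"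
abbreviation "conj_c a b \<equiv> prod_encode (3, prod_encode (a, b))"
abbreviation "disj_c a b \<equiv> prod_encode (4, prod_encode (a, b))"
abbreviation "imp_c a b \<equiv> prod_encode (5, prod_encode (a, b))"
abbreviation "forall_c a \<equiv> prod_encode (6, a)"
abbreviation "exists_c a \<equiv> prod_encode (7, a)"
abbreviation "inst_c a t \<equiv> sfm 0 0 t a"
abbreviation "lift_c a \<equiv> sfm 1 0 (prod_encode (0, 1)) a"

text \<open>The disjuncts are the schemes of \<open>logical_axiom\<close> in their order,
  transferred to codes. Once the codes of the parameters are given, only computable functions and
  equality occur.\<close>

definition axiom_shape :: "nat \<Rightarrow> nat \<Rightarrow> nat \<Rightarrow> nat \<Rightarrow> nat \<Rightarrow> nat \<Rightarrow> bool" where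
  "axiom_shape a b d s t x \<longleftrightarrow>
    x = imp_c a (imp_c b a) \<or>
    x = imp_c (imp_c a (imp_c b d)) (imp_c (imp_c a b) (imp_c a d)) \<or>
    x = imp_c a (imp_c b (conj_c a b)) \<or>
    x = imp_c (conj_c a b) a \<or>
    x = imp_c (conj_c a b) b \<or>
    x = imp_c a (disj_c a b) \<or>
    x = imp_c b (disj_c a b) \<or>
    x = imp_c (imp_c a d) (imp_c (imp_c b d) (imp_c (disj_c a b) d)) \<or>
    x = imp_c (imp_c a b) (imp_c (imp_c a (neg_c b)) (neg_c a)) \<or>
    x = imp_c (neg_c (neg_c a)) a \<or>
    x = imp_c (forall_c a) (inst_c a t) \<or>
    x = imp_c (forall_c (imp_c (lift_c a) b)) (imp_c a (forall_c b)) \<or>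
    x = imp_c (inst_c a t) (exists_c a) \<or>
    x = imp_c (forall_c (imp_c a (lift_c b))) (imp_c (exists_c a) b) \<or>
    x = eq_c t t \<or>
    x = imp_c (eq_c s t) (imp_c (inst_c a s) (inst_c a t))"

lemma ex5I: "Q a b c d e \<Longrightarrow> \<exists>a b c d e. Q a b c d e"
  by blast

lemma logical_axiom_shape:
  "logical_axiom \<alpha> \<Longrightarrow> \<exists>\<phi> \<psi> \<chi> s t. axiom_shape (gn \<phi>) (gn \<psi>) (gn \<chi>) (gn_tm s) (gn_tm t) (gn \<alpha>)"
proof (induction rule: logical_axiom.induct)
  case (imp_K \<phi> \<psi>)
  show ?case by (rule ex5I[of _ \<phi> \<psi> undefined undefined undefined]) (simp add: axiom_shape_def sfm_inst sfm_lift)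
next
  case (imp_S \<phi> \<psi> \<chi>)
  show ?case by (rule ex5I[of _ \<phi> \<psi> \<chi> undefined undefined]) (simp add: axiom_shape_def sfm_inst sfm_lift)
next
  case (conj_intro \<phi> \<psi>)
  show ?case by (rule ex5I[of _ \<phi> \<psi> undefined undefined undefined]) (simp add: axiom_shape_def sfm_inst sfm_lift)
next
  case (conj_elim1 \<phi> \<psi>)
  show ?case by (rule ex5I[of _ \<phi> \<psi> undefined undefined undefined]) (simp add: axiom_shape_def sfm_inst sfm_lift)
next
  case (conj_elim2 \<phi> \<psi>)
  show ?case by (rule ex5I[of _ \<phi> \<psi> undefined undefined undefined]) (simp add: axiom_shape_def sfm_inst sfm_lift)
next
  case (disj_intro1 \<phi> \<psi>)
  show ?case by (rule ex5I[of _ \<phi> \<psi> undefined undefined undefined]) (simp add: axiom_shape_def sfm_inst sfm_lift)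
next
  case (disj_intro2 \<psi> \<phi>)
  show ?case by (rule ex5I[of _ \<phi> \<psi> undefined undefined undefined]) (simp add: axiom_shape_def sfm_inst sfm_lift)
next
  case (disj_elim \<phi> \<chi> \<psi>)
  show ?case by (rule ex5I[of _ \<phi> \<psi> \<chi> undefined undefined]) (simp add: axiom_shape_def sfm_inst sfm_lift)
next
  case (neg_intro \<phi> \<psi>)
  show ?case by (rule ex5I[of _ \<phi> \<psi> undefined undefined undefined]) (simp add: axiom_shape_def sfm_inst sfm_lift)
next
  case (neg_neg \<phi>)
  show ?case by (rule ex5I[of _ \<phi> undefined undefined undefined undefined]) (simp add: axiom_shape_def sfm_inst sfm_lift)
next
  case (forall_elim \<phi> t)
  show ?case by (rule ex5I[of _ \<phi> undefined undefined undefined t]) (simp add: axiom_shape_def sfm_inst sfm_lift)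
next
  case (forall_intro \<phi> \<psi>)
  show ?case by (rule ex5I[of _ \<phi> \<psi> undefined undefined undefined]) (simp add: axiom_shape_def sfm_inst sfm_lift)
next
  case (exists_intro \<phi> t)
  show ?case by (rule ex5I[of _ \<phi> undefined undefined undefined t]) (simp add: axiom_shape_def sfm_inst sfm_lift)
next
  case (exists_elim \<phi> \<psi>)
  show ?case by (rule ex5I[of _ \<phi> \<psi> undefined undefined undefined]) (simp add: axiom_shape_def sfm_inst sfm_lift)
next
  case (eq_refl t)
  show ?case by (rule ex5I[of _ undefined undefined undefined undefined t]) (simp add: axiom_shape_def sfm_inst sfm_lift)
next
  case (eq_subst s t \<phi>)
  show ?case by (rule ex5I[of _ \<phi> undefined undefined s t]) (simp add: axiom_shape_def sfm_inst sfm_lift)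
qed

lemma axiom_shape_logical:
  assumes "axiom_shape (gn \<phi>) (gn \<psi>) (gn \<chi>) (gn_tm s) (gn_tm t) x"
  shows "\<exists>\<alpha>. logical_axiom \<alpha> \<and> x = gn \<alpha>"
  using assms unfolding axiom_shape_def
proof (elim disjE, goal_cases)
  case 1
  then have "x = gn (Imp \<phi> (Imp \<psi> \<phi>))" by (simp add: sfm_inst sfm_lift)
  then show ?case using logical_axiom.imp_K by blast
next
  case 2
  then have "x = gn (Imp (Imp \<phi> (Imp \<psi> \<chi>)) (Imp (Imp \<phi> \<psi>) (Imp \<phi> \<chi>)))" by (simp add: sfm_inst sfm_lift)
  then show ?case using logical_axiom.imp_S by blast
next
  case 3
  then have "x = gn (Imp \<phi> (Imp \<psi> (Conj \<phi> \<psi>)))" by (simp add: sfm_inst sfm_lift)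
  then show ?case using logical_axiom.conj_intro by blast
next
  case 4
  then have "x = gn (Imp (Conj \<phi> \<psi>) \<phi>)" by (simp add: sfm_inst sfm_lift)
  then show ?case using logical_axiom.conj_elim1 by blast
next
  case 5
  then have "x = gn (Imp (Conj \<phi> \<psi>) \<psi>)" by (simp add: sfm_inst sfm_lift)
  then show ?case using logical_axiom.conj_elim2 by blast
next
  case 6
  then have "x = gn (Imp \<phi> (Disj \<phi> \<psi>))" by (simp add: sfm_inst sfm_lift)
  then show ?case using logical_axiom.disj_intro1 by blast
next
  case 7
  then have "x = gn (Imp \<psi> (Disj \<phi> \<psi>))" by (simp add: sfm_inst sfm_lift)
  then show ?case using logical_axiom.disj_intro2 by blast
next
  case 8
  then have "x = gn (Imp (Imp \<phi> \<chi>) (Imp (Imp \<psi> \<chi>) (Imp (Disj \<phi> \<psi>) \<chi>)))" by (simp add: sfm_inst sfm_lift)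
  then show ?case using logical_axiom.disj_elim by blast
next
  case 9
  then have "x = gn (Imp (Imp \<phi> \<psi>) (Imp (Imp \<phi> (Neg \<psi>)) (Neg \<phi>)))" by (simp add: sfm_inst sfm_lift)
  then show ?case using logical_axiom.neg_intro by blast
next
  case 10
  then have "x = gn (Imp (Neg (Neg \<phi>)) \<phi>)" by (simp add: sfm_inst sfm_lift)
  then show ?case using logical_axiom.neg_neg by blast
next
  case 11
  then have "x = gn (Imp (Forall \<phi>) (inst \<phi> t))" by (simp add: sfm_inst sfm_lift)
  then show ?case using logical_axiom.forall_elim by blast
next
  case 12
  then have "x = gn (Imp (Forall (Imp (lift \<phi>) \<psi>)) (Imp \<phi> (Forall \<psi>)))" by (simp add: sfm_inst sfm_lift)
  then show ?case using logical_axiom.forall_intro by blast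
next
  case 13
  then have "x = gn (Imp (inst \<phi> t) (Exists \<phi>))" by (simp add: sfm_inst sfm_lift)
  then show ?case using logical_axiom.exists_intro by blast
next
  case 14
  then have "x = gn (Imp (Forall (Imp \<phi> (lift \<psi>))) (Imp (Exists \<phi>) \<psi>))" by (simp add: sfm_inst sfm_lift)
  then show ?case using logical_axiom.exists_elim by blast
next
  case 15
  then have "x = gn (Eq t t)" by (simp add: sfm_inst sfm_lift)
  then show ?case using logical_axiom.eq_refl by blast
next
  case 16
  then have "x = gn (Imp (Eq s t) (Imp (inst \<phi> s) (inst \<phi> t)))" by (simp add: sfm_inst sfm_lift)
  then show ?case using logical_axiom.eq_subst by blast
qed

lemma re_logical_axiom: "re (\<lambda>e. \<exists>\<alpha>. logical_axiom \<alpha> \<and> e 0 = gn \<alpha>)"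
proof -
  have "re (\<lambda>e. \<exists>a b d s t. (\<exists>\<phi>. a = gn \<phi>) \<and> (\<exists>\<phi>. b = gn \<phi>) \<and> (\<exists>\<phi>. d = gn \<phi>) \<and>
      (\<exists>r. s = gn_tm r) \<and> (\<exists>r. t = gn_tm r) \<and> axiom_shape a b d s t (e 0))"
    unfolding axiom_shape_def
    by (intro re_ex re_conj re_form re_term dec_re dec_rules cf_rules cf_sfm)
  moreover have "(\<exists>a b d s t. (\<exists>\<phi>. a = gn \<phi>) \<and> (\<exists>\<phi>. b = gn \<phi>) \<and> (\<exists>\<phi>. d = gn \<phi>) \<and>
      (\<exists>r. s = gn_tm r) \<and> (\<exists>r. t = gn_tm r) \<and> axiom_shape a b d s t x) \<longleftrightarrow> (\<exists>\<alpha>. logical_axiom \<alpha> \<and> x = gn \<alpha>)"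
    (is "?L \<longleftrightarrow> ?R") for x
  proof
    show ?R if ?L
    proof -
      from that obtain \<phi> \<psi> \<chi> s t where "axiom_shape (gn \<phi>) (gn \<psi>) (gn \<chi>) (gn_tm s) (gn_tm t) x" by blast
      then show ?thesis by (rule axiom_shape_logical)
    qed
    show ?L if ?R
    proof -
      from that obtain \<alpha> where \<alpha>: "logical_axiom \<alpha>" "x = gn \<alpha>" by blast
      from logical_axiom_shape[OF \<alpha>(1)] obtain \<phi> \<psi> \<chi> s t
        where "axiom_shape (gn \<phi>) (gn \<psi>) (gn \<chi>) (gn_tm s) (gn_tm t) x" unfolding \<alpha>(2) by blast
      then show ?thesis by blast
    qed
  qed
  ultimately show ?thesis by simp
qed

lemma re_theorems:
  assumes "prim_rec_axiomatized_theory T"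
  shows "re (\<lambda>e. \<exists>\<phi>. T \<turnstile> \<phi> \<and> e 0 = gn \<phi>)"
proof -
  obtain f where f: "prim_rec 1 f" "\<And>n. f [n] = (if n \<in> gn ` T then 1 else 0)"
    using assms by (auto simp: prim_rec_axiomatized_theory_def prim_rec_set_def)
  have "cf (\<lambda>e. f (map (\<lambda>F. F e) [\<lambda>e. e 0]))"
    by (rule prim_rec_cf[OF f(1)]) (auto intro: cf_var)
  then have "re (\<lambda>e. f [e 0] = 1)" using dec_re[OF dec_eq[OF _ cf_const]] by simp
  moreover have "f [n] = 1 \<longleftrightarrow> n \<in> gn ` T" for n by (simp add: f(2))
  ultimately have T: "re (\<lambda>e. e 0 \<in> gn ` T)" by simp
  let ?A = "\<lambda>x. x \<in> gn ` T \<or> (\<exists>\<alpha>. logical_axiom \<alpha> \<and> x = gn \<alpha>)"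
  \<comment> \<open>The first disjunct is modus ponens, \<open>y\<close> being the implication and
    \<open>z\<close> its antecedent; the second is generalization.\<close>
  let ?R = "\<lambda>x y z. y = prod_encode (5, prod_encode (z, x)) \<or> x = prod_encode (6, y)"
  have "re (\<lambda>e. ?A (e 0))" by (intro re_disj T re_logical_axiom)
  then have "re (\<lambda>e. cl ?A ?R (e 0))"
    by (rule re_cl) (intro re_disj dec_re[OF dec_eq] cf_rules)+
  moreover have "cl ?A ?R x \<longleftrightarrow> (\<exists>\<phi>. T \<turnstile> \<phi> \<and> x = gn \<phi>)" for x
  proof
    show "\<exists>\<phi>. T \<turnstile> \<phi> \<and> x = gn \<phi>" if "cl ?A ?R x"
      using that
    proof induction
      case (base x) then show ?case by (auto intro: proves.axiom proves.logical)
    next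
      case (step x y z)
      then obtain \<phi> \<psi> where st: "T \<turnstile> \<phi>" "y = gn \<phi>" "T \<turnstile> \<psi>" "z = gn \<psi>" by blast
      from step.hyps(1) show ?case
      proof
        assume y: "y = prod_encode (5, prod_encode (z, x))"
        then obtain \<chi> where "\<phi> = Imp \<psi> \<chi>" "x = gn \<chi>" using st(2,4) by (cases \<phi>) auto
        then show ?thesis using st proves.mp by blast
      next
        assume "x = prod_encode (6, y)"
        then have "x = gn (Forall \<phi>)" using st by simp
        then show ?thesis using st proves.gen by blast
      qed
    qed
    have "cl ?A ?R (gn \<phi>)" if "T \<turnstile> \<phi>" for \<phi>
      using that
    proof induction
      case (axiom \<phi>) then show ?case by (intro cl.base) auto
    next
      case (logical \<phi>) then show ?case by (intro cl.base) auto
    next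
      case (mp \<phi> \<psi>) show ?case by (rule cl.step[OF _ mp.IH]) simp
    next
      case (gen \<phi>) show ?case by (rule cl.step[OF _ gen.IH gen.IH]) simp
    qed
    then show "cl ?A ?R x" if "\<exists>\<phi>. T \<turnstile> \<phi> \<and> x = gn \<phi>" using that by blast
  qed
  ultimately show ?thesis by simp
qed

section \<open>The enumerable relations of the construction\<close>

definition numc :: "nat \<Rightarrow> nat" where
  "numc n = rec_nat (prod_encode (1, 0)) (\<lambda>_ r. prod_encode (2, r)) n"

lemma numc_gn: "numc n = gn_tm (numeral_tm n)"
  by (induction n) (auto simp: numc_def)

lemma cf_numc: "cf F \<Longrightarrow> cf (\<lambda>e. numc (F e))"
  unfolding numc_def
  by (rule cf_rec_nat[where A = "\<lambda>e. prod_encode (1, 0)" and S = "\<lambda>y r e. prod_encode (2, r)"]) (intro cf_rules)+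

text \<open>For \<open>c = gn \<Psi>\<close> this is the code of \<open>\<Psi>(c, a)\<close>.\<close>

definition self_app :: "nat \<Rightarrow> nat \<Rightarrow> nat" where
  "self_app c a = sfm 0 0 (numc a) (sfm 0 0 (numc c) c)"

lemma self_app_gn: "self_app (gn \<Psi>) a = gn (inst (inst \<Psi> (numeral_tm (gn \<Psi>))) (numeral_tm a))"
  by (simp add: self_app_def numc_gn sfm_inst)

lemma cf_self_app: "cf F \<Longrightarrow> cf G \<Longrightarrow> cf (\<lambda>e. self_app (F e) (G e))"
  unfolding self_app_def by (intro cf_sfm cf_numc cf_const)

definition iter_app :: "nat \<Rightarrow> nat \<Rightarrow> nat \<Rightarrow> nat" where
  "iter_app c i y = rec_nat y (\<lambda>_ r. self_app c r) i"

lemma iter_app_simps [simp]: "iter_app c 0 y = y" "iter_app c (Suc i) y = self_app c (iter_app c i y)"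
  by (simp_all add: iter_app_def)

lemma cf_iter_app:
  assumes "cf C" "cf I" "cf Y"
  shows "cf (\<lambda>e. iter_app (C e) (I e) (Y e))"
  unfolding iter_app_def
  by (rule cf_rec_nat[where S = "\<lambda>y r e. self_app (C e) r"])
    (intro assms cf_self_app cf_var cf_rename[OF assms(1)])+

text \<open>The bound on \<open>i\<close> makes the relation decidable. It loses nothing as soon as
  every application increases the code, see \<open>descends_iff\<close>.\<close>

definition descends :: "nat \<Rightarrow> nat \<Rightarrow> nat \<Rightarrow> bool" where
  "descends c x y \<longleftrightarrow> (\<exists>i\<le>x. iter_app c i y = x)"

lemma dec_descends:
  assumes "cf C" "cf X" "cf Y"
  shows "dec (\<lambda>e. descends (C e) (X e) (Y e))"
  unfolding descends_def
  by (intro dec_bex dec_eq cf_iter_app cf_var assms cf_rename[OF assms(1)] cf_rename[OF assms(2)] cf_rename[OF assms(3)])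

lemma cf_pow2: "cf F \<Longrightarrow> cf (\<lambda>e. 2 ^ F e)"
proof -
  assume "cf F"
  then have "cf (\<lambda>e. rec_nat 1 (\<lambda>_ r. r + r) (F e))"
    by (intro cf_rec_nat[where A = "\<lambda>e. 1" and S = "\<lambda>y r e. r + r"] cf_rules)
  moreover have "rec_nat 1 (\<lambda>_ r. r + r) n = (2::nat) ^ n" for n by (induction n) auto
  ultimately show ?thesis by simp
qed

text \<open>The binary digit of \<open>l\<close> at position \<open>y\<close> is 1, expressed by
  quotient and remainder with bounds that keep the relation decidable.\<close>

lemma set_decode_iff: "y \<in> set_decode l \<longleftrightarrow> (\<exists>q\<le>l. \<exists>r\<le>l. r < 2 ^ y \<and> l = Suc (q + q) * 2 ^ y + r)"
proof
  assume "y \<in> set_decode l"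
  then have "odd (l div 2 ^ y)" by (simp add: set_decode_def)
  then obtain q where q: "l div 2 ^ y = Suc (q + q)" by (metis oddE mult_2 Suc_eq_plus1)
  have "l = Suc (q + q) * 2 ^ y + l mod 2 ^ y" by (metis q div_mult_mod_eq)
  moreover have "q \<le> l" using q div_le_dividend[of l "2 ^ y"] by simp
  moreover have "l mod 2 ^ y < 2 ^ y" "l mod 2 ^ y \<le> l" by simp_all
  ultimately show "\<exists>q\<le>l. \<exists>r\<le>l. r < 2 ^ y \<and> l = Suc (q + q) * 2 ^ y + r" by blast
next
  assume "\<exists>q\<le>l. \<exists>r\<le>l. r < 2 ^ y \<and> l = Suc (q + q) * 2 ^ y + r"
  then obtain q r where r: "r < 2 ^ y" and l: "l = Suc (q + q) * 2 ^ y + r" by blast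
  have "l div 2 ^ y = Suc (q + q)" unfolding l using r by (subst div_mult_self3) simp_all
  then show "y \<in> set_decode l" by (simp add: set_decode_def)
qed

lemma dec_mem:
  assumes "cf F" "cf G"
  shows "dec (\<lambda>e. F e \<in> set_decode (G e))"
  unfolding set_decode_iff
  by (intro dec_bex dec_rules cf_rules cf_pow2 cf_rename[OF assms(1)] cf_rename[OF assms(2)] assms)

text \<open>\<open>Th w y\<close> says that \<open>w\<close> witnesses the provability of \<open>y\<close>. A stage \<open>u = (b, w, L)\<close> proposes the valuation
  \<open>stage_val\<close>: the sentence \<open>Pr(a)\<close> is to hold if \<open>a\<close> arises by iterating \<open>Pr\<close> from a member of the
  finite set \<open>L\<close> or from a theorem found up to \<open>u\<close>. The values of \<open>stage_eval\<close> are 0 (false), 1 (true)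
  and 2 (not a Boolean combination of instances of \<open>Pr\<close>).\<close>

definition stage_val :: "(nat \<Rightarrow> nat \<Rightarrow> bool) \<Rightarrow> nat \<Rightarrow> nat \<Rightarrow> nat \<Rightarrow> bool" where
  "stage_val Th c u a \<longleftrightarrow>
    (\<exists>y\<le>a. descends c a y \<and> (y \<in> set_decode (psnd (psnd u)) \<or> (\<exists>w\<le>u. Th w y)))"

definition atom_val :: "(nat \<Rightarrow> nat \<Rightarrow> bool) \<Rightarrow> nat \<Rightarrow> nat \<Rightarrow> nat \<Rightarrow> nat" where
  "atom_val Th c u x = (if \<exists>a\<le>x. self_app c a = x
     then if \<exists>a\<le>x. self_app c a = x \<and> stage_val Th c u a then 1 else 0 else 2)"

definition neg3 :: "nat \<Rightarrow> nat" where
  "neg3 v = (if v = 0 then 1 else if v = 1 then 0 else 2)"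

definition bin3 :: "nat \<Rightarrow> nat \<Rightarrow> nat \<Rightarrow> nat" where
  "bin3 k v w = (if v = 2 \<or> w = 2 then 2
     else if k = 3 \<and> v = 1 \<and> w = 1 \<or> k = 4 \<and> (v = 1 \<or> w = 1) \<or> k = 5 \<and> (v = 0 \<or> w = 1) then 1 else 0)"

text \<open>Tag 7 covers the instances of the predicate, which begin with \<open>Exists\<close>; tag
  6 covers such an instance behind a vacuous quantifier, the form that propositional variables will
  take.\<close>

function stage_eval :: "(nat \<Rightarrow> nat \<Rightarrow> bool) \<Rightarrow> nat \<Rightarrow> nat \<Rightarrow> nat \<Rightarrow> nat" where
  "stage_eval Th c u x =
    (if pfst x = 2 then neg3 (stage_eval Th c u (psnd x))
     else if pfst x = 3 \<or> pfst x = 4 \<or> pfst x = 5 then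
       bin3 (pfst x) (stage_eval Th c u (pfst (psnd x))) (stage_eval Th c u (psnd (psnd x)))
     else if pfst x = 6 then atom_val Th c u (psnd x)
     else if pfst x = 7 then atom_val Th c u x
     else if x = gn (Eq Zero (Succ Zero)) then 0 else 2)"
  by pat_completeness auto
termination
  by (relation "measure (\<lambda>(Th, c, u, x). x)") (auto simp: psnd_less pfst_psnd_less)

declare stage_eval.simps [simp del]

text \<open>Neither modal formulas nor their interpretation occur: any provable formula with value 0
  counts. So the bell is defined, and decidable, before the predicate is fixed.\<close>

definition bell :: "(nat \<Rightarrow> nat \<Rightarrow> bool) \<Rightarrow> nat \<Rightarrow> nat \<Rightarrow> bool" where
  "bell Th c u \<longleftrightarrow> Th (pfst (psnd u)) (pfst u) \<and> stage_eval Th c u (pfst u) = 0"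

definition first_bell :: "(nat \<Rightarrow> nat \<Rightarrow> bool) \<Rightarrow> nat \<Rightarrow> nat \<Rightarrow> bool" where
  "first_bell Th c u \<longleftrightarrow> bell Th c u \<and> (\<forall>u'<u. \<not> bell Th c u')"

text \<open>The bound \<open>u < w\<close> is strict, so the first bell itself still admits the
  theorem witnessed by its number as well as its finite set.\<close>

definition admits :: "(nat \<Rightarrow> nat \<Rightarrow> bool) \<Rightarrow> nat \<Rightarrow> nat \<Rightarrow> nat \<Rightarrow> bool" where
  "admits Th c w y \<longleftrightarrow> (\<forall>u<w. \<not> bell Th c u) \<and>
    (Th w y \<or> bell Th c w \<and> y \<in> set_decode (psnd (psnd w)))"

context
  fixes Th :: "nat \<Rightarrow> nat \<Rightarrow> bool"
  assumes Th: "dec (\<lambda>e. Th (e 0) (e 1))"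
begin

lemma dec_stage_val:
  assumes "cf C" "cf U" "cf X"
  shows "dec (\<lambda>e. stage_val Th (C e) (U e) (X e))"
  unfolding stage_val_def
  by (intro dec_rules dec_descends dec_mem dec_rel[OF Th] cf_rules assms
      cf_rename[OF assms(1)] cf_rename[OF assms(2)] cf_rename[OF assms(3)])

lemma cf_atom_val:
  assumes "cf C" "cf U" "cf X"
  shows "cf (\<lambda>e. atom_val Th (C e) (U e) (X e))"
  unfolding atom_val_def
  by (intro dec_rules dec_stage_val cf_self_app cf_rules assms
      cf_rename[OF assms(1)] cf_rename[OF assms(2)] cf_rename[OF assms(3)])

lemma cf_stage_eval:
  assumes "cf C" "cf U" "cf X"
  shows "cf (\<lambda>e. stage_eval Th (C e) (U e) (X e))"
proof -
  define h where "h x = stage_eval Th (pfst x) (pfst (psnd x)) (psnd (psnd x))" for x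
  define B where "B x \<longleftrightarrow> \<not> (pfst (psnd (psnd x)) = 2 \<or> pfst (psnd (psnd x)) = 3 \<or>
    pfst (psnd (psnd x)) = 4 \<or> pfst (psnd (psnd x)) = 5)" for x
  define A where "A p = (let c = pfst p; u = pfst (psnd p); x = psnd (psnd p) in
     if pfst x = 6 then atom_val Th c u (psnd x)
     else if pfst x = 7 then atom_val Th c u x
     else if x = gn (Eq Zero (Succ Zero)) then 0 else 2)" for p
  define l where "l p = (let x = psnd (psnd p) in
     prod_encode (pfst p, prod_encode (pfst (psnd p), if pfst x = 2 then psnd x else pfst (psnd x))))" for p
  define r where "r p = (let x = psnd (psnd p) in
     prod_encode (pfst p, prod_encode (pfst (psnd p), if pfst x = 2 then psnd x else psnd (psnd x))))" for p
  define K where "K p v w = (let x = psnd (psnd p) in if pfst x = 2 then neg3 v else bin3 (pfst x) v w)" for p v w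
  have "cf (\<lambda>e. h (prod_encode (C e, prod_encode (U e, X e))))"
  proof (rule cf_recursion[where h = h and m = "\<lambda>x. psnd (psnd x)" and B = B and A = A and l = l and r = r and C = K])
    fix x
    show "h x = (if B x then A x else K x (h (l x)) (h (r x)))"
      unfolding h_def by (subst stage_eval.simps) (auto simp: Let_def A_def K_def l_def r_def B_def)
  qed (auto simp: B_def Let_def psnd_less pfst_psnd_less A_def K_def l_def r_def neg3_def bin3_def
      intro!: cf_rules dec_rules assms cf_atom_val)
  then show ?thesis by (simp add: h_def)
qed

lemma dec_bell: "cf C \<Longrightarrow> cf U \<Longrightarrow> dec (\<lambda>e. bell Th (C e) (U e))"
  unfolding bell_def by (intro dec_rules dec_rel[OF Th] cf_stage_eval cf_rules)

lemma dec_first_bell: assumes "cf C" "cf U" shows "dec (\<lambda>e. first_bell Th (C e) (U e))"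
  unfolding first_bell_def
  by (intro dec_rules dec_bell cf_rules assms cf_rename[OF assms(1)] cf_rename[OF assms(2)])

lemma dec_admits: assumes "cf C" "cf W" "cf Y" shows "dec (\<lambda>e. admits Th (C e) (W e) (Y e))"
  unfolding admits_def
  by (intro dec_rules dec_bell dec_mem dec_rel[OF Th] cf_rules assms
     cf_rename[OF assms(1)] cf_rename[OF assms(2)] cf_rename[OF assms(3)])

end

section \<open>Proof witnesses and Rosser formulas\<close>

lemma theorem_witnesses:
  assumes "prim_rec_axiomatized_theory T"
  obtains Th where "dec (\<lambda>e. Th (e 0) (e 1))" "\<And>y. (\<exists>w. Th w y) \<longleftrightarrow> (\<exists>\<phi>. T \<turnstile> \<phi> \<and> y = gn \<phi>)"
proof -
  obtain \<theta> where \<theta>: "Delta0 \<theta>" "\<And>e. (\<exists>\<phi>. T \<turnstile> \<phi> \<and> e 0 = gn \<phi>) \<longleftrightarrow> (\<exists>n. sat (case_nat n e) \<theta>)"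
    using re_theorems[OF assms] unfolding re_def by blast
  have eq: "(\<lambda>i. tval e (case_nat (Var 0) (\<lambda>_. Var 1) i)) = case_nat (e 0) (\<lambda>_. e 1)" for e
    by (auto split: nat.split)
  show ?thesis
  \<comment> \<open>The witness of the \<open>Delta0\<close> matrix plays the part of a proof. All
    variables of \<open>\<theta>\<close> after it may be set to \<open>y\<close>, because the
    enumerated relation looks at \<open>e 0\<close> only.\<close>
  proof (rule that[of "\<lambda>w y. sat (case_nat w (\<lambda>_. y)) \<theta>"])
    show "dec (\<lambda>e. sat (case_nat (e 0) (\<lambda>_. e 1)) \<theta>)"
      using dec_Delta0[OF Delta0_subst[OF \<theta>(1), of "case_nat (Var 0) (\<lambda>_. Var 1)"]]
      by (simp add: sat_subst eq[unfolded One_nat_def])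
    show "(\<exists>w. sat (case_nat w (\<lambda>_. y)) \<theta>) \<longleftrightarrow> (\<exists>\<phi>. T \<turnstile> \<phi> \<and> y = gn \<phi>)" for y
      using \<theta>(2)[of "\<lambda>_. y"] by simp
  qed
qed

text \<open>A witness \<open>s\<close> of \<open>R\<close> counts only if no
  \<open>n \<le> s\<close> witnesses the complement. For a false instance let the numeral
  \<open>v\<close> witness the complement: \<open>PA\<close> compares \<open>s\<close> with
  \<open>v\<close>, refutes the finitely many \<open>s\<close> up to \<open>v\<close> one by one,
  and for the others uses \<open>v\<close> against the bounded clause. So the refutation holds with
  \<open>s\<close> free, and generalizes over all witnesses.\<close>

lemma rosser:
  assumes "dec R"
  obtains \<rho> where "Delta0 \<rho>" "\<And>e. R e \<Longrightarrow> \<exists>s. sat (case_nat s e) \<rho>"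
    "\<And>e s. \<not> R e \<Longrightarrow> \<not> sat (case_nat s e) \<rho>"
    "\<And>e. \<not> R e \<Longrightarrow> PA \<turnstile> Neg (subst (case_nat (Var 0) (num e)) \<rho>)"
proof -
  obtain \<alpha> where \<alpha>: "Delta0 \<alpha>" "\<And>e. R e \<longleftrightarrow> (\<exists>n. sat (case_nat n e) \<alpha>)"
    using assms by (auto simp: dec_def re_def)
  obtain \<beta> where \<beta>: "Delta0 \<beta>" "\<And>e. \<not> R e \<longleftrightarrow> (\<exists>n. sat (case_nat n e) \<beta>)"
    using assms by (auto simp: dec_def re_def)
  let ?\<beta> = "subst (case_nat (Var 0) (\<lambda>i. Var (Suc (Suc i)))) \<beta>"
  let ?F = "Imp (Le (Var 0) (lift_tm (Var 0))) (Neg ?\<beta>)"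
  let ?\<rho> = "Conj \<alpha> (Forall ?F)"
  have sat_\<rho>: "sat (case_nat s e) ?\<rho> \<longleftrightarrow> sat (case_nat s e) \<alpha> \<and> (\<forall>n\<le>s. \<not> sat (case_nat n e) \<beta>)" for s e
    by (simp add: sat_subst case_nat_eta)
  show ?thesis
  proof (rule that[of ?\<rho>])
    show "Delta0 ?\<rho>" by (intro Delta0.intros Delta0_subst \<alpha> \<beta>)
    show "\<exists>s. sat (case_nat s e) ?\<rho>" if "R e" for e
      unfolding sat_\<rho> using that \<alpha>(2) \<beta>(2) by blast
    show "\<not> sat (case_nat s e) ?\<rho>" if "\<not> R e" for e s
      unfolding sat_\<rho> using that \<alpha>(2) by blast
    fix e assume nR: "\<not> R e"
    then obtain v where v: "sat (case_nat v e) \<beta>" using \<beta>(2) by blast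
    let ?s = "case_nat (Var 0) (num e)"
    have pv: "PA \<turnstile> subst (num (case_nat v e)) \<beta>" using Delta0_decided[OF \<beta>(1), of "case_nat v e"] v by simp
    have "PA \<turnstile> Imp (Le (Var 0) (numeral_tm v)) (Neg (subst ?s \<alpha>))"
    proof (rule PA_le_numeral_imp)
      fix i
      have "\<not> sat (case_nat i e) \<alpha>" using nR \<alpha>(2) by blast
      then have "PA \<turnstile> Neg (subst (num (case_nat i e)) \<alpha>)" using Delta0_decided[OF \<alpha>(1), of "case_nat i e"] by simp
      moreover have "(\<lambda>j. subst_tm (Var(0 := numeral_tm i)) (?s j)) = num (case_nat i e)"
        by (auto split: nat.split)
      ultimately have "PA \<turnstile> Neg (subst (Var(0 := numeral_tm i)) (subst ?s \<alpha>))" by (simp add: subst_comp)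
      then show "PA \<turnstile> Imp (Eq (Var 0) (numeral_tm i)) (Neg (subst ?s \<alpha>))"
        by (rule taut2[OF _ eq_replace[of PA 0 "numeral_tm i" "subst ?s \<alpha>"]]) auto
    qed
    moreover have "PA \<turnstile> Imp (Le (numeral_tm v) (Var 0)) (Neg (subst ?s (Forall ?F)))"
    proof -
      have "(\<lambda>j. subst_tm (case_nat (numeral_tm v) ?s) (case_nat (Var 0) (\<lambda>i. Var (Suc (Suc i))) j)) = num (case_nat v e)"
        by (auto split: nat.split)
      then have "PA \<turnstile> Imp (subst ?s (Forall ?F)) (Imp (Le (numeral_tm v) (Var 0)) (Neg (subst (num (case_nat v e)) \<beta>)))"
        using subst_forall_imp[of PA ?s ?F "numeral_tm v"] by (simp add: subst_comp)
      then show ?thesis by (rule taut2[OF pv]) auto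
    qed
    ultimately show "PA \<turnstile> Neg (subst ?s ?\<rho>)"
      by (rule taut3[OF PA_linear[of "Var 0" v]]) auto
  qed
qed

section \<open>The provability predicate\<close>

text \<open>The tail is 0 to match the default \<open>Zero\<close> that \<open>pr_matrix\<close>
  substitutes for all further variables of its parts.\<close>

definition env1 :: "nat \<Rightarrow> nat \<Rightarrow> nat" where
  "env1 c = case_nat c (\<lambda>_. 0)"

definition env2 :: "nat \<Rightarrow> nat \<Rightarrow> nat \<Rightarrow> nat" where
  "env2 c a = case_nat c (env1 a)"

text \<open>The variables are, from index 0 on, \<open>s', s, w, y, c, x\<close>.\<close>

definition pr_matrix :: "fm \<Rightarrow> fm \<Rightarrow> fm \<Rightarrow> fm" where
  "pr_matrix \<delta> \<alpha> \<tau> = Conj (Le (Var 3) (Var 5))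
    (Conj (subst (case_nat (Var 1) (case_nat (Var 3) (case_nat (Var 4) (case_nat (Var 5) (\<lambda>_. Zero))))) \<delta>)
    (Conj (subst (case_nat (Var 0) (case_nat (Var 2) (case_nat (Var 3) (case_nat (Var 4) (\<lambda>_. Zero))))) \<alpha>)
      (Forall (Imp (Le (Var 0) (lift_tm (Var 2)))
        (Neg (subst (case_nat (Var 0) (case_nat (Var 5) (\<lambda>_. Zero))) \<tau>))))))"

definition pr_formula :: "fm \<Rightarrow> fm \<Rightarrow> fm \<Rightarrow> fm" where
  "pr_formula \<delta> \<alpha> \<tau> = Exists (Exists (Exists (Exists (pr_matrix \<delta> \<alpha> \<tau>))))"

text \<open>\<open>\<delta>\<close>, \<open>\<alpha>\<close> and \<open>\<tau>\<close> will express
  \<open>descends\<close>, \<open>admits\<close> and the stop condition. The remaining arguments are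
  terms, because \<open>PA\<close> handles them first as variables and then as numerals.\<close>

definition delta_at :: "fm \<Rightarrow> nat \<Rightarrow> nat \<Rightarrow> tm \<Rightarrow> tm \<Rightarrow> fm" where
  "delta_at \<delta> c a s y = subst (case_nat s (case_nat y (num (env2 c a)))) \<delta>"

definition alpha_at :: "fm \<Rightarrow> nat \<Rightarrow> tm \<Rightarrow> tm \<Rightarrow> tm \<Rightarrow> fm" where
  "alpha_at \<alpha> c s w y = subst (case_nat s (case_nat w (case_nat y (num (env1 c))))) \<alpha>"

definition tau_at :: "fm \<Rightarrow> nat \<Rightarrow> tm \<Rightarrow> fm" where
  "tau_at \<tau> c t = subst (case_nat t (num (env1 c))) \<tau>"

definition pr_matrix_at :: "fm \<Rightarrow> fm \<Rightarrow> fm \<Rightarrow> nat \<Rightarrow> nat \<Rightarrow> tm \<Rightarrow> tm \<Rightarrow> tm \<Rightarrow> tm \<Rightarrow> fm" where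
  "pr_matrix_at \<delta> \<alpha> \<tau> c a s' s w y = Conj (Le y (numeral_tm a)) (Conj (delta_at \<delta> c a s y)
    (Conj (alpha_at \<alpha> c s' w y) (Forall (Imp (Le (Var 0) (lift_tm w)) (Neg (tau_at \<tau> c (Var 0)))))))"

lemma Sigma1_pr_formula: "Delta0 \<delta> \<Longrightarrow> Delta0 \<alpha> \<Longrightarrow> Delta0 \<tau> \<Longrightarrow> Sigma1 (pr_formula \<delta> \<alpha> \<tau>)"
  unfolding pr_formula_def pr_matrix_def
  by (intro Sigma1.intros Delta0.intros Delta0_subst)

lemma fv_pr_formula: "fv (pr_formula \<delta> \<alpha> \<tau>) \<subseteq> {0, 1}"
proof -
  have "fv (pr_matrix \<delta> \<alpha> \<tau>) \<subseteq> {0, 1, 2, 3, 4, 5}"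
    by (auto simp: pr_matrix_def fv_subst split: nat.splits) (metis gr0_conv_Suc not0_implies_Suc)
  then have "n \<in> fv (pr_formula \<delta> \<alpha> \<tau>) \<Longrightarrow> Suc (Suc (Suc (Suc n))) \<in> {0, 1, 2, 3, 4, 5}" for n
    by (auto simp: pr_formula_def)
  then show ?thesis by force
qed

section \<open>Instances of the predicate formula and their truth\<close>

lemma subst_pr_matrix:
  "subst (case_nat s' (case_nat s (case_nat w (case_nat y (num (env2 c a)))))) (pr_matrix \<delta> \<alpha> \<tau>)
    = pr_matrix_at \<delta> \<alpha> \<tau> c a s' s w y" (is "subst ?\<sigma> _ = _")
proof -
  have d: "(\<lambda>i. subst_tm ?\<sigma> (case_nat (Var 1) (case_nat (Var 3) (case_nat (Var 4) (case_nat (Var 5) (\<lambda>_. Zero)))) i))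
      = case_nat s (case_nat y (num (env2 c a)))"
    by (auto simp: env2_def env1_def eval_nat_numeral split: nat.split)
  have a: "(\<lambda>i. subst_tm ?\<sigma> (case_nat (Var 0) (case_nat (Var 2) (case_nat (Var 3) (case_nat (Var 4) (\<lambda>_. Zero)))) i))
      = case_nat s' (case_nat w (case_nat y (num (env1 c))))"
    by (auto simp: env2_def env1_def eval_nat_numeral split: nat.split)
  have t: "(\<lambda>i. subst_tm (up ?\<sigma>) (case_nat (Var 0) (case_nat (Var 5) (\<lambda>_. Zero)) i)) = case_nat (Var 0) (num (env1 c))"
    by (auto simp: env2_def env1_def eval_nat_numeral split: nat.split)
  have v: "?\<sigma> 3 = y" "?\<sigma> 5 = numeral_tm a" "?\<sigma> 2 = w"
    by (auto simp: env2_def env1_def eval_nat_numeral)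
  have l: "subst_tm (up ?\<sigma>) (lift_tm (Var 2)) = lift_tm w"
    unfolding subst_tm_up_lift by (simp add: v)
  show ?thesis
    unfolding pr_matrix_def pr_matrix_at_def delta_at_def alpha_at_def tau_at_def
    by (simp only: subst.simps subst_comp d a t l subst_tm.simps v up_simps)
qed

lemma inst_pr_formula:
  "inst (inst (pr_formula \<delta> \<alpha> \<tau>) (numeral_tm c)) (numeral_tm a) = subst (num (env2 c a)) (pr_formula \<delta> \<alpha> \<tau>)"
  unfolding inst_def subst_comp
proof (rule subst_cong)
  fix i assume "i \<in> fv (pr_formula \<delta> \<alpha> \<tau>)"
  then have "i = 0 \<or> i = 1" using fv_pr_formula by blast
  then show "subst_tm (case_nat (numeral_tm a) Var) (case_nat (numeral_tm c) Var i) = num (env2 c a) i"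
    by (auto simp: env2_def env1_def)
qed

lemma up4: "up (up (up (up (num e)))) = case_nat (Var 0) (case_nat (Var 1) (case_nat (Var 2) (case_nat (Var 3) (num e))))"
  by (auto simp: up_def eval_nat_numeral split: nat.split)

lemma subst_pr_formula: "subst (num (env2 c a)) (pr_formula \<delta> \<alpha> \<tau>)
    = Exists (Exists (Exists (Exists (pr_matrix_at \<delta> \<alpha> \<tau> c a (Var 0) (Var 1) (Var 2) (Var 3)))))"
  unfolding pr_formula_def subst.simps up4 subst_pr_matrix ..

lemma sat_pr_formula:
  "sat e (subst (num (env2 c a)) (pr_formula \<delta> \<alpha> \<tau>)) \<longleftrightarrow>
    (\<exists>y\<le>a. (\<exists>s. sat (case_nat s (case_nat y (env2 c a))) \<delta>) \<and>
      (\<exists>w. (\<exists>s. sat (case_nat s (case_nat w (case_nat y (env1 c)))) \<alpha>) \<and>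
        (\<forall>t\<le>w. \<not> sat (case_nat t (env1 c)) \<tau>)))"
proof -
  have d: "(\<lambda>i. tval (case_nat s' (case_nat s (case_nat w (case_nat y e))))
        (case_nat (Var 1) (case_nat (Var 3) (num (env2 c a))) i)) = case_nat s (case_nat y (env2 c a))" for s' s w y
    by (auto simp: eval_nat_numeral split: nat.split)
  have a: "(\<lambda>i. tval (case_nat s' (case_nat s (case_nat w (case_nat y e))))
        (case_nat (Var 0) (case_nat (Var 2) (case_nat (Var 3) (num (env1 c)))) i))
      = case_nat s' (case_nat w (case_nat y (env1 c)))" for s' s w y
    by (auto simp: eval_nat_numeral split: nat.split)
  have t: "(\<lambda>i. tval (case_nat t e) (case_nat (Var 0) (num (env1 c)) i)) = case_nat t (env1 c)" for t e
    by (auto split: nat.split)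
  have "sat (case_nat s' (case_nat s (case_nat w (case_nat y e)))) (pr_matrix_at \<delta> \<alpha> \<tau> c a (Var 0) (Var 1) (Var 2) (Var 3))
    \<longleftrightarrow> y \<le> a \<and> sat (case_nat s (case_nat y (env2 c a))) \<delta> \<and>
      sat (case_nat s' (case_nat w (case_nat y (env1 c)))) \<alpha> \<and> (\<forall>t\<le>w. \<not> sat (case_nat t (env1 c)) \<tau>)" for s' s w y
    unfolding pr_matrix_at_def delta_at_def alpha_at_def tau_at_def sat.simps sat_subst d a t tval.simps tval_lift
    by (simp add: eval_nat_numeral)
  then show ?thesis unfolding subst_pr_formula sat.simps by blast
qed

lemma sentence_subst_num: "sentence (subst (num e) \<phi>)"
  by (simp add: sentence_def fv_subst)

lemma pr_matrix_imp: "PA \<turnstile> Imp (pr_matrix_at \<delta> \<alpha> \<tau> c a s' s w y) (subst (num (env2 c a)) (pr_formula \<delta> \<alpha> \<tau>))"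
proof -
  let ?M = "pr_matrix \<delta> \<alpha> \<tau>" and ?s = "num (env2 c a)"
  have 1: "PA \<turnstile> Imp (pr_matrix_at \<delta> \<alpha> \<tau> c a s' s w y) (subst (case_nat s (case_nat w (case_nat y ?s))) (Exists ?M))"
    using imp_subst_exists[of PA s' "case_nat s (case_nat w (case_nat y ?s))" ?M] unfolding subst_pr_matrix .
  show ?thesis unfolding pr_formula_def
    by (rule taut4[OF 1 imp_subst_exists[of PA s "case_nat w (case_nat y ?s)" "Exists ?M"]
          imp_subst_exists[of PA w "case_nat y ?s" "Exists (Exists ?M)"]
          imp_subst_exists[of PA y ?s "Exists (Exists (Exists ?M))"]])
      (simp only: ev.simps(6), blast)
qed

lemma pr_formula_imp:
  assumes "PA \<turnstile> Imp (pr_matrix_at \<delta> \<alpha> \<tau> c a (Var 0) (Var 1) (Var 2) (Var 3)) \<psi>" and "sentence \<psi>"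
  shows "PA \<turnstile> Imp (subst (num (env2 c a)) (pr_formula \<delta> \<alpha> \<tau>)) \<psi>"
proof -
  have "lift \<psi> = \<psi>" using assms(2) by (simp add: lift_def subst_sentence)
  then show ?thesis unfolding subst_pr_formula
    using assms(1) by (metis exists_imp)
qed

section \<open>What PA proves about the predicate\<close>

lemma delta_at_replace: "PA \<turnstile> Imp (Eq (Var 3) (numeral_tm i))
    (Imp (delta_at \<delta> c a (Var 1) (Var 3)) (delta_at \<delta> c a (Var 1) (numeral_tm i)))"
proof -
  have "(\<lambda>j. subst_tm (Var(3 := numeral_tm i)) (case_nat (Var 1) (case_nat (Var 3) (num (env2 c a))) j))
      = case_nat (Var 1) (case_nat (numeral_tm i) (num (env2 c a)))"
    by (auto split: nat.split)
  then show ?thesis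
    using eq_replace[of PA 3 "numeral_tm i" "delta_at \<delta> c a (Var 1) (Var 3)"]
    unfolding delta_at_def subst_comp by simp
qed

lemma alpha_at_replace_y: "PA \<turnstile> Imp (Eq (Var 3) (numeral_tm i))
    (Imp (alpha_at \<alpha> c (Var 0) (Var 2) (Var 3)) (alpha_at \<alpha> c (Var 0) (Var 2) (numeral_tm i)))"
proof -
  have "(\<lambda>j. subst_tm (Var(3 := numeral_tm i)) (case_nat (Var 0) (case_nat (Var 2) (case_nat (Var 3) (num (env1 c)))) j))
      = case_nat (Var 0) (case_nat (Var 2) (case_nat (numeral_tm i) (num (env1 c))))"
    by (auto split: nat.split)
  then show ?thesis
    using eq_replace[of PA 3 "numeral_tm i" "alpha_at \<alpha> c (Var 0) (Var 2) (Var 3)"]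
    unfolding alpha_at_def subst_comp by simp
qed

lemma alpha_at_replace_w: "PA \<turnstile> Imp (Eq (Var 2) (numeral_tm j))
    (Imp (alpha_at \<alpha> c (Var 0) (Var 2) (numeral_tm i)) (alpha_at \<alpha> c (Var 0) (numeral_tm j) (numeral_tm i)))"
proof -
  have "(\<lambda>k. subst_tm (Var(2 := numeral_tm j)) (case_nat (Var 0) (case_nat (Var 2) (case_nat (numeral_tm i) (num (env1 c)))) k))
      = case_nat (Var 0) (case_nat (numeral_tm j) (case_nat (numeral_tm i) (num (env1 c))))"
    by (auto split: nat.split)
  then show ?thesis
    using eq_replace[of PA 2 "numeral_tm j" "alpha_at \<alpha> c (Var 0) (Var 2) (numeral_tm i)"]
    unfolding alpha_at_def subst_comp by simp
qed

lemma delta_at_refuted: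
  assumes "PA \<turnstile> Neg (subst (case_nat (Var 0) (num (case_nat i (env2 c a)))) \<delta>)"
  shows "PA \<turnstile> Imp (Eq (Var 3) (numeral_tm i)) (Neg (delta_at \<delta> c a (Var 1) (Var 3)))"
proof -
  have "(\<lambda>j. subst_tm (\<lambda>_. Var 1) (case_nat (Var 0) (num (case_nat i (env2 c a))) j))
      = case_nat (Var 1) (case_nat (numeral_tm i) (num (env2 c a)))"
    by (auto split: nat.split)
  then have "PA \<turnstile> Neg (delta_at \<delta> c a (Var 1) (numeral_tm i))"
    using PA_subst[OF assms, of "\<lambda>_. Var 1"] by (simp add: subst_comp delta_at_def)
  then show ?thesis by (rule taut2[OF _ delta_at_replace]) auto
qed

text \<open>\<open>PA\<close> distinguishes the finitely many \<open>y \<le> a\<close>. Those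
  unrelated to \<open>a\<close> are refuted by the Rosser property; for the others the relation to
  \<open>b\<close> is true and has a numeral witness that \<open>PA\<close> verifies. The clauses on
  admission and stopping are passed on unchanged with \<open>w\<close> still a variable, so
  \<open>PA\<close> has to know nothing about them.\<close>

lemma pr_mono:
  assumes \<delta>: "Delta0 \<delta>"
    and pos: "\<And>y x. RD y c x \<Longrightarrow> \<exists>s. sat (case_nat s (case_nat y (env2 c x))) \<delta>"
    and neg: "\<And>y x. \<not> RD y c x \<Longrightarrow> PA \<turnstile> Neg (subst (case_nat (Var 0) (num (case_nat y (env2 c x)))) \<delta>)"
    and ab: "\<And>y. y \<le> a \<Longrightarrow> RD y c a \<Longrightarrow> y \<le> b \<and> RD y c b"
  shows "PA \<turnstile> Imp (subst (num (env2 c a)) (pr_formula \<delta> \<alpha> \<tau>)) (subst (num (env2 c b)) (pr_formula \<delta> \<alpha> \<tau>))"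
proof (rule pr_formula_imp[OF _ sentence_subst_num])
  let ?M = "pr_matrix_at \<delta> \<alpha> \<tau> c a (Var 0) (Var 1) (Var 2) (Var 3)"
  let ?G = "subst (num (env2 c b)) (pr_formula \<delta> \<alpha> \<tau>)"
  have "PA \<turnstile> Imp (Le (Var 3) (numeral_tm a)) (Imp ?M ?G)"
  proof (rule PA_le_numeral_imp)
    fix i assume i: "i \<le> a"
    show "PA \<turnstile> Imp (Eq (Var 3) (numeral_tm i)) (Imp ?M ?G)"
    proof (cases "RD i c a")
      case False
      show ?thesis
        by (rule taut1[OF delta_at_refuted[OF neg[OF False]]]) (auto simp: pr_matrix_at_def)
    next
      case True
      with ab i have b: "i \<le> b" "RD i c b" by auto
      obtain s where "sat (case_nat s (case_nat i (env2 c b))) \<delta>" using pos[OF b(2)] by blast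
      then have d: "PA \<turnstile> delta_at \<delta> c b (numeral_tm s) (numeral_tm i)"
        using Delta0_decided[OF \<delta>, of "case_nat s (case_nat i (env2 c b))"] by (simp add: delta_at_def case_num)
      show ?thesis
        by (rule taut4[OF d PA_numeral_le[OF b(1)] alpha_at_replace_y[of i \<alpha> c]
              pr_matrix_imp[of \<delta> \<alpha> \<tau> c b "Var 0" "numeral_tm s" "Var 2" "numeral_tm i"]])
          (auto simp: pr_matrix_at_def)
    qed
  qed
  then show "PA \<turnstile> Imp ?M ?G" by (rule taut1) (auto simp: pr_matrix_at_def)
qed

text \<open>\<open>PA\<close> proves that \<open>t\<close> is a stop, so every \<open>w\<close> from
  \<open>t\<close> on violates the last clause of the matrix. This leaves finitely many pairs of
  \<open>y \<le> a\<close> and \<open>w \<le> t\<close>, refuted one by one.\<close>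

lemma pr_refute:
  assumes neg: "\<And>y x. \<not> RD y c x \<Longrightarrow> PA \<turnstile> Neg (subst (case_nat (Var 0) (num (case_nat y (env2 c x)))) \<delta>)"
    and nega: "\<And>w y. \<not> RA w y c \<Longrightarrow> PA \<turnstile> Neg (subst (case_nat (Var 0) (num (case_nat w (case_nat y (env1 c))))) \<alpha>)"
    and \<tau>: "Delta0 \<tau>" "sat (case_nat t (env1 c)) \<tau>"
    and no: "\<And>y w. y \<le> a \<Longrightarrow> RD y c a \<Longrightarrow> w \<le> t \<Longrightarrow> \<not> RA w y c"
  shows "PA \<turnstile> Neg (subst (num (env2 c a)) (pr_formula \<delta> \<alpha> \<tau>))"
proof -
  let ?M = "pr_matrix_at \<delta> \<alpha> \<tau> c a (Var 0) (Var 1) (Var 2) (Var 3)"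
  let ?N = "Forall (Imp (Le (Var 0) (lift_tm (Var 2))) (Neg (tau_at \<tau> c (Var 0))))"
  have pt: "PA \<turnstile> tau_at \<tau> c (numeral_tm t)"
    using Delta0_decided[OF \<tau>(1), of "case_nat t (env1 c)"] \<tau>(2) by (simp add: tau_at_def case_num)
  have "(\<lambda>i. subst_tm (case_nat (numeral_tm t) Var) (case_nat (Var 0) (num (env1 c)) i)) = case_nat (numeral_tm t) (num (env1 c))"
    by (auto split: nat.split)
  then have "PA \<turnstile> Imp ?N (Imp (Le (numeral_tm t) (Var 2)) (Neg (tau_at \<tau> c (numeral_tm t))))"
    using proves.logical[OF forall_elim[of "Imp (Le (Var 0) (lift_tm (Var 2))) (Neg (tau_at \<tau> c (Var 0)))" "numeral_tm t"], of PA]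
    by (simp add: inst_def tau_at_def subst_comp)
  then have late: "PA \<turnstile> Imp (Le (numeral_tm t) (Var 2)) (Neg ?N)"
    by (rule taut2[OF pt]) auto
  have "PA \<turnstile> Imp (Le (Var 3) (numeral_tm a)) (Neg ?M)"
  proof (rule PA_le_numeral_imp)
    fix i assume i: "i \<le> a"
    show "PA \<turnstile> Imp (Eq (Var 3) (numeral_tm i)) (Neg ?M)"
    proof (cases "RD i c a")
      case False
      show ?thesis
        by (rule taut1[OF delta_at_refuted[OF neg[OF False]]]) (auto simp: pr_matrix_at_def)
    next
      case True
      have "PA \<turnstile> Imp (Le (Var 2) (numeral_tm t)) (Neg (alpha_at \<alpha> c (Var 0) (Var 2) (numeral_tm i)))"
      proof (rule PA_le_numeral_imp)
        fix j assume "j \<le> t"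
        then have "PA \<turnstile> Neg (alpha_at \<alpha> c (Var 0) (numeral_tm j) (numeral_tm i))"
          using nega[OF no[OF i True]] by (simp add: alpha_at_def case_num)
        then show "PA \<turnstile> Imp (Eq (Var 2) (numeral_tm j)) (Neg (alpha_at \<alpha> c (Var 0) (Var 2) (numeral_tm i)))"
          by (rule taut2[OF _ alpha_at_replace_w]) auto
      qed
      then show ?thesis
        by (rule taut4[OF _ late PA_linear[of "Var 2" t] alpha_at_replace_y[of i \<alpha> c]]) (auto simp: pr_matrix_at_def)
    qed
  qed
  then have "PA \<turnstile> Imp ?M (Neg (Eq Zero Zero))" by (rule taut1) (auto simp: pr_matrix_at_def)
  then have "PA \<turnstile> Imp (subst (num (env2 c a)) (pr_formula \<delta> \<alpha> \<tau>)) (Neg (Eq Zero Zero))"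
    by (rule pr_formula_imp) (simp add: sentence_def)
  then show ?thesis by (rule taut2[OF eq_refl'[of PA Zero]]) auto
qed

lemma le_gn_numeral: "n \<le> gn_tm (numeral_tm n)"
proof (induction n)
  case (Suc n)
  have "gn_tm (numeral_tm n) < gn_tm (numeral_tm (Suc n))"
    using psnd_less[of "prod_encode (2, gn_tm (numeral_tm n))"] by simp
  then show ?case using Suc by simp
qed simp

text \<open>The numeral of \<open>a\<close> occurs in the first conjunct of the matrix, and codes
  grow with their parts. This is the growth that makes the bounds in \<open>descends\<close> and
  \<open>atom_val\<close> harmless.\<close>

lemma less_gn_pr_formula: "a < gn (subst (num (env2 c a)) (pr_formula \<delta> \<alpha> \<tau>))"
proof -
  have e: "gn \<phi> < gn (Exists \<phi>)" for \<phi> using psnd_less[of "prod_encode (7, gn \<phi>)"] by simp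
  have k: "gn \<phi> < gn (Conj \<phi> \<psi>)" for \<phi> \<psi>
    using pfst_psnd_less(1)[of "prod_encode (3, prod_encode (gn \<phi>, gn \<psi>))"] by simp
  have l: "gn_tm t < gn (Le s t)" for s t
    using pfst_psnd_less(2)[of "prod_encode (1, prod_encode (gn_tm s, gn_tm t))"] by simp
  show ?thesis
    unfolding subst_pr_formula pr_matrix_at_def
    using le_gn_numeral l k e by (meson le_less_trans less_trans)
qed

text \<open>\<open>t\<close> bounds both \<open>u\<close> and its witness, which keeps the condition
  \<open>Delta0\<close>. The strict bound on \<open>u\<close> leaves the stages up to and including
  the first bell untouched by the stop.\<close>

lemma stop_formula:
  assumes "re (\<lambda>e. RL (e 0) (e 1))"
  obtains \<tau> where "Delta0 \<tau>"
    "\<And>c. (\<exists>t. sat (case_nat t (env1 c)) \<tau>) \<longleftrightarrow> (\<exists>u. RL u c)"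
    "\<And>t c. sat (case_nat t (env1 c)) \<tau> \<Longrightarrow> \<exists>u<t. RL u c"
proof -
  obtain \<xi> where l: "Delta0 \<xi>" "\<And>e. RL (e 0) (e 1) \<longleftrightarrow> (\<exists>n. sat (case_nat n e) \<xi>)"
    using assms unfolding re_def by blast
  let ?\<tau> = "Exists (Conj (Le (Var 0) (lift_tm (Var 0))) (Exists (Conj (Le (Var 0) (lift_tm (Var 1)))
    (Conj (Le (Succ (Var 1)) (Var 2))
      (subst (case_nat (Var 0) (case_nat (Var 1) (\<lambda>i. Var (Suc (Suc (Suc i)))))) \<xi>)))))"
  have eq: "(\<lambda>i. tval (case_nat s (case_nat u (case_nat t e))) (case_nat (Var 0) (case_nat (Var 1) (\<lambda>i. Var (Suc (Suc (Suc i))))) i))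
      = case_nat s (case_nat u e)" for s u t e
    by (auto split: nat.split)
  have s: "sat (case_nat t e) ?\<tau> \<longleftrightarrow> (\<exists>u<t. \<exists>s\<le>t. sat (case_nat s (case_nat u e)) \<xi>)" for t e
    unfolding sat.simps sat_subst eq by (auto simp: eval_nat_numeral Suc_le_eq) (meson less_imp_le)
  have r: "RL u c \<longleftrightarrow> (\<exists>n. sat (case_nat n (case_nat u (env1 c))) \<xi>)" for u c
    using l(2)[of "case_nat u (env1 c)"] by (simp add: env1_def)
  show ?thesis
  proof (rule that[of ?\<tau>])
    show "Delta0 ?\<tau>" by (intro Delta0.intros Delta0_subst l)
    show 1: "\<exists>u<t. RL u c" if "sat (case_nat t (env1 c)) ?\<tau>" for t c
      using that unfolding s r by blast
    show "(\<exists>t. sat (case_nat t (env1 c)) ?\<tau>) \<longleftrightarrow> (\<exists>u. RL u c)" for c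
    proof
      assume "\<exists>u. RL u c"
      then obtain u n where "sat (case_nat n (case_nat u (env1 c))) \<xi>" unfolding r by blast
      \<comment> \<open>\<open>Suc (u + n)\<close> lies strictly above \<open>u\<close> and bounds
        the witness \<open>n\<close>.\<close>
      then have "sat (case_nat (Suc (u + n)) (env1 c)) ?\<tau>" unfolding s
        by (intro exI[of _ u] exI[of _ n] conjI) auto
      then show "\<exists>t. sat (case_nat t (env1 c)) ?\<tau>" by blast
    qed (use 1 in blast)
  qed
qed

section \<open>Valuations refuting non-theorems of N4\<close>

primrec subs :: "mfm \<Rightarrow> mfm set" where
  "subs (MVar n) = {MVar n}"
| "subs MBot = {MBot}"
| "subs (MNeg A) = insert (MNeg A) (subs A)"
| "subs (MConj A B) = insert (MConj A B) (subs A \<union> subs B)"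
| "subs (MDisj A B) = insert (MDisj A B) (subs A \<union> subs B)"
| "subs (MImp A B) = insert (MImp A B) (subs A \<union> subs B)"
| "subs (Box A) = insert (Box A) (subs A)"

lemma finite_subs: "finite (subs A)"
  by (induction A) auto

lemma size_subs: "B \<in> subs A \<Longrightarrow> size B \<le> size A"
  by (induction A) auto

lemma size_Box_pow: "size A \<le> size ((Box ^^ i) A)"
  by (induction i) auto

lemma N4_mp: "N4 (MImp A B) \<Longrightarrow> N4 A \<Longrightarrow> N4 B"
  unfolding N4_def by (rule N_plus.mp)

lemma N4_taut: "tautology A \<Longrightarrow> N4 A"
  unfolding N4_def by (rule N_plus.taut)

lemma N4_nec: "N4 A \<Longrightarrow> N4 (Box A)"
  unfolding N4_def by (rule N_plus.nec)

lemma N4_four: "N4 (MImp (Box A) (Box (Box A)))"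
  unfolding N4_def by (rule N_plus.extra) blast

lemma N4_Box_pow: "N4 A \<Longrightarrow> N4 ((Box ^^ i) A)"
  by (induction i) (auto intro: N4_nec)

text \<open>The theorems are discharged one at a time as antecedents until a tautology is
  left.\<close>

lemma N4_finite_consequence:
  assumes "finite \<Delta>" "\<And>D. D \<in> \<Delta> \<Longrightarrow> N4 D" "\<And>v. (\<forall>D\<in>\<Delta>. bool_eval v D) \<Longrightarrow> bool_eval v A"
  shows "N4 A"
  using assms
proof (induction \<Delta> arbitrary: A rule: finite_induct)
  case empty
  then show ?case by (auto intro: N4_taut simp: tautology_def)
next
  case (insert D \<Delta>)
  have "N4 (MImp D A)"
  proof (rule insert.IH)
    show "bool_eval v (MImp D A)" if "\<forall>D\<in>\<Delta>. bool_eval v D" for v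
      using insert.prems(2)[of v] that by auto
  qed (use insert.prems in auto)
  then show ?case by (rule N4_mp) (use insert.prems in auto)
qed

lemma N4_four_pow: "N4 (MImp (Box A) (Box ((Box ^^ i) A)))"
proof (induction i)
  case 0
  then show ?case by (auto intro: N4_taut simp: tautology_def)
next
  case (Suc i)
  show ?case
    by (rule N4_finite_consequence[of "{MImp (Box A) (Box ((Box ^^ i) A)), MImp (Box ((Box ^^ i) A)) (Box (Box ((Box ^^ i) A)))}"])
      (use Suc N4_four in auto)
qed

text \<open>Necessitated theorems and iterated instances of the axiom 4 among the subformulas of
  \<open>A\<close> are finitely many theorems of \<open>N4\<close>. If every Boolean valuation
  satisfying them satisfied \<open>A\<close>, then \<open>A\<close> would be a theorem.\<close>

lemma N4_valuation:
  assumes "\<not> N4 A"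
  obtains v where "\<not> bool_eval v A" "\<And>C. Box C \<in> subs A \<Longrightarrow> N4 C \<Longrightarrow> v (Box C)"
    "\<And>C i. Box C \<in> subs A \<Longrightarrow> Box ((Box ^^ i) C) \<in> subs A \<Longrightarrow> v (Box C) \<Longrightarrow> v (Box ((Box ^^ i) C))"
proof -
  let ?\<Delta>1 = "{Box C | C. Box C \<in> subs A \<and> N4 C}"
  let ?\<Delta>2 = "{MImp (Box C) (Box ((Box ^^ i) C)) | C i. Box C \<in> subs A \<and> Box ((Box ^^ i) C) \<in> subs A}"
  have "finite (?\<Delta>1 \<union> ?\<Delta>2)"
  proof (rule finite_UnI)
    show "finite ?\<Delta>1" by (rule finite_subset[OF _ finite_subs[of A]]) auto
    show "finite ?\<Delta>2"
      by (rule finite_subset[of _ "(\<lambda>(X, Y). MImp X Y) ` (subs A \<times> subs A)"]) (auto simp: finite_subs)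
  qed
  moreover have "N4 D" if "D \<in> ?\<Delta>1 \<union> ?\<Delta>2" for D using that by (auto intro: N4_nec N4_four_pow)
  ultimately obtain v where v: "\<forall>D\<in>?\<Delta>1 \<union> ?\<Delta>2. bool_eval v D" "\<not> bool_eval v A"
    using N4_finite_consequence[of "?\<Delta>1 \<union> ?\<Delta>2" A] assms by blast
  show ?thesis
  proof (rule that[OF v(2)])
    show "v (Box C)" if "Box C \<in> subs A" "N4 C" for C
    proof -
      have "bool_eval v (Box C)" using v(1) that by blast
      then show ?thesis by simp
    qed
    show "v (Box ((Box ^^ i) C))" if "Box C \<in> subs A" "Box ((Box ^^ i) C) \<in> subs A" "v (Box C)" for C i
    proof -
      have "bool_eval v (MImp (Box C) (Box ((Box ^^ i) C)))" using v(1) that by blast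
      then show ?thesis using that(3) by simp
    qed
  qed
qed

section \<open>The interpretation\<close>

text \<open>No formula has a code of the form \<open>prod_encode (8, n)\<close>, so the predicate can be used at these
  numbers to interpret the propositional variables. The vacuous quantifier keeps them apart from boxes.\<close>

primrec interp :: "fm \<Rightarrow> mfm \<Rightarrow> fm" where
  "interp P (MVar n) = Forall (inst P (numeral_tm (prod_encode (8, n))))"
| "interp P MBot = Eq Zero (Succ Zero)"
| "interp P (MNeg A) = Neg (interp P A)"
| "interp P (MConj A B) = Conj (interp P A) (interp P B)"
| "interp P (MDisj A B) = Disj (interp P A) (interp P B)"
| "interp P (MImp A B) = Imp (interp P A) (interp P B)"
| "interp P (Box A) = apply_code P (interp P A)"

lemma gn_neq_8: "gn \<phi> \<noteq> prod_encode (8, n)"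
  by (cases \<phi>) auto

lemma stage_eval_values: "stage_eval Th c u x = 0 \<or> stage_eval Th c u x = 1 \<or> stage_eval Th c u x = 2"
proof -
  have "stage_eval Th c u x \<in> {0, 1, 2}"
    by (subst stage_eval.simps) (auto simp: neg3_def bin3_def atom_val_def)
  then show ?thesis by auto
qed

text \<open>The interface between syntax and argument: the rest of the proof knows the predicate
  only through these properties, and \<open>stop\<close> stands for the truth of the stop
  formula.\<close>

locale numeration =
  fixes T :: "fm set" and P :: fm and Th :: "nat \<Rightarrow> nat \<Rightarrow> bool" and c :: nat and stop :: "nat \<Rightarrow> bool"
  assumes consistent: "consistent T" and contains: "contains_theory T PA"
    and Th_iff: "(\<exists>w. Th w y) \<longleftrightarrow> (\<exists>\<phi>. T \<turnstile> \<phi> \<and> y = gn \<phi>)"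
    and fv_P: "fv P \<subseteq> {0}"
    and code: "self_app c a = gn (inst P (numeral_tm a))"
    and less_code: "a < self_app c a"
    and inst_P_Exists: "\<exists>\<chi>. inst P (numeral_tm a) = Exists \<chi>"
    and inst_P_inject: "inst P (numeral_tm a) = inst P (numeral_tm b) \<Longrightarrow> a = b"
    and truth: "sat e (inst P (numeral_tm a)) \<longleftrightarrow>
      (\<exists>y\<le>a. descends c a y \<and> (\<exists>w. admits Th c w y \<and> (\<forall>t\<le>w. \<not> stop t)))"
    and complete: "sat e (inst P (numeral_tm a)) \<Longrightarrow> PA \<turnstile> inst P (numeral_tm a)"
    and mono: "(\<And>y. y \<le> a \<Longrightarrow> descends c a y \<Longrightarrow> y \<le> b \<and> descends c b y) \<Longrightarrow>
      PA \<turnstile> Imp (inst P (numeral_tm a)) (inst P (numeral_tm b))"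
    and refutes: "stop t \<Longrightarrow> (\<And>y w. y \<le> a \<Longrightarrow> descends c a y \<Longrightarrow> w \<le> t \<Longrightarrow> \<not> admits Th c w y) \<Longrightarrow>
      PA \<turnstile> Neg (inst P (numeral_tm a))"
    and stop_iff: "(\<exists>t. stop t) \<longleftrightarrow> (\<exists>u. first_bell Th c u)"
    and stop_after: "stop t \<Longrightarrow> \<exists>u<t. first_bell Th c u"
begin

section \<open>Descent along the iteration\<close>

lemma T_PA: "PA \<turnstile> \<phi> \<Longrightarrow> T \<turnstile> \<phi>"
  using contains by (simp add: contains_theory_def)

lemma iter_app_ge: "y + i \<le> iter_app c i y"
proof (induction i)
  case (Suc i) then show ?case using less_code[of "iter_app c i y"] by simp
qed simp

lemma descends_iff: "descends c x y \<longleftrightarrow> (\<exists>i. iter_app c i y = x)"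
  unfolding descends_def using iter_app_ge[of y] by (metis add_leD2)

lemma descends_le: "descends c x y \<Longrightarrow> y \<le> x"
  unfolding descends_iff using iter_app_ge[of y] by (metis add_leD1)

lemma descends_refl: "descends c x x"
  unfolding descends_iff by (rule exI[of _ 0]) simp

lemma descends_step: "descends c x y \<Longrightarrow> descends c (self_app c x) y"
  unfolding descends_iff by (metis iter_app_simps(2))

lemma sentence_inst_P: "sentence (inst P (numeral_tm a))"
proof -
  have "fv (inst P (numeral_tm a)) = (\<Union>i\<in>fv P. fv_tm (case_nat (numeral_tm a) Var i))"
    by (simp add: inst_def fv_subst)
  then show ?thesis using fv_P by (auto simp: sentence_def)
qed

text \<open>The code of the instance at \<open>a\<close> descends from everything that
  \<open>a\<close> descends from, so monotonicity applies.\<close>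

lemma four: "PA \<turnstile> Imp (inst P (numeral_tm a)) (inst P (numeral_tm (self_app c a)))"
  using descends_step descends_le by (intro mono) (meson)

section \<open>The first bell\<close>

lemma first_bell_unique: "first_bell Th c u \<Longrightarrow> first_bell Th c u' \<Longrightarrow> u = u'"
  unfolding first_bell_def by (metis nat_neq_iff)

lemma admits_le: "first_bell Th c u \<Longrightarrow> admits Th c w y \<Longrightarrow> w \<le> u"
  unfolding first_bell_def admits_def by (meson not_le)

lemma admits_iff:
  assumes "first_bell Th c u"
  shows "(\<exists>w. admits Th c w y) \<longleftrightarrow> y \<in> set_decode (psnd (psnd u)) \<or> (\<exists>w\<le>u. Th w y)"
proof
  assume "\<exists>w. admits Th c w y"
  then obtain w where w: "admits Th c w y" by blast
  then have le: "w \<le> u" using admits_le assms by blast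
  show "y \<in> set_decode (psnd (psnd u)) \<or> (\<exists>w\<le>u. Th w y)"
  proof (cases "Th w y")
    case False
    then have b: "bell Th c w" "y \<in> set_decode (psnd (psnd w))" using w by (auto simp: admits_def)
    then have "w = u" using assms le unfolding first_bell_def by (metis le_neq_implies_less)
    then show ?thesis using b by simp
  qed (use le in blast)
next
  assume "y \<in> set_decode (psnd (psnd u)) \<or> (\<exists>w\<le>u. Th w y)"
  then show "\<exists>w. admits Th c w y"
  proof
    assume "y \<in> set_decode (psnd (psnd u))"
    then have "admits Th c u y" using assms by (simp add: admits_def first_bell_def)
    then show ?thesis by blast
  next
    assume "\<exists>w\<le>u. Th w y"
    then obtain w where "w \<le> u" "Th w y" by blast
    then have "admits Th c w y" using assms by (simp add: admits_def first_bell_def)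
    then show ?thesis by blast
  qed
qed

lemma bell_decides:
  assumes u: "first_bell Th c u"
  shows "stage_val Th c u a \<Longrightarrow> PA \<turnstile> inst P (numeral_tm a)"
    and "\<not> stage_val Th c u a \<Longrightarrow> PA \<turnstile> Neg (inst P (numeral_tm a))"
proof -
  have v: "stage_val Th c u a \<longleftrightarrow> (\<exists>y\<le>a. descends c a y \<and> (\<exists>w. admits Th c w y))"
    unfolding stage_val_def admits_iff[OF u] by blast
  {
    assume "stage_val Th c u a"
    then obtain y w where y: "y \<le> a" "descends c a y" "admits Th c w y" unfolding v by blast
    have "\<not> stop t" if "t \<le> w" for t
    proof
      assume "stop t"
      then have "u < t" using stop_after first_bell_unique[OF u] by blast
      then show False using that admits_le[OF u y(3)] by simp
    qed
    then have "sat (\<lambda>_. 0) (inst P (numeral_tm a))" unfolding truth using y by blast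
    then show "PA \<turnstile> inst P (numeral_tm a)" by (rule complete)
  next
    assume n: "\<not> stage_val Th c u a"
    obtain t where "stop t" using stop_iff u by blast
    then show "PA \<turnstile> Neg (inst P (numeral_tm a))"
      by (rule refutes) (use n in \<open>auto simp: v\<close>)
  }
qed

lemma atom_val_decides:
  assumes u: "first_bell Th c u"
  shows "atom_val Th c u (gn \<phi>) = 1 \<Longrightarrow> sentence \<phi> \<and> PA \<turnstile> \<phi>"
    and "atom_val Th c u (gn \<phi>) = 0 \<Longrightarrow> sentence \<phi> \<and> PA \<turnstile> Neg \<phi>"
proof -
  assume "atom_val Th c u (gn \<phi>) = 1"
  then obtain a where "self_app c a = gn \<phi>" "stage_val Th c u a"
    by (auto simp: atom_val_def split: if_splits)
  then show "sentence \<phi> \<and> PA \<turnstile> \<phi>" using bell_decides(1)[OF u] sentence_inst_P by (auto simp: code)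
next
  assume "atom_val Th c u (gn \<phi>) = 0"
  then obtain a where a: "self_app c a = gn \<phi>" "a \<le> gn \<phi>" and n: "\<not> (\<exists>a\<le>gn \<phi>. self_app c a = gn \<phi> \<and> stage_val Th c u a)"
    by (auto simp: atom_val_def split: if_splits)
  then have "\<not> stage_val Th c u a" by blast
  then show "sentence \<phi> \<and> PA \<turnstile> Neg \<phi>" using a bell_decides(2)[OF u] sentence_inst_P by (auto simp: code)
qed

lemma stage_eval_decides:
  assumes u: "first_bell Th c u"
  shows "(stage_eval Th c u (gn \<phi>) = 1 \<longrightarrow> PA \<turnstile> \<phi>) \<and> (stage_eval Th c u (gn \<phi>) = 0 \<longrightarrow> PA \<turnstile> Neg \<phi>)"
proof (induction \<phi>)
  case (Eq s t)
  have "PA \<turnstile> Neg (Eq Zero (Succ Zero))" using PA_numeral_neq[of 0 1] by simp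
  moreover have "stage_eval Th c u (gn (Eq s t)) = (if Eq s t = Eq Zero (Succ Zero) then 0 else 2)"
    by (subst stage_eval.simps) (simp add: gn_inject[symmetric] del: gn_inject gn_tm_inject)
  ultimately show ?case by simp
next
  case (Le s t)
  have "stage_eval Th c u (gn (Le s t)) = 2"
    by (subst stage_eval.simps) simp
  then show ?case by simp
next
  case (Neg \<phi>)
  have "stage_eval Th c u (gn (Neg \<phi>)) = neg3 (stage_eval Th c u (gn \<phi>))"
    by (subst stage_eval.simps) simp
  then show ?case using Neg taut1[of PA \<phi> "Neg (Neg \<phi>)"] by (auto simp: neg3_def split: if_splits)
next
  case (Conj \<phi> \<psi>)
  have e: "stage_eval Th c u (gn (Conj \<phi> \<psi>)) = bin3 3 (stage_eval Th c u (gn \<phi>)) (stage_eval Th c u (gn \<psi>))"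
    by (subst stage_eval.simps) simp
  show ?case unfolding e bin3_def
    using Conj stage_eval_values[of Th c u "gn \<phi>"] stage_eval_values[of Th c u "gn \<psi>"]
      taut2[of PA \<phi> \<psi> "Conj \<phi> \<psi>"] taut1[of PA "Neg \<phi>" "Neg (Conj \<phi> \<psi>)"] taut1[of PA "Neg \<psi>" "Neg (Conj \<phi> \<psi>)"]
    by (auto split: if_splits)
next
  case (Disj \<phi> \<psi>)
  have e: "stage_eval Th c u (gn (Disj \<phi> \<psi>)) = bin3 4 (stage_eval Th c u (gn \<phi>)) (stage_eval Th c u (gn \<psi>))"
    by (subst stage_eval.simps) simp
  show ?case unfolding e bin3_def
    using Disj stage_eval_values[of Th c u "gn \<phi>"] stage_eval_values[of Th c u "gn \<psi>"]
      taut2[of PA "Neg \<phi>" "Neg \<psi>" "Neg (Disj \<phi> \<psi>)"] taut1[of PA \<phi> "Disj \<phi> \<psi>"] taut1[of PA \<psi> "Disj \<phi> \<psi>"]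
    by (auto split: if_splits)
next
  case (Imp \<phi> \<psi>)
  have e: "stage_eval Th c u (gn (Imp \<phi> \<psi>)) = bin3 5 (stage_eval Th c u (gn \<phi>)) (stage_eval Th c u (gn \<psi>))"
    by (subst stage_eval.simps) simp
  show ?case unfolding e bin3_def
    using Imp stage_eval_values[of Th c u "gn \<phi>"] stage_eval_values[of Th c u "gn \<psi>"]
      taut2[of PA \<phi> "Neg \<psi>" "Neg (Imp \<phi> \<psi>)"] taut1[of PA "Neg \<phi>" "Imp \<phi> \<psi>"] taut1[of PA \<psi> "Imp \<phi> \<psi>"]
    by (auto split: if_splits)
next
  case (Forall \<phi>)
  have e: "stage_eval Th c u (gn (Forall \<phi>)) = atom_val Th c u (gn \<phi>)"
    by (subst stage_eval.simps) simp
  \<comment> \<open>The quantifier is vacuous over a sentence, so refuting the body refutes the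
    formula.\<close>
  have "PA \<turnstile> Neg (Forall \<phi>)" if "sentence \<phi>" "PA \<turnstile> Neg \<phi>"
  proof -
    have "PA \<turnstile> Imp (Forall \<phi>) \<phi>"
      using proves.logical[OF forall_elim[of \<phi> Zero], of PA] that(1) by (simp add: inst_def subst_sentence)
    then show ?thesis by (rule taut2[OF that(2)]) auto
  qed
  then show ?case unfolding e using atom_val_decides[OF u, of \<phi>] by (auto intro: proves.gen)
next
  case (Exists \<phi>)
  have "stage_eval Th c u (gn (Exists \<phi>)) = atom_val Th c u (gn (Exists \<phi>))"
    by (subst stage_eval.simps) simp
  then show ?case using atom_val_decides[OF u, of "Exists \<phi>"] by auto
qed

lemma no_bell: "\<not> bell Th c u"
proof
  assume "bell Th c u"
  define u0 where "u0 = (LEAST u. bell Th c u)"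
  have b: "bell Th c u0" unfolding u0_def using \<open>bell Th c u\<close> by (rule LeastI)
  then have f: "first_bell Th c u0"
    unfolding first_bell_def u0_def using not_less_Least by blast
  obtain \<beta> where \<beta>: "T \<turnstile> \<beta>" "pfst u0 = gn \<beta>" using b Th_iff[of "pfst u0"] by (auto simp: bell_def)
  then have "PA \<turnstile> Neg \<beta>" using stage_eval_decides[OF f, of \<beta>] b by (simp add: bell_def)
  then show False using \<beta>(1) consistent T_PA by (auto simp: consistent_def)
qed

lemma sat_P_iff: "sat e (inst P (numeral_tm a)) \<longleftrightarrow> (\<exists>\<phi>. T \<turnstile> \<phi> \<and> a = gn \<phi>)"
proof -
  have "\<not> stop t" for t using stop_iff no_bell by (auto simp: first_bell_def)
  then have eq: "sat e (inst P (numeral_tm a)) \<longleftrightarrow> (\<exists>y\<le>a. descends c a y \<and> (\<exists>\<phi>. T \<turnstile> \<phi> \<and> y = gn \<phi>))" for a e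
    unfolding truth Th_iff[symmetric] using no_bell by (auto simp: admits_def)
  have thm_sat: "sat e (inst P (numeral_tm (gn \<phi>)))" if "T \<turnstile> \<phi>" for \<phi> e
    unfolding eq using that descends_refl by blast
  have "\<exists>\<psi>. T \<turnstile> \<psi> \<and> iter_app c i (gn \<phi>) = gn \<psi>" if "T \<turnstile> \<phi>" for i \<phi>
  proof (induction i)
    case 0 then show ?case using that by auto
  next
    case (Suc i)
    then obtain \<psi> where \<psi>: "T \<turnstile> \<psi>" "iter_app c i (gn \<phi>) = gn \<psi>" by blast
    then have "T \<turnstile> inst P (numeral_tm (gn \<psi>))" using T_PA complete thm_sat by blast
    then show ?case using \<psi>(2) by (auto simp: code)
  qed
  then show ?thesis using eq thm_sat by (auto simp: descends_iff)
qed

lemma provability_predicate: "provability_predicate T P"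
  unfolding provability_predicate_def apply_code_def
proof (intro conjI allI fv_P)
  fix \<phi>
  show "T \<turnstile> \<phi> \<longleftrightarrow> PA \<turnstile> inst P (numeral_tm (gn \<phi>))"
    using sat_P_iff[of _ "gn \<phi>"] complete PA_sound by (metis gn_inject)
qed

lemma PA_tautology:
  assumes f: "arith_interpretation P f" and A: "tautology A"
  shows "PA \<turnstile> f A"
proof -
  \<comment> \<open>A first-order valuation induces a modal one through \<open>f\<close>. The two
    agree on \<open>MBot\<close> only if \<open>v\<close> rejects
    \<open>Eq Zero (Succ Zero)\<close>, and that sentence is refuted in \<open>PA\<close>.\<close>
  have "bool_eval (\<lambda>B. ev v (f B)) B = ev v (f B)" if "\<not> v (Eq Zero (Succ Zero))" for v B
    using f that by (induction B) (auto simp: arith_interpretation_def)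
  then have "ev v (f A)" if "\<not> v (Eq Zero (Succ Zero))" for v
    using A that unfolding tautology_def by metis
  moreover have "PA \<turnstile> Neg (Eq Zero (Succ Zero))" using PA_numeral_neq[of 0 1] by simp
  ultimately show ?thesis by (auto intro: taut1)
qed

lemma soundness:
  assumes f: "arith_interpretation P f" and A: "N4 A"
  shows "PA \<turnstile> f A"
  using A unfolding N4_def
proof induction
  case (taut A) then show ?case by (rule PA_tautology[OF f])
next
  case (extra A)
  then obtain B where "A = MImp (Box B) (Box (Box B))" by blast
  then have "f A = Imp (inst P (numeral_tm (gn (f B)))) (inst P (numeral_tm (self_app c (gn (f B)))))"
    using f by (simp add: arith_interpretation_def apply_code_def code)
  then show ?case using four by simp
next
  case (mp A B)
  then show ?case using f proves.mp by (auto simp: arith_interpretation_def)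
next
  case (nec A)
  then have "PA \<turnstile> apply_code P (f A)" using provability_predicate T_PA by (auto simp: provability_predicate_def)
  then show ?case using f by (simp add: arith_interpretation_def)
qed

section \<open>The interpretation inside the locale\<close>

lemma arith_interpretation_interp: "arith_interpretation P (interp P)"
proof -
  have "sentence (interp P A)" for A
  proof (induction A)
    case (MVar n)
    then show ?case using sentence_inst_P[of "prod_encode (8, n)"] by (auto simp: sentence_def)
  next
    case (Box A) then show ?case using sentence_inst_P by (simp add: apply_code_def)
  qed (auto simp: sentence_def)
  then show ?thesis by (simp add: arith_interpretation_def)
qed

text \<open>Instances of \<open>P\<close> begin with \<open>Exists\<close>; among interpreted
  formulas only those of boxes do, since variables are hidden behind \<open>Forall\<close>.\<close>

lemma interp_eq_inst_P: "interp P A = inst P (numeral_tm a) \<Longrightarrow> \<exists>B. A = Box B \<and> a = gn (interp P B)"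
  using inst_P_Exists[of a] inst_P_inject by (cases A) (auto simp: apply_code_def)

text \<open>Different modal formulas must receive different codes; otherwise a finite set of codes
  could not prescribe the truth values of boxes independently.\<close>

lemma interp_inject: "interp P A = interp P B \<Longrightarrow> A = B"
proof (induction A arbitrary: B)
  case (MVar n)
  then show ?case
  proof (cases B)
    case (MVar m)
    then show ?thesis using MVar.prems inst_P_inject by fastforce
  next
    case (Box C)
    then show ?thesis using MVar.prems inst_P_Exists[of "gn (interp P C)"] by (auto simp: apply_code_def)
  qed auto
next
  case (Box A)
  then obtain C where "B = Box C" "gn (interp P A) = gn (interp P C)"
    using interp_eq_inst_P[of B "gn (interp P A)"] by (auto simp: apply_code_def)
  then show ?case using Box.IH by simp
next
  case MBot
  then show ?case using inst_P_Exists by (cases B) (auto simp: apply_code_def, metis fm.distinct(13))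
next
  case (MNeg A)
  then show ?case using interp_eq_inst_P[of "MNeg A"] by (cases B) (auto simp: apply_code_def)
next
  case (MConj A A')
  then show ?case using interp_eq_inst_P[of "MConj A A'"] by (cases B) (auto simp: apply_code_def)
next
  case (MDisj A A')
  then show ?case using interp_eq_inst_P[of "MDisj A A'"] by (cases B) (auto simp: apply_code_def)
next
  case (MImp A A')
  then show ?case using interp_eq_inst_P[of "MImp A A'"] by (cases B) (auto simp: apply_code_def)
qed

text \<open>Descent from an interpreted formula is the stripping of boxes. The closure taken in
  \<open>stage_val\<close> thus corresponds to the iterated axiom 4 in
  \<open>N4_valuation\<close>.\<close>

lemma iter_app_interp:
  "iter_app c i y = gn (interp P A) \<Longrightarrow> \<exists>B. A = (Box ^^ i) B \<and> y = gn (interp P B)"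
proof (induction i arbitrary: A)
  case 0 then show ?case by auto
next
  case (Suc i)
  then have "interp P A = inst P (numeral_tm (iter_app c i y))" by (simp add: code)
  then obtain B where "A = Box B" "iter_app c i y = gn (interp P B)" using interp_eq_inst_P by blast
  then show ?case using Suc.IH by fastforce
qed

lemma atom_val_code: "atom_val Th c u (self_app c a) = (if stage_val Th c u a then 1 else 0)"
proof -
  have "self_app c b = self_app c a \<longleftrightarrow> b = a" for b using inst_P_inject by (auto simp: code)
  then show ?thesis using less_code[of a] by (auto simp: atom_val_def)
qed

text \<open>A non-theorem \<open>B\<close> of least size with \<open>T \<turnstile> f(B)\<close> rings a bell: the boxed subformulas of \<open>B\<close> that
  the proposed valuation makes true because of theorems of \<open>T\<close> are theorems of \<open>N4\<close> by minimality, so the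
  proposed valuation can agree on \<open>B\<close> with one that refutes \<open>B\<close>.\<close>

lemma completeness: "T \<turnstile> interp P A \<Longrightarrow> N4 A"
proof (induction A rule: measure_induct_rule[of size])
  case (less B)
  show ?case
  proof (rule ccontr)
    assume "\<not> N4 B"
    then obtain v where v: "\<not> bool_eval v B" "\<And>C. Box C \<in> subs B \<Longrightarrow> N4 C \<Longrightarrow> v (Box C)"
      "\<And>C i. Box C \<in> subs B \<Longrightarrow> Box ((Box ^^ i) C) \<in> subs B \<Longrightarrow> v (Box C) \<Longrightarrow> v (Box ((Box ^^ i) C))"
      using N4_valuation by blast
    \<comment> \<open>The proposal of the bell: codes of the \<open>C\<close> whose box is true
      under \<open>v\<close>, and the reserved numbers of the true variables.\<close>
    define L where "L = (\<lambda>C. gn (interp P C)) ` {C. Box C \<in> subs B \<and> v (Box C)} \<union>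
      (\<lambda>n. prod_encode (8, n)) ` {n. MVar n \<in> subs B \<and> v (MVar n)}"
    have "finite L"
    proof -
      have "finite {C. Box C \<in> subs B}" "finite {n. MVar n \<in> subs B}"
        using finite_vimageI[OF finite_subs[of B], of Box] finite_vimageI[OF finite_subs[of B], of MVar]
        by (auto simp: vimage_def inj_def)
      then show ?thesis unfolding L_def by simp
    qed
    obtain w where w: "Th w (gn (interp P B))" using Th_iff less.prems by blast
    define u where "u = prod_encode (gn (interp P B), prod_encode (w, set_encode L))"
    have L: "set_decode (psnd (psnd u)) = L" using \<open>finite L\<close> by (simp add: u_def)
    have sv: "stage_val Th c u a \<longleftrightarrow> (\<exists>i y. iter_app c i y = a \<and> (y \<in> L \<or> (\<exists>w\<le>u. Th w y)))" for a
      unfolding stage_val_def L using descends_le by (auto simp: descends_iff)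
    have box: "stage_val Th c u (gn (interp P C)) \<longleftrightarrow> v (Box C)" if C: "Box C \<in> subs B" for C
    proof
      assume "v (Box C)"
      then have "gn (interp P C) \<in> L" using C by (auto simp: L_def)
      then show "stage_val Th c u (gn (interp P C))" unfolding sv using iter_app_simps(1) by blast
    next
      assume "stage_val Th c u (gn (interp P C))"
      then obtain i y where iy: "iter_app c i y = gn (interp P C)" "y \<in> L \<or> (\<exists>w\<le>u. Th w y)"
        unfolding sv by blast
      then obtain D where D: "C = (Box ^^ i) D" "y = gn (interp P D)" using iter_app_interp by blast
      from iy(2) show "v (Box C)"
      proof
        assume "y \<in> L"
        then obtain E where "Box E \<in> subs B" "v (Box E)" "interp P D = interp P E"
          using D(2) gn_neq_8 by (auto simp: L_def)
        then show ?thesis using v(3)[of E i] C D(1) interp_inject by blast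
      next
        assume "\<exists>w\<le>u. Th w y"
        then obtain \<phi> where "T \<turnstile> \<phi>" "y = gn \<phi>" using Th_iff[of y] by blast
        then have "T \<turnstile> interp P D" using D(2) by simp
        \<comment> \<open>\<open>D\<close> lies inside \<open>C\<close>, and \<open>Box C\<close>
          inside \<open>B\<close>, so minimality makes \<open>D\<close> a theorem of
          \<open>N4\<close>; necessitation then leads to \<open>C\<close>.\<close>
        moreover have "size D < size B" using size_subs[OF C] size_Box_pow[of D i] D(1) by simp
        ultimately have "N4 C" unfolding D(1) using less.IH N4_Box_pow by blast
        then show ?thesis using v(2) C by blast
      qed
    qed
    have var: "stage_val Th c u (prod_encode (8, n)) \<longleftrightarrow> v (MVar n)" if n: "MVar n \<in> subs B" for n
    proof -
      \<comment> \<open>A descent of positive length ends in the code of a formula, which never has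
        tag 8.\<close>
      have "iter_app c i y = prod_encode (8, n) \<longleftrightarrow> i = 0 \<and> y = prod_encode (8, n)" for i y
        using gn_neq_8 by (cases i) (auto simp: code)
      then have "stage_val Th c u (prod_encode (8, n)) \<longleftrightarrow>
          prod_encode (8, n) \<in> L \<or> (\<exists>w\<le>u. Th w (prod_encode (8, n)))" unfolding sv by auto
      moreover have "\<not> Th w (prod_encode (8, n))" for w using Th_iff[of "prod_encode (8, n)"] gn_neq_8 by metis
      moreover have "prod_encode (8, n) \<in> L \<longleftrightarrow> v (MVar n)"
        using n gn_neq_8 by (auto simp: L_def) (metis gn_neq_8)
      ultimately show ?thesis by simp
    qed
    have "subs D \<subseteq> subs B \<Longrightarrow> stage_eval Th c u (gn (interp P D)) = (if bool_eval v D then 1 else 0)" for D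
    proof (induction D)
      case (MVar n)
      have "stage_eval Th c u (gn (interp P (MVar n))) = atom_val Th c u (self_app c (prod_encode (8, n)))"
        by (subst stage_eval.simps) (simp add: code)
      then show ?case using MVar var by (simp add: atom_val_code)
    next
      case MBot
      show ?case by (subst stage_eval.simps) simp
    next
      case (MNeg D)
      then show ?case by (subst stage_eval.simps) (auto simp: neg3_def)
    next
      case (MConj D E)
      then show ?case by (subst stage_eval.simps) (auto simp: bin3_def)
    next
      case (MDisj D E)
      then show ?case by (subst stage_eval.simps) (auto simp: bin3_def)
    next
      case (MImp D E)
      then show ?case by (subst stage_eval.simps) (auto simp: bin3_def)
    next
      case (Box D)
      obtain \<chi> where \<chi>: "interp P (Box D) = Exists \<chi>" using inst_P_Exists by (auto simp: apply_code_def)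
      have "stage_eval Th c u (gn (interp P (Box D))) = atom_val Th c u (gn (interp P (Box D)))"
        unfolding \<chi> by (subst stage_eval.simps) simp
      then show ?case using Box.prems box by (simp add: atom_val_code apply_code_def flip: code)
    qed
    from this[of B] have "stage_eval Th c u (gn (interp P B)) = 0" using v(1) by simp
    then have "bell Th c u" using w by (simp add: bell_def u_def)
    then show False using no_bell by blast
  qed
qed

end

theorem theorem5p1:
  fixes T :: "fm set"
  assumes "prim_rec_axiomatized_theory T"
    and "consistent T"
    and "contains_theory T PA"
  shows "\<exists>Pr. Sigma1 Pr \<and> provability_predicate T Pr \<and>
    (\<forall>A f. arith_interpretation Pr f \<longrightarrow> N4 A \<longrightarrow> PA \<turnstile> f A) \<and>
    (\<exists>f. arith_interpretation Pr f \<and> (\<forall>A. N4 A \<longleftrightarrow> T \<turnstile> f A))"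
proof -
  obtain Th where Th: "dec (\<lambda>e. Th (e 0) (e 1))" "\<And>y. (\<exists>w. Th w y) \<longleftrightarrow> (\<exists>\<phi>. T \<turnstile> \<phi> \<and> y = gn \<phi>)"
    using theorem_witnesses[OF assms(1)] by blast
  \<comment> \<open>After the witness, the variables of \<open>\<delta>\<close> are
    \<open>y\<close>, \<open>c\<close>, \<open>x\<close>, and those of \<open>\<alpha>\<close> below
    are \<open>w\<close>, \<open>y\<close>, \<open>c\<close>, in the order in which
    \<open>pr_matrix\<close> substitutes.\<close>
  obtain \<delta> where \<delta>: "Delta0 \<delta>" "\<And>e. descends (e 1) (e 2) (e 0) \<Longrightarrow> \<exists>s. sat (case_nat s e) \<delta>"
    "\<And>e s. \<not> descends (e 1) (e 2) (e 0) \<Longrightarrow> \<not> sat (case_nat s e) \<delta>"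
    "\<And>e. \<not> descends (e 1) (e 2) (e 0) \<Longrightarrow> PA \<turnstile> Neg (subst (case_nat (Var 0) (num e)) \<delta>)"
    by (rule rosser[OF dec_descends[OF cf_var[of 1] cf_var[of 2] cf_var[of 0]]]) blast
  obtain \<alpha> where \<alpha>: "Delta0 \<alpha>" "\<And>e. admits Th (e 2) (e 0) (e 1) \<Longrightarrow> \<exists>s. sat (case_nat s e) \<alpha>"
    "\<And>e s. \<not> admits Th (e 2) (e 0) (e 1) \<Longrightarrow> \<not> sat (case_nat s e) \<alpha>"
    "\<And>e. \<not> admits Th (e 2) (e 0) (e 1) \<Longrightarrow> PA \<turnstile> Neg (subst (case_nat (Var 0) (num e)) \<alpha>)"
    by (rule rosser[OF dec_admits[OF Th(1) cf_var[of 2] cf_var[of 0] cf_var[of 1]]]) blast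
  obtain \<tau> where \<tau>: "Delta0 \<tau>" "\<And>c. (\<exists>t. sat (case_nat t (env1 c)) \<tau>) \<longleftrightarrow> (\<exists>u. first_bell Th c u)"
    "\<And>t c. sat (case_nat t (env1 c)) \<tau> \<Longrightarrow> \<exists>u<t. first_bell Th c u"
    using stop_formula[OF dec_re[OF dec_first_bell[OF Th(1) cf_var[of 1] cf_var[of 0]]]] by blast
  define \<Psi> where "\<Psi> = pr_formula \<delta> \<alpha> \<tau>"
  \<comment> \<open>The diagonal step: \<open>\<Psi>\<close> receives its own code as parameter, so
    \<open>self_app c\<close> yields the codes of the instances of \<open>P\<close>, and the
    relations in \<open>\<Psi>\<close> speak about \<open>P\<close> itself.\<close>
  define c where "c = gn \<Psi>"
  define P where "P = inst \<Psi> (numeral_tm c)"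
  have P: "inst P (numeral_tm a) = subst (num (env2 c a)) (pr_formula \<delta> \<alpha> \<tau>)" for a
    by (simp add: P_def \<Psi>_def inst_pr_formula)
  have sigma: "Sigma1 P"
    unfolding P_def \<Psi>_def inst_def by (intro Sigma1_subst Sigma1_pr_formula \<delta>(1) \<alpha>(1) \<tau>(1))
  have env [simp]: "env2 c a 0 = c" "env2 c a (Suc 0) = a" "env1 c 0 = c" for a
    by (simp_all add: env1_def env2_def)
  have d: "(\<exists>s. sat (case_nat s (case_nat y (env2 c a))) \<delta>) \<longleftrightarrow> descends c a y" for y a
    using \<delta>(2,3)[of "case_nat y (env2 c a)"] by (auto simp: numeral_2_eq_2)
  have a: "(\<exists>s. sat (case_nat s (case_nat w (case_nat y (env1 c)))) \<alpha>) \<longleftrightarrow> admits Th c w y" for w y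
    using \<alpha>(2,3)[of "case_nat w (case_nat y (env1 c))"] by (auto simp: numeral_2_eq_2)
  interpret numeration T P Th c "\<lambda>t. sat (case_nat t (env1 c)) \<tau>"
  proof
    show "fv P \<subseteq> {0}"
    proof
      fix i assume "i \<in> fv P"
      then obtain j where "j \<in> fv \<Psi>" "i \<in> fv_tm (case_nat (numeral_tm c) Var j)"
        by (auto simp: P_def inst_def fv_subst)
      then show "i \<in> {0}" using fv_pr_formula[of \<delta> \<alpha> \<tau>] by (auto simp: \<Psi>_def split: nat.splits)
    qed
    show "self_app c x = gn (inst P (numeral_tm x))" for x
      unfolding P_def c_def by (rule self_app_gn)
    then show "x < self_app c x" for x using less_gn_pr_formula by (simp add: P)
    show "\<exists>\<chi>. inst P (numeral_tm x) = Exists \<chi>" for x by (simp add: P subst_pr_formula)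
    \<comment> \<open>The conjunct that bounds the descended number displays the numeral of the
      argument.\<close>
    show "x = y" if "inst P (numeral_tm x) = inst P (numeral_tm y)" for x y
      using that by (simp add: P subst_pr_formula pr_matrix_at_def)
    show "sat e (inst P (numeral_tm x)) \<longleftrightarrow> (\<exists>y\<le>x. descends c x y \<and>
        (\<exists>w. admits Th c w y \<and> (\<forall>t\<le>w. \<not> sat (case_nat t (env1 c)) \<tau>)))" for e x
      unfolding P sat_pr_formula d a ..
    show "PA \<turnstile> inst P (numeral_tm x)" if "sat e (inst P (numeral_tm x))" for e x
    proof -
      have "sat (env2 c x) (pr_formula \<delta> \<alpha> \<tau>)" using that by (simp add: P sat_subst)
      then show ?thesis unfolding P
        by (rule Sigma1_complete[OF Sigma1_pr_formula[OF \<delta>(1) \<alpha>(1) \<tau>(1)]])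
    qed
    show "PA \<turnstile> Imp (inst P (numeral_tm x)) (inst P (numeral_tm x'))"
      if "\<And>y. y \<le> x \<Longrightarrow> descends c x y \<Longrightarrow> y \<le> x' \<and> descends c x' y" for x x'
      unfolding P
    proof (rule pr_mono[where RD = "\<lambda>y c x. descends c x y"])
      show "PA \<turnstile> Neg (subst (case_nat (Var 0) (num (case_nat y (env2 c x)))) \<delta>)" if "\<not> descends c x y" for y x
        using \<delta>(4)[of "case_nat y (env2 c x)"] that by (simp add: numeral_2_eq_2)
    qed (use that \<delta>(1) d in auto)
    show "PA \<turnstile> Neg (inst P (numeral_tm x))"
      if "sat (case_nat t (env1 c)) \<tau>" "\<And>y w. y \<le> x \<Longrightarrow> descends c x y \<Longrightarrow> w \<le> t \<Longrightarrow> \<not> admits Th c w y" for t x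
      unfolding P
    proof (rule pr_refute[where RD = "\<lambda>y c x. descends c x y" and RA = "\<lambda>w y c. admits Th c w y"])
      show "PA \<turnstile> Neg (subst (case_nat (Var 0) (num (case_nat y (env2 c x)))) \<delta>)" if "\<not> descends c x y" for y x
        using \<delta>(4)[of "case_nat y (env2 c x)"] that by (simp add: numeral_2_eq_2)
      show "PA \<turnstile> Neg (subst (case_nat (Var 0) (num (case_nat w (case_nat y (env1 c))))) \<alpha>)" if "\<not> admits Th c w y" for w y
        using \<alpha>(4)[of "case_nat w (case_nat y (env1 c))"] that by (simp add: numeral_2_eq_2)
    qed (use that \<tau>(1) in auto)
  qed (use assms Th(2) \<tau>(2,3) in auto)
  show ?thesis
    using sigma provability_predicate soundness arith_interpretation_interp completeness T_PA by blast
qed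

end
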